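(* Let $\mathbf M$ be a $\mathcal D$-based total structure with structural reduct $\mathbf M^\flat$ in $\mathcal D$, let $\widetilde{\mathbf M}$ be a total structure with topology that is an alter ego of $\mathbf M$, and let $\mathcal A=\mathbb{ISP}(\mathbf M)$ and $\mathcal X=\mathbb{IS}_c\mathbb P^+(\widetilde{\mathbf M})$. Assume there is an order relation $\leqslant$ that is conjunct-atomic definable from $\widetilde{\mathbf M}$ such that $\widetilde{\mathbf M}^\flat=\langle M;\leqslant,\mathcal T\rangle$ is a Priestley space (where $\mathcal T$ is the topology of $\widetilde{\mathbf M}$), and that there exists $\omega\in\mathcal D(\mathbf M^\flat,\mathbf D)\cap\mathcal P(\widetilde{\mathbf M}^\flat,\widetilde{\mathbf D})$ such that (1) $\widetilde{\mathbf M}$ entails each binary relation $r$ on $M$ which forms a substructure of $\mathbf M^2$ that is maximal in $(\omega,\omega)^{-1}(\leqslant)$, (2) $\omega\circ\mathrm{Clo}_1(\widetilde{\mathbf M})$ separates the points of $M$, and (3) $\omega\circ\mathrm{Clo}_1(\mathbf M)$ separates the structure $\widetilde{\mathbf M}^\flat$, that is, if $a\not\leqslant b$ in $\widetilde{\mathbf M}^\flat$, then there exists $t\in\mathrm{Clo}_1(\mathbf M)$ such that $\omega(t(a))=1$ and $\omega(t(b))=0$. Then: (a) $\widetilde{\mathbf M}$ fully dualises $\mathbf M$; (b) $\mathbf M$ is injective in $\mathcal A$ and $\widetilde{\mathbf M}$ is injective in $\mathcal X$, and consequently the duality is strong; (c) for all $\mathbf A\in\mathcal A$ and all $\mathbf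 X\in\mathcal X$, $\mathrm D(\mathbf A)^\flat\cong\mathrm H(\mathbf A^\flat)$ in $\mathcal P$ and $\mathrm E(\mathbf X)^\flat\cong\mathrm K(\mathbf X^\flat)$ in $\mathcal D$, via the maps $\mathcal A(\mathbf A,\mathbf M)\to\mathcal D(\mathbf A^\flat,\mathbf D)$, $x\mapsto\omega\circ x$, and $\mathcal X(\mathbf X,\widetilde{\mathbf M})\to\mathcal P(\mathbf X^\flat,\widetilde{\mathbf D})$, $\alpha\mapsto\omega\circ\alpha$, respectively.
   Context: **Structures.** A total structure is $\mathbf M=\langle M;G,R\rangle$ with $M$ a non-empty set, $G$ a set of finitary operations (nullary allowed) and $R$ a set of finitary non-empty relations on $M$; $G$ or $R$ may be empty. Operations and relations are lifted pointwise to powers. A substructure is a subset closed under the operations, with the restricted relations; substructures of structures without topology are non-empty. Homomorphisms preserve all operations and relations. A total structure with topology $\widetilde{\mathbf M}=\langle M;G,R,\mathcal T\rangle$ also carries a compact Hausdorff topology $\mathcal T$ on $M$ (no compatibility of structure and topology is assumed); purely structural notions applied to $\widetilde{\mathbf M}$ (term functions, definability, etc.) refer to the structure with the topology removed. **Classes.** $\mathbb{ISP}(\mathbf M)$ is the category of all (non-empty) structures isomorphic to substructures of powers of $\mathbf M$, with homomorphisms as morphisms. $\mathbb{IS}_c\mathbb P^+(\widetilde{\mathbf M})$ is the category of all structures with topology isomorphic to topologically closed substructures of powers $\widetilde{\mathbf M}^S$ with $S\neq\varnothing$ (product topology), with continuous homomorphisms as morphisms; the empty structure belongs to it if the type of $\widetilde{\mathbf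 M}$ has no nullary operations. $\mathcal C(\mathbf A,\mathbf B)$ denotes the set of morphisms in a category $\mathcal C$. Embeddings are isomorphisms onto substructures in $\mathbb{ISP}(\mathbf M)$ and isomorphisms onto topologically closed substructures in $\mathbb{IS}_c\mathbb P^+(\widetilde{\mathbf M})$; injectivity is with respect to these embeddings. **Alter egos.** $\widetilde{\mathbf M}=\langle M;G_2,R_2,\mathcal T\rangle$ is an alter ego of $\mathbf M=\langle M;G_1,R_1\rangle$ if each $n$-ary $r\in R_2$ forms a substructure of $\mathbf M^n$, each $n$-ary $g\in G_2$ is a homomorphism $\mathbf M^n\to\mathbf M$, each relation in $R_1$ is topologically closed and each operation in $G_1$ is continuous with respect to $\mathcal T$. **Dualities.** For $\mathbf A\in\mathcal A$, $\mathcal A(\mathbf A,\mathbf M)$ is a closed substructure of $\widetilde{\mathbf M}^A$, giving $\mathrm D(\mathbf A)\in\mathcal X$; for $\mathbf X\in\mathcal X$, $\mathcal X(\mathbf X,\widetilde{\mathbf M})$ is a substructure of $\mathbf M^X$, giving $\mathrm E(\mathbf X)\in\mathcal A$. The evaluation maps are $e_{\mathbf A}\colon\mathbf A\to\mathrm{ED}(\mathbf A)$, $e_{\mathbf A}(a)(x)=x(a)$, and $\varepsilon_{\mathbf X}\colon\mathbf X\to\mathrm{DE}(\mathbf X)$, $\varepsilon_{\mathbf X}(x)(\alpha)=\alpha(x)$. $\widetilde{\mathbf M}$ fully dualises $\mathbf M$ if $e_{\mathbf A}$ and $\varepsilon_{\mathbf X}$ are isomorphisms for all $\mathbf A\in\mathcal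 A$, $\mathbf X\in\mathcal X$; the duality is strong if moreover $\widetilde{\mathbf M}$ is injective in $\mathcal X$. **Distributive lattices.** $\mathcal D$ is the category of bounded distributive lattices with bounded lattice homomorphisms, $\mathbf D$ is the two-element bounded lattice on $\{0,1\}$, $\mathcal D=\mathbb{ISP}(\mathbf D)$. $\widetilde{\mathbf D}=\langle\{0,1\};\leqslant,\mathcal T\rangle$ is the two-element chain with the discrete topology, and $\mathcal P=\mathbb{IS}_c\mathbb P^+(\widetilde{\mathbf D})$ is the category of Priestley spaces (continuous order-preserving maps). $\mathrm H(\mathbf L)=\mathcal D(\mathbf L,\mathbf D)$, a closed substructure of $\widetilde{\mathbf D}^L$, and $\mathrm K(\mathbf Y)=\mathcal P(\mathbf Y,\widetilde{\mathbf D})$, a sublattice of $\mathbf D^Y$. A total structure $\mathbf M$ is $\mathcal D$-based if it has a structural reduct $\mathbf M^\flat=\langle M;\vee,\wedge,0,1\rangle$ in $\mathcal D$, i.e. $\vee,\wedge,0,1$ are term functions of $\mathbf M$ (of arities $2,2,0,0$) making $M$ a bounded distributive lattice; then each $\mathbf A\in\mathcal A$ has a reduct $\mathbf A^\flat\in\mathcal D$ given by the same terms. A relation is conjunct-atomic definable from $\widetilde{\mathbf M}$ if it is the set of tuples satisfying a finite conjunction of atomic formulas (with equality) in the language of $\widetilde{\mathbf M}$; each $\mathbf X\in\mathcal X$ has a reduct $\mathbf X^\flat\in\mathcal P$ given by the formula defining $\leqslant$. **Other notation.** $\mathrm{Clo}_1(\cdot)$ is the set of unary term functions; $\omega\circ\mathcal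 E=\{\omega\circ u\mid u\in\mathcal E\}$; a set $Z$ of maps on $M$ separates the points of $M$ if for $a\neq b$ in $M$ some $z\in Z$ has $z(a)\ne z(b)$. $(\omega,\omega)^{-1}(\leqslant)=\{(a,b)\in M^2\mid\omega(a)\leqslant\omega(b)\text{ in }\{0,1\}\}$; maximality is among substructures of $\mathbf M^2$ contained in this set. $\widetilde{\mathbf M}$ entails $r\subseteq M^n$ if $r$ forms a substructure of $\mathbf M^n$ and, for all $\mathbf A\in\mathcal A$, every $\mathcal X$-morphism $\alpha\colon\mathcal A(\mathbf A,\mathbf M)\to\widetilde{\mathbf M}$ preserves $r$ (lifted pointwise). *)

theory Defs
  imports "HOL-Analysis.Analysis"
begin

section \<open>Structures and structures with topology\<close>

text \<open>
  Types of structures are given by operation and relation symbols with arities, so that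
  structures of the same type can be compared.  An \<open>n\<close>-tuple over \<open>C\<close> is an extensional function
  on \<open>{..<n}\<close>; thus \<open>C\<^sup>n\<close> is the power of \<open>C\<close> with index set \<open>{..<n}\<close>, and the only
  \<open>0\<close>-tuple is \<open>\<lambda>_. undefined\<close>.  Operations and relations of a structure only matter at the symbols
  of its type and on tuples over the carrier.
\<close>

abbreviation tuples :: "nat \<Rightarrow> 'a set \<Rightarrow> (nat \<Rightarrow> 'a) set" where
  "tuples n C \<equiv> {..<n} \<rightarrow>\<^sub>E C"

definition pair :: "'a \<Rightarrow> 'a \<Rightarrow> nat \<Rightarrow> 'a" where
  "pair a b = (\<lambda>i\<in>{..<2}. if i = 0 then a else b)"

record ('f, 'r) signature =
  ops :: "'f set"
  opar :: "'f \<Rightarrow> nat"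
  rels :: "'r set"
  relar :: "'r \<Rightarrow> nat"

record ('a, 'f, 'r) struc =
  carrier :: "'a set"
  opn :: "'f \<Rightarrow> (nat \<Rightarrow> 'a) \<Rightarrow> 'a"
  rel :: "'r \<Rightarrow> (nat \<Rightarrow> 'a) set"

record ('a, 'f, 'r) tstruc = "('a, 'f, 'r) struc" +
  topo :: "'a topology"

definition is_struc :: "('f, 'r) signature \<Rightarrow> ('a, 'f, 'r, 'z) struc_scheme \<Rightarrow> bool" where
  "is_struc \<Sigma> A \<longleftrightarrow>
     (\<forall>f\<in>ops \<Sigma>. \<forall>x\<in>tuples (opar \<Sigma> f) (carrier A). opn A f x \<in> carrier A) \<and>
     (\<forall>r\<in>rels \<Sigma>. rel A r \<subseteq> tuples (relar \<Sigma> r) (carrier A))"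

definition total_struc :: "('f, 'r) signature \<Rightarrow> ('a, 'f, 'r, 'z) struc_scheme \<Rightarrow> bool" where
  "total_struc \<Sigma> M \<longleftrightarrow>
     is_struc \<Sigma> M \<and> carrier M \<noteq> {} \<and> (\<forall>r\<in>rels \<Sigma>. rel M r \<noteq> {})"

definition total_tstruc :: "('f, 'r) signature \<Rightarrow> ('a, 'f, 'r) tstruc \<Rightarrow> bool" where
  "total_tstruc \<Sigma> M \<longleftrightarrow>
     total_struc \<Sigma> M \<and> topspace (topo M) = carrier M \<and>
     compact_space (topo M) \<and> Hausdorff_space (topo M)"

definition hom ::
  "('f, 'r) signature \<Rightarrow> ('a, 'f, 'r, 'y) struc_scheme \<Rightarrow> ('b, 'f, 'r, 'z) struc_scheme \<Rightarrow> ('a \<Rightarrow> 'b) set"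
where
  "hom \<Sigma> A B = {h \<in> carrier A \<rightarrow>\<^sub>E carrier B.
     (\<forall>f\<in>ops \<Sigma>. \<forall>x\<in>tuples (opar \<Sigma> f) (carrier A).
        h (opn A f x) = opn B f (compose {..<opar \<Sigma> f} h x)) \<and>
     (\<forall>r\<in>rels \<Sigma>. \<forall>x\<in>rel A r. compose {..<relar \<Sigma> r} h x \<in> rel B r)}"

definition thom ::
  "('f, 'r) signature \<Rightarrow> ('a, 'f, 'r) tstruc \<Rightarrow> ('b, 'f, 'r) tstruc \<Rightarrow> ('a \<Rightarrow> 'b) set"
where
  "thom \<Sigma> X Y = {h \<in> hom \<Sigma> X Y. continuous_map (topo X) (topo Y) h}"

definition isom ::
  "('f, 'r) signature \<Rightarrow> ('a, 'f, 'r, 'y) struc_scheme \<Rightarrow> ('b, 'f, 'r, 'z) struc_scheme \<Rightarrow> ('a \<Rightarrow> 'b) \<Rightarrow> bool"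
where
  "isom \<Sigma> A B h \<longleftrightarrow> h \<in> hom \<Sigma> A B \<and>
     (\<exists>k\<in>hom \<Sigma> B A. (\<forall>a\<in>carrier A. k (h a) = a) \<and> (\<forall>b\<in>carrier B. h (k b) = b))"

definition tisom ::
  "('f, 'r) signature \<Rightarrow> ('a, 'f, 'r) tstruc \<Rightarrow> ('b, 'f, 'r) tstruc \<Rightarrow> ('a \<Rightarrow> 'b) \<Rightarrow> bool"
where
  "tisom \<Sigma> X Y h \<longleftrightarrow> h \<in> thom \<Sigma> X Y \<and>
     (\<exists>k\<in>thom \<Sigma> Y X. (\<forall>x\<in>carrier X. k (h x) = x) \<and> (\<forall>y\<in>carrier Y. h (k y) = y))"

text \<open>Non-emptiness of substructures is required separately, where it applies.\<close>

definition closed_under ::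
  "('f, 'r) signature \<Rightarrow> ('a, 'f, 'r, 'z) struc_scheme \<Rightarrow> 'a set \<Rightarrow> bool"
where
  "closed_under \<Sigma> A N \<longleftrightarrow> N \<subseteq> carrier A \<and>
     (\<forall>f\<in>ops \<Sigma>. \<forall>x\<in>tuples (opar \<Sigma> f) N. opn A f x \<in> N)"

definition forms_substruc ::
  "('f, 'r) signature \<Rightarrow> ('a, 'f, 'r, 'z) struc_scheme \<Rightarrow> 'a set \<Rightarrow> bool"
where
  "forms_substruc \<Sigma> A N \<longleftrightarrow> N \<noteq> {} \<and> closed_under \<Sigma> A N"

definition forms_closed_tsubstruc ::
  "('f, 'r) signature \<Rightarrow> ('a, 'f, 'r) tstruc \<Rightarrow> 'a set \<Rightarrow> bool"
where
  "forms_closed_tsubstruc \<Sigma> X N \<longleftrightarrow> closed_under \<Sigma> X N \<and> closedin (topo X) N"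

definition restr ::
  "('f, 'r) signature \<Rightarrow> ('a, 'f, 'r, 'z) struc_scheme \<Rightarrow> 'a set \<Rightarrow> ('a, 'f, 'r) struc"
where
  "restr \<Sigma> A N = \<lparr>carrier = N, opn = opn A, rel = (\<lambda>r. rel A r \<inter> tuples (relar \<Sigma> r) N)\<rparr>"

definition trestr ::
  "('f, 'r) signature \<Rightarrow> ('a, 'f, 'r) tstruc \<Rightarrow> 'a set \<Rightarrow> ('a, 'f, 'r) tstruc"
where
  "trestr \<Sigma> X N = struc.extend (restr \<Sigma> X N) \<lparr>topo = subtopology (topo X) N\<rparr>"

definition pow_struc ::
  "('f, 'r) signature \<Rightarrow> ('a, 'f, 'r, 'z) struc_scheme \<Rightarrow> 's set \<Rightarrow> ('s \<Rightarrow> 'a, 'f, 'r) struc"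
where
  "pow_struc \<Sigma> A S =
    \<lparr>carrier = S \<rightarrow>\<^sub>E carrier A,
     opn = (\<lambda>f x. \<lambda>s\<in>S. opn A f (\<lambda>i\<in>{..<opar \<Sigma> f}. x i s)),
     rel = (\<lambda>r. {x \<in> tuples (relar \<Sigma> r) (S \<rightarrow>\<^sub>E carrier A).
                   \<forall>s\<in>S. (\<lambda>i\<in>{..<relar \<Sigma> r}. x i s) \<in> rel A r})\<rparr>"

definition pow_tstruc ::
  "('f, 'r) signature \<Rightarrow> ('a, 'f, 'r) tstruc \<Rightarrow> 's set \<Rightarrow> ('s \<Rightarrow> 'a, 'f, 'r) tstruc"
where
  "pow_tstruc \<Sigma> X S =
     struc.extend (pow_struc \<Sigma> X S) \<lparr>topo = product_topology (\<lambda>_. topo X) S\<rparr>"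


section \<open>The classes \<open>ISP\<close> and \<open>IS\<^sub>cP\<^sup>+\<close>\<close>

text \<open>
  An index set \<open>S\<close> in an arbitrary type cannot be quantified existentially in a definition.
  A structure with carrier type \<open>'a\<close> that embeds into any power of \<open>M\<close> also embeds into one whose
  index set consists of functions \<open>'a \<Rightarrow> 'm\<close>, so index sets of that type suffice;
  see \<open>ISPI\<close> and \<open>IScPI\<close> below.
\<close>

definition ISP :: "('f, 'r) signature \<Rightarrow> ('m, 'f, 'r) struc \<Rightarrow> ('a, 'f, 'r) struc set" where
  "ISP \<Sigma> M = {A. is_struc \<Sigma> A \<and>
     (\<exists>(S :: ('a \<Rightarrow> 'm) set) N h.
        forms_substruc \<Sigma> (pow_struc \<Sigma> M S) N \<and> isom \<Sigma> A (restr \<Sigma> (pow_struc \<Sigma> M S) N) h)}"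

definition IScP :: "('f, 'r) signature \<Rightarrow> ('m, 'f, 'r) tstruc \<Rightarrow> ('x, 'f, 'r) tstruc set" where
  "IScP \<Sigma> M = {X. is_struc \<Sigma> X \<and> topspace (topo X) = carrier X \<and>
     (\<exists>(S :: ('x \<Rightarrow> 'm) set) N h. S \<noteq> {} \<and>
        forms_closed_tsubstruc \<Sigma> (pow_tstruc \<Sigma> M S) N \<and> tisom \<Sigma> X (trestr \<Sigma> (pow_tstruc \<Sigma> M S) N) h)}"

definition embedding ::
  "('f, 'r) signature \<Rightarrow> ('a, 'f, 'r) struc \<Rightarrow> ('b, 'f, 'r) struc \<Rightarrow> ('a \<Rightarrow> 'b) \<Rightarrow> bool"
where
  "embedding \<Sigma> A B h \<longleftrightarrow>
     (\<exists>N. forms_substruc \<Sigma> B N \<and> isom \<Sigma> A (restr \<Sigma> B N) h)"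

definition tembedding ::
  "('f, 'r) signature \<Rightarrow> ('a, 'f, 'r) tstruc \<Rightarrow> ('b, 'f, 'r) tstruc \<Rightarrow> ('a \<Rightarrow> 'b) \<Rightarrow> bool"
where
  "tembedding \<Sigma> X Y h \<longleftrightarrow>
     (\<exists>N. forms_closed_tsubstruc \<Sigma> Y N \<and> tisom \<Sigma> X (trestr \<Sigma> Y N) h)"

text \<open>
  Notions that quantify over all members of a class take the carrier types of these members
  as arguments; a theorem that is polymorphic in them speaks about all members.
\<close>

definition injective_ISP ::
  "'a itself \<Rightarrow> 'b itself \<Rightarrow> ('f, 'r) signature \<Rightarrow> ('m, 'f, 'r) struc \<Rightarrow> bool"
where
  "injective_ISP TA TB \<Sigma> M \<longleftrightarrow>
     (\<forall>(A :: ('a, 'f, 'r) struc)\<in>ISP \<Sigma> M. \<forall>(B :: ('b, 'f, 'r) struc)\<in>ISP \<Sigma> M.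
        \<forall>j h. embedding \<Sigma> A B j \<and> h \<in> hom \<Sigma> A M \<longrightarrow>
          (\<exists>k\<in>hom \<Sigma> B M. \<forall>a\<in>carrier A. k (j a) = h a))"

definition injective_IScP ::
  "'x itself \<Rightarrow> 'y itself \<Rightarrow> ('f, 'r) signature \<Rightarrow> ('m, 'f, 'r) tstruc \<Rightarrow> bool"
where
  "injective_IScP TX TY \<Sigma> M \<longleftrightarrow>
     (\<forall>(X :: ('x, 'f, 'r) tstruc)\<in>IScP \<Sigma> M. \<forall>(Y :: ('y, 'f, 'r) tstruc)\<in>IScP \<Sigma> M.
        \<forall>j h. tembedding \<Sigma> X Y j \<and> h \<in> thom \<Sigma> X M \<longrightarrow>
          (\<exists>k\<in>thom \<Sigma> Y M. \<forall>x\<in>carrier X. k (j x) = h x))"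


section \<open>Alter egos and dualities\<close>

definition alter_ego ::
  "('f, 'r) signature \<Rightarrow> ('m, 'f, 'r) struc \<Rightarrow> ('g, 's) signature \<Rightarrow> ('m, 'g, 's) tstruc \<Rightarrow> bool"
where
  "alter_ego \<Sigma>1 M \<Sigma>2 Mt \<longleftrightarrow>
     carrier Mt = carrier M \<and>
     (\<forall>r\<in>rels \<Sigma>2. forms_substruc \<Sigma>1 (pow_struc \<Sigma>1 M {..<relar \<Sigma>2 r}) (rel Mt r)) \<and>
     (\<forall>g\<in>ops \<Sigma>2. restrict (opn Mt g) (tuples (opar \<Sigma>2 g) (carrier M))
                     \<in> hom \<Sigma>1 (pow_struc \<Sigma>1 M {..<opar \<Sigma>2 g}) M) \<and>
     (\<forall>r\<in>rels \<Sigma>1. closedin (product_topology (\<lambda>_. topo Mt) {..<relar \<Sigma>1 r}) (rel M r)) \<and>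
     (\<forall>f\<in>ops \<Sigma>1. continuous_map (product_topology (\<lambda>_. topo Mt) {..<opar \<Sigma>1 f}) (topo Mt) (opn M f))"

definition dualD ::
  "('f, 'r) signature \<Rightarrow> ('m, 'f, 'r) struc \<Rightarrow> ('g, 's) signature \<Rightarrow> ('m, 'g, 's) tstruc
     \<Rightarrow> ('a, 'f, 'r) struc \<Rightarrow> ('a \<Rightarrow> 'm, 'g, 's) tstruc"
where
  "dualD \<Sigma>1 M \<Sigma>2 Mt A = trestr \<Sigma>2 (pow_tstruc \<Sigma>2 Mt (carrier A)) (hom \<Sigma>1 A M)"

definition dualE ::
  "('f, 'r) signature \<Rightarrow> ('m, 'f, 'r) struc \<Rightarrow> ('g, 's) signature \<Rightarrow> ('m, 'g, 's) tstruc
     \<Rightarrow> ('x, 'g, 's) tstruc \<Rightarrow> ('x \<Rightarrow> 'm, 'f, 'r) struc"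
where
  "dualE \<Sigma>1 M \<Sigma>2 Mt X = restr \<Sigma>1 (pow_struc \<Sigma>1 M (carrier X)) (thom \<Sigma>2 X Mt)"

definition eval_e ::
  "('f, 'r) signature \<Rightarrow> ('m, 'f, 'r) struc \<Rightarrow> ('a, 'f, 'r) struc \<Rightarrow> 'a \<Rightarrow> ('a \<Rightarrow> 'm) \<Rightarrow> 'm"
where
  "eval_e \<Sigma>1 M A = (\<lambda>a\<in>carrier A. \<lambda>x\<in>hom \<Sigma>1 A M. x a)"

definition eval_eps ::
  "('g, 's) signature \<Rightarrow> ('m, 'g, 's) tstruc \<Rightarrow> ('x, 'g, 's) tstruc \<Rightarrow> 'x \<Rightarrow> ('x \<Rightarrow> 'm) \<Rightarrow> 'm"
where
  "eval_eps \<Sigma>2 Mt X = (\<lambda>x\<in>carrier X. \<lambda>\<alpha>\<in>thom \<Sigma>2 X Mt. \<alpha> x)"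

definition fully_dualises ::
  "'a itself \<Rightarrow> 'x itself \<Rightarrow> ('f, 'r) signature \<Rightarrow> ('m, 'f, 'r) struc
     \<Rightarrow> ('g, 's) signature \<Rightarrow> ('m, 'g, 's) tstruc \<Rightarrow> bool"
where
  "fully_dualises TA TX \<Sigma>1 M \<Sigma>2 Mt \<longleftrightarrow>
     (\<forall>(A :: ('a, 'f, 'r) struc)\<in>ISP \<Sigma>1 M.
        isom \<Sigma>1 A (dualE \<Sigma>1 M \<Sigma>2 Mt (dualD \<Sigma>1 M \<Sigma>2 Mt A)) (eval_e \<Sigma>1 M A)) \<and>
     (\<forall>(X :: ('x, 'g, 's) tstruc)\<in>IScP \<Sigma>2 Mt.
        tisom \<Sigma>2 X (dualD \<Sigma>1 M \<Sigma>2 Mt (dualE \<Sigma>1 M \<Sigma>2 Mt X)) (eval_eps \<Sigma>2 Mt X))"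

definition strongly_dualises ::
  "'a itself \<Rightarrow> 'x itself \<Rightarrow> 'y itself \<Rightarrow> ('f, 'r) signature \<Rightarrow> ('m, 'f, 'r) struc
     \<Rightarrow> ('g, 's) signature \<Rightarrow> ('m, 'g, 's) tstruc \<Rightarrow> bool"
where
  "strongly_dualises TA TX TY \<Sigma>1 M \<Sigma>2 Mt \<longleftrightarrow>
     fully_dualises TA TX \<Sigma>1 M \<Sigma>2 Mt \<and> injective_IScP TX TY \<Sigma>2 Mt"

definition entails ::
  "'a itself \<Rightarrow> ('f, 'r) signature \<Rightarrow> ('m, 'f, 'r) struc
     \<Rightarrow> ('g, 's) signature \<Rightarrow> ('m, 'g, 's) tstruc \<Rightarrow> nat \<Rightarrow> (nat \<Rightarrow> 'm) set \<Rightarrow> bool"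
where
  "entails TA \<Sigma>1 M \<Sigma>2 Mt n r \<longleftrightarrow>
     forms_substruc \<Sigma>1 (pow_struc \<Sigma>1 M {..<n}) r \<and>
     (\<forall>(A :: ('a, 'f, 'r) struc)\<in>ISP \<Sigma>1 M. \<forall>\<alpha>\<in>thom \<Sigma>2 (dualD \<Sigma>1 M \<Sigma>2 Mt A) Mt.
        \<forall>x\<in>tuples n (hom \<Sigma>1 A M).
          (\<forall>a\<in>carrier A. (\<lambda>i\<in>{..<n}. x i a) \<in> r) \<longrightarrow> compose {..<n} \<alpha> x \<in> r)"


section \<open>Terms and conjunctions of atomic formulas\<close>

datatype 'f trm = Var nat | App 'f "'f trm list"

datatype ('f, 'r) atom = EqAtom "'f trm" "'f trm" | RelAtom 'r "'f trm list"

text \<open>Well-formed terms and atomic formulas in the variables \<open>0, \<dots>, n - 1\<close>.\<close>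

fun wf_trm :: "('f, 'r) signature \<Rightarrow> nat \<Rightarrow> 'f trm \<Rightarrow> bool" where
  "wf_trm \<Sigma> n (Var i) \<longleftrightarrow> i < n"
| "wf_trm \<Sigma> n (App f ts) \<longleftrightarrow>
     f \<in> ops \<Sigma> \<and> length ts = opar \<Sigma> f \<and> (\<forall>t\<in>set ts. wf_trm \<Sigma> n t)"

fun wf_atom :: "('f, 'r) signature \<Rightarrow> nat \<Rightarrow> ('f, 'r) atom \<Rightarrow> bool" where
  "wf_atom \<Sigma> n (EqAtom s t) \<longleftrightarrow> wf_trm \<Sigma> n s \<and> wf_trm \<Sigma> n t"
| "wf_atom \<Sigma> n (RelAtom r ts) \<longleftrightarrow>
     r \<in> rels \<Sigma> \<and> length ts = relar \<Sigma> r \<and> (\<forall>t\<in>set ts. wf_trm \<Sigma> n t)"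

fun trm_val :: "('a, 'f, 'r, 'z) struc_scheme \<Rightarrow> 'f trm \<Rightarrow> (nat \<Rightarrow> 'a) \<Rightarrow> 'a" where
  "trm_val A (Var i) x = x i"
| "trm_val A (App f ts) x =
     opn A f (\<lambda>i\<in>{..<length ts}. map (\<lambda>t. trm_val A t x) ts ! i)"

fun sat :: "('a, 'f, 'r, 'z) struc_scheme \<Rightarrow> ('f, 'r) atom \<Rightarrow> (nat \<Rightarrow> 'a) \<Rightarrow> bool" where
  "sat A (EqAtom s t) x \<longleftrightarrow> trm_val A s x = trm_val A t x"
| "sat A (RelAtom r ts) x \<longleftrightarrow>
     (\<lambda>i\<in>{..<length ts}. map (\<lambda>t. trm_val A t x) ts ! i) \<in> rel A r"

definition Clo1 :: "('f, 'r) signature \<Rightarrow> ('a, 'f, 'r, 'z) struc_scheme \<Rightarrow> ('a \<Rightarrow> 'a) set" where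
  "Clo1 \<Sigma> A = {\<lambda>a\<in>carrier A. trm_val A t (\<lambda>i\<in>{..<1}. a) | t. wf_trm \<Sigma> 1 t}"

definition separates_points :: "('a \<Rightarrow> 'b) set \<Rightarrow> 'a set \<Rightarrow> bool" where
  "separates_points Z C \<longleftrightarrow> (\<forall>a\<in>C. \<forall>b\<in>C. a \<noteq> b \<longrightarrow> (\<exists>z\<in>Z. z a \<noteq> z b))"


section \<open>Bounded distributive lattices and Priestley spaces\<close>

text \<open>The two-element structures live on \<^typ>\<open>bool\<close>, with \<open>0\<close> as \<^const>\<open>False\<close> and \<open>1\<close> as \<^const>\<open>True\<close>.\<close>

datatype dl_op = Join | Meet | Zero | One

definition sigD :: "(dl_op, unit) signature" where
  "sigD = \<lparr>ops = UNIV, opar = case_dl_op 2 2 0 0, rels = {}, relar = (\<lambda>_. 0)\<rparr>"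

definition bounded_distrib_lattice :: "('a, dl_op, unit) struc \<Rightarrow> bool" where
  "bounded_distrib_lattice L \<longleftrightarrow> is_struc sigD L \<and>
     (let j = (\<lambda>a b. opn L Join (pair a b)); m = (\<lambda>a b. opn L Meet (pair a b));
          z = opn L Zero (\<lambda>_. undefined); u = opn L One (\<lambda>_. undefined); C = carrier L
      in (\<forall>a\<in>C. \<forall>b\<in>C. j a b = j b a \<and> m a b = m b a) \<and>
         (\<forall>a\<in>C. \<forall>b\<in>C. \<forall>c\<in>C. j (j a b) c = j a (j b c) \<and> m (m a b) c = m a (m b c)) \<and>
         (\<forall>a\<in>C. \<forall>b\<in>C. j a (m a b) = a \<and> m a (j a b) = a) \<and>
         (\<forall>a\<in>C. \<forall>b\<in>C. \<forall>c\<in>C. m a (j b c) = j (m a b) (m a c)) \<and>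
         (\<forall>a\<in>C. j a z = a \<and> m a u = a))"

definition latD :: "(bool, dl_op, unit) struc" where
  "latD = \<lparr>carrier = UNIV,
     opn = case_dl_op (\<lambda>x. x 0 \<or> x 1) (\<lambda>x. x 0 \<and> x 1) (\<lambda>_. False) (\<lambda>_. True),
     rel = (\<lambda>_. {})\<rparr>"

definition sigP :: "(unit, unit) signature" where
  "sigP = \<lparr>ops = {}, opar = (\<lambda>_. 0), rels = UNIV, relar = (\<lambda>_. 2)\<rparr>"

definition chainD :: "(bool, unit, unit) tstruc" where
  "chainD = \<lparr>carrier = UNIV, opn = (\<lambda>_ _. undefined),
     rel = (\<lambda>_. {p \<in> tuples 2 UNIV. p 0 \<le> p 1}), topo = discrete_topology UNIV\<rparr>"

abbreviation Priestley :: "('x, unit, unit) tstruc set" where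
  "Priestley \<equiv> IScP sigP chainD"

abbreviation dualH :: "('a, dl_op, unit) struc \<Rightarrow> ('a \<Rightarrow> bool, unit, unit) tstruc" where
  "dualH \<equiv> dualD sigD latD sigP chainD"

abbreviation dualK :: "('x, unit, unit) tstruc \<Rightarrow> ('x \<Rightarrow> bool, dl_op, unit) struc" where
  "dualK \<equiv> dualE sigD latD sigP chainD"

text \<open>
  The reduct of a structure given by four terms, and the reduct of a structure with topology
  given by a finite conjunction of atomic formulas in two variables.
\<close>

definition lat_reduct :: "(dl_op \<Rightarrow> 'f trm) \<Rightarrow> ('a, 'f, 'r) struc \<Rightarrow> ('a, dl_op, unit) struc" where
  "lat_reduct \<tau> A = \<lparr>carrier = carrier A, opn = (\<lambda>s. trm_val A (\<tau> s)), rel = (\<lambda>_. {})\<rparr>"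

definition D_based :: "('f, 'r) signature \<Rightarrow> ('m, 'f, 'r) struc \<Rightarrow> (dl_op \<Rightarrow> 'f trm) \<Rightarrow> bool" where
  "D_based \<Sigma> M \<tau> \<longleftrightarrow>
     (\<forall>s. wf_trm \<Sigma> (opar sigD s) (\<tau> s)) \<and> bounded_distrib_lattice (lat_reduct \<tau> M)"

definition ord_reduct :: "('f, 'r) atom list \<Rightarrow> ('x, 'f, 'r) tstruc \<Rightarrow> ('x, unit, unit) tstruc" where
  "ord_reduct \<Phi> X = \<lparr>carrier = carrier X, opn = (\<lambda>_ _. undefined),
     rel = (\<lambda>_. {p \<in> tuples 2 (carrier X). \<forall>\<phi>\<in>set \<Phi>. sat X \<phi> p}), topo = topo X\<rparr>"

text \<open>\<open>maximal_in \<Sigma> M U r\<close>: the relation \<open>r\<close> forms a substructure of \<open>M\<^sup>2\<close> that is maximal in \<open>U\<close>.\<close>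

definition maximal_in ::
  "('f, 'r) signature \<Rightarrow> ('m, 'f, 'r) struc \<Rightarrow> (nat \<Rightarrow> 'm) set \<Rightarrow> (nat \<Rightarrow> 'm) set \<Rightarrow> bool"
where
  "maximal_in \<Sigma> M U r \<longleftrightarrow> forms_substruc \<Sigma> (pow_struc \<Sigma> M {..<2::nat}) r \<and> r \<subseteq> U \<and>
     (\<forall>s. forms_substruc \<Sigma> (pow_struc \<Sigma> M {..<2::nat}) s \<and> s \<subseteq> U \<and> r \<subseteq> s \<longrightarrow> s = r)"

definition preimage_le :: "'m set \<Rightarrow> ('m \<Rightarrow> bool) \<Rightarrow> (nat \<Rightarrow> 'm) set" where
  "preimage_le C \<omega> = {p \<in> tuples 2 C. \<omega> (p 0) \<le> \<omega> (p 1)}"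


section \<open>Independence of the chosen index and carrier types\<close>

lemma rel_tuples:
  assumes "is_struc \<Sigma> A" "r \<in> rels \<Sigma>" "x \<in> rel A r"
  shows "x \<in> tuples (relar \<Sigma> r) (carrier A)"
  using assms unfolding is_struc_def by blast

lemma hom_PiE: "h \<in> hom \<Sigma> A B \<Longrightarrow> h \<in> carrier A \<rightarrow>\<^sub>E carrier B"
  by (simp add: hom_def)

lemma hom_op: "h \<in> hom \<Sigma> A B \<Longrightarrow> f \<in> ops \<Sigma> \<Longrightarrow> x \<in> tuples (opar \<Sigma> f) (carrier A) \<Longrightarrow>
    h (opn A f x) = opn B f (compose {..<opar \<Sigma> f} h x)"
  by (simp add: hom_def)

lemma hom_rel: "h \<in> hom \<Sigma> A B \<Longrightarrow> r \<in> rels \<Sigma> \<Longrightarrow> x \<in> rel A r \<Longrightarrow>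
    compose {..<relar \<Sigma> r} h x \<in> rel B r"
  by (simp add: hom_def)

lemma tuples_nth: "x \<in> tuples n C \<Longrightarrow> i < n \<Longrightarrow> x i \<in> C"
  by auto

lemma tuples_compose:
  "h \<in> C \<rightarrow> D \<Longrightarrow> x \<in> tuples n C \<Longrightarrow> compose {..<n} h x \<in> tuples n D"
  by (fastforce simp: compose_def)

lemma compose_tuples:
  "x \<in> tuples n C \<Longrightarrow> compose {..<n} (compose C k h) x = compose {..<n} k (compose {..<n} h x)"
  by (fastforce simp: compose_def)

lemma hom_compose:
  assumes A: "is_struc \<Sigma> A" and h: "h \<in> hom \<Sigma> A B" and k: "k \<in> hom \<Sigma> B C"
  shows "compose (carrier A) k h \<in> hom \<Sigma> A C"
  unfolding hom_def
proof (intro CollectI conjI ballI)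
  show "compose (carrier A) k h \<in> carrier A \<rightarrow>\<^sub>E carrier C"
    using hom_PiE[OF h] hom_PiE[OF k] by (fastforce simp: compose_def)
next
  fix r x assume r: "r \<in> rels \<Sigma>" and x: "x \<in> rel A r"
  show "compose {..<relar \<Sigma> r} (compose (carrier A) k h) x \<in> rel C r"
    using hom_rel[OF k r hom_rel[OF h r x]] compose_tuples[OF rel_tuples[OF A r x]] by metis
next
  fix f x assume f: "f \<in> ops \<Sigma>" and x: "x \<in> tuples (opar \<Sigma> f) (carrier A)"
  have "compose {..<opar \<Sigma> f} h x \<in> tuples (opar \<Sigma> f) (carrier B)"
    using hom_PiE[OF h] by (intro tuples_compose[OF _ x]) auto
  moreover have "opn A f x \<in> carrier A"
    using A f x by (auto simp: is_struc_def)
  ultimately show "compose (carrier A) k h (opn A f x)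
          = opn C f (compose {..<opar \<Sigma> f} (compose (carrier A) k h) x)"
    unfolding compose_tuples[OF x] using hom_op[OF h f x] hom_op[OF k f]
    by (simp add: compose_def)
qed

lemma carrier_pow [simp]: "carrier (pow_struc \<Sigma> M S) = S \<rightarrow>\<^sub>E carrier M"
  by (simp add: pow_struc_def)

lemma pow_op_closed:
  assumes "is_struc \<Sigma> M" "f \<in> ops \<Sigma>" "x \<in> tuples (opar \<Sigma> f) (S \<rightarrow>\<^sub>E carrier M)"
  shows "opn (pow_struc \<Sigma> M S) f x \<in> S \<rightarrow>\<^sub>E carrier M"
proof -
  have "(\<lambda>i\<in>{..<opar \<Sigma> f}. x i s) \<in> tuples (opar \<Sigma> f) (carrier M)" if "s \<in> S" for s
    using assms(3) that by (auto simp: PiE_iff)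
  then show ?thesis
    using assms(1,2) by (simp add: pow_struc_def is_struc_def)
qed

lemma reindex_hom:
  assumes M: "is_struc \<Sigma> M" and "\<And>s. s \<in> S \<Longrightarrow> \<phi> s \<in> S'"
  shows "(\<lambda>y\<in>S' \<rightarrow>\<^sub>E carrier M. \<lambda>s\<in>S. y (\<phi> s)) \<in> hom \<Sigma> (pow_struc \<Sigma> M S') (pow_struc \<Sigma> M S)"
    (is "?\<rho> \<in> _")
proof -
  have pt: "(\<lambda>i\<in>{..<n}. compose {..<n} ?\<rho> x i s) = (\<lambda>i\<in>{..<n}. x i (\<phi> s))"
    if "x \<in> tuples n (S' \<rightarrow>\<^sub>E carrier M)" "s \<in> S" for n x s
    by (rule restrict_ext) (use tuples_nth[OF that(1)] that(2) in \<open>simp add: compose_def\<close>)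
  have maps: "?\<rho> \<in> (S' \<rightarrow>\<^sub>E carrier M) \<rightarrow>\<^sub>E (S \<rightarrow>\<^sub>E carrier M)"
    using assms(2) by (auto simp: PiE_iff)
  show ?thesis
    unfolding hom_def
  proof (intro CollectI conjI ballI)
    show "?\<rho> \<in> carrier (pow_struc \<Sigma> M S') \<rightarrow>\<^sub>E carrier (pow_struc \<Sigma> M S)"
      using maps by simp
  next
    fix r x assume r: "r \<in> rels \<Sigma>" and x: "x \<in> rel (pow_struc \<Sigma> M S') r"
    then have xt: "x \<in> tuples (relar \<Sigma> r) (S' \<rightarrow>\<^sub>E carrier M)" 
      and xr: "\<forall>s\<in>S'. (\<lambda>i\<in>{..<relar \<Sigma> r}. x i s) \<in> rel M r"
      by (simp_all add: pow_struc_def)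
    have "compose {..<relar \<Sigma> r} ?\<rho> x \<in> tuples (relar \<Sigma> r) (S \<rightarrow>\<^sub>E carrier M)"
      using maps by (intro tuples_compose[OF _ xt]) auto
    then show "compose {..<relar \<Sigma> r} ?\<rho> x \<in> rel (pow_struc \<Sigma> M S) r"
      using xr pt[OF xt] assms(2) unfolding pow_struc_def by (simp del: restrict_apply)
  next
    fix f x assume f: "f \<in> ops \<Sigma>" and x: "x \<in> tuples (opar \<Sigma> f) (carrier (pow_struc \<Sigma> M S'))"
    then have xt: "x \<in> tuples (opar \<Sigma> f) (S' \<rightarrow>\<^sub>E carrier M)" by simp
    show "?\<rho> (opn (pow_struc \<Sigma> M S') f x)
            = opn (pow_struc \<Sigma> M S) f (compose {..<opar \<Sigma> f} ?\<rho> x)"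
    proof
      fix s
      show "?\<rho> (opn (pow_struc \<Sigma> M S') f x) s
            = opn (pow_struc \<Sigma> M S) f (compose {..<opar \<Sigma> f} ?\<rho> x) s"
      proof (cases "s \<in> S")
        case True
        then show ?thesis
          using pow_op_closed[OF M f xt] pt[OF xt True] assms(2)[OF True]
          by (simp add: pow_struc_def del: restrict_apply) simp
      next
        case False
        then show ?thesis
          using pow_op_closed[OF M f xt] by (simp add: pow_struc_def)
      qed
    qed
  qed
qed

lemma prod_hom:
  assumes A: "is_struc \<Sigma> A" and p: "\<And>s. s \<in> S \<Longrightarrow> p s \<in> hom \<Sigma> A M"
  shows "(\<lambda>a\<in>carrier A. \<lambda>s\<in>S. p s a) \<in> hom \<Sigma> A (pow_struc \<Sigma> M S)"
    (is "?g \<in> _")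
proof -
  have pt: "(\<lambda>i\<in>{..<n}. compose {..<n} ?g x i s) = compose {..<n} (p s) x"
    if "x \<in> tuples n (carrier A)" "s \<in> S" for n x s
    using that by (fastforce simp: compose_def)
  have maps: "?g \<in> carrier A \<rightarrow>\<^sub>E (S \<rightarrow>\<^sub>E carrier M)"
    using hom_PiE[OF p] by (auto simp: PiE_iff Pi_iff)
  show ?thesis
    unfolding hom_def
  proof (intro CollectI conjI ballI)
    show "?g \<in> carrier A \<rightarrow>\<^sub>E carrier (pow_struc \<Sigma> M S)"
      using maps by simp
  next
    fix r x assume r: "r \<in> rels \<Sigma>" and x: "x \<in> rel A r"
    note xt = rel_tuples[OF A r x]
    have "compose {..<relar \<Sigma> r} ?g x \<in> tuples (relar \<Sigma> r) (S \<rightarrow>\<^sub>E carrier M)"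
      using maps by (intro tuples_compose[OF _ xt]) auto
    then show "compose {..<relar \<Sigma> r} ?g x \<in> rel (pow_struc \<Sigma> M S) r"
      using pt[OF xt] hom_rel[OF p r x] unfolding pow_struc_def by (simp del: restrict_apply)
  next
    fix f x assume f: "f \<in> ops \<Sigma>" and x: "x \<in> tuples (opar \<Sigma> f) (carrier A)"
    have Af: "opn A f x \<in> carrier A" using A f x by (auto simp: is_struc_def)
    show "?g (opn A f x) = opn (pow_struc \<Sigma> M S) f (compose {..<opar \<Sigma> f} ?g x)"
    proof
      fix s
      show "?g (opn A f x) s = opn (pow_struc \<Sigma> M S) f (compose {..<opar \<Sigma> f} ?g x) s"
      proof (cases "s \<in> S")
        case True
        have "opn (pow_struc \<Sigma> M S) f (compose {..<opar \<Sigma> f} ?g x) s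
                = opn M f (\<lambda>i\<in>{..<opar \<Sigma> f}. compose {..<opar \<Sigma> f} ?g x i s)"
          using True by (simp add: pow_struc_def)
        also have "\<dots> = opn M f (compose {..<opar \<Sigma> f} (p s) x)"
          by (simp only: pt[OF x True])
        finally show ?thesis
          using hom_op[OF p[OF True] f x] Af True by simp
      next
        case False
        then show ?thesis using Af by (simp add: pow_struc_def)
      qed
    qed
  qed
qed

lemma proj_hom:
  assumes M: "is_struc \<Sigma> M" and s: "s \<in> S"
  shows "(\<lambda>y\<in>S \<rightarrow>\<^sub>E carrier M. y s) \<in> hom \<Sigma> (pow_struc \<Sigma> M S) M" (is "?p \<in> _")
proof -
  have pt: "compose {..<n} ?p x = (\<lambda>i\<in>{..<n}. x i s)"
    if "x \<in> tuples n (S \<rightarrow>\<^sub>E carrier M)" for n x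
    unfolding compose_def by (rule restrict_ext) (use tuples_nth[OF that] in simp)
  show ?thesis
    unfolding hom_def
  proof (intro CollectI conjI ballI)
    show "?p \<in> carrier (pow_struc \<Sigma> M S) \<rightarrow>\<^sub>E carrier M"
      using s by auto
  next
    fix r x assume "r \<in> rels \<Sigma>" and "x \<in> rel (pow_struc \<Sigma> M S) r"
    then show "compose {..<relar \<Sigma> r} ?p x \<in> rel M r"
      using s pt[of x "relar \<Sigma> r"] by (simp add: pow_struc_def)
  next
    fix f x assume f: "f \<in> ops \<Sigma>" and "x \<in> tuples (opar \<Sigma> f) (carrier (pow_struc \<Sigma> M S))"
    then have xt: "x \<in> tuples (opar \<Sigma> f) (S \<rightarrow>\<^sub>E carrier M)" by simp
    show "?p (opn (pow_struc \<Sigma> M S) f x) = opn M f (compose {..<opar \<Sigma> f} ?p x)"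
      using pow_op_closed[OF M f xt] s pt[OF xt] by (simp add: pow_struc_def)
  qed
qed

lemma restr_simps [simp]:
  "carrier (restr \<Sigma> A N) = N" "opn (restr \<Sigma> A N) = opn A"
  "rel (restr \<Sigma> A N) r = rel A r \<inter> tuples (relar \<Sigma> r) N"
  by (simp_all add: restr_def)

lemma is_struc_restr: "closed_under \<Sigma> A N \<Longrightarrow> is_struc \<Sigma> (restr \<Sigma> A N)"
  by (simp add: closed_under_def is_struc_def)

lemma hom_into_restr:
  assumes A: "is_struc \<Sigma> A" and h: "h \<in> hom \<Sigma> A B" and N: "h ` carrier A \<subseteq> N"
  shows "h \<in> hom \<Sigma> A (restr \<Sigma> B N)"
proof -
  have "compose {..<relar \<Sigma> r} h x \<in> tuples (relar \<Sigma> r) N" if "r \<in> rels \<Sigma>" "x \<in> rel A r" for r x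
    using N by (intro tuples_compose[OF _ rel_tuples[OF A that]]) auto
  then show ?thesis
    using h N by (auto simp: hom_def PiE_iff)
qed

lemma hom_from_restr_codomain:
  "h \<in> hom \<Sigma> A (restr \<Sigma> B N) \<Longrightarrow> N \<subseteq> carrier B \<Longrightarrow> h \<in> hom \<Sigma> A B"
  by (auto simp: hom_def PiE_iff)

lemma restrict_hom:
  assumes h: "h \<in> hom \<Sigma> A B" and N: "closed_under \<Sigma> A N"
  shows "restrict h N \<in> hom \<Sigma> (restr \<Sigma> A N) B"
proof -
  have NA: "N \<subseteq> carrier A" using N by (simp add: closed_under_def)
  have eq: "compose {..<n} (restrict h N) x = compose {..<n} h x" if "x \<in> tuples n N" for n x
    using that by (fastforce simp: compose_def)
  have sub: "x \<in> tuples n (carrier A)" if "x \<in> tuples n N" for n x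
    using that NA by (auto simp: PiE_iff)
  show ?thesis
    unfolding hom_def
  proof (intro CollectI conjI ballI)
    show "restrict h N \<in> carrier (restr \<Sigma> A N) \<rightarrow>\<^sub>E carrier B"
      using hom_PiE[OF h] NA by (auto simp: PiE_iff)
  next
    fix r x assume "r \<in> rels \<Sigma>" and "x \<in> rel (restr \<Sigma> A N) r"
    then show "compose {..<relar \<Sigma> r} (restrict h N) x \<in> rel B r"
      using eq[of x "relar \<Sigma> r"] hom_rel[OF h] by simp
  next
    fix f x assume f: "f \<in> ops \<Sigma>" and "x \<in> tuples (opar \<Sigma> f) (carrier (restr \<Sigma> A N))"
    then have x: "x \<in> tuples (opar \<Sigma> f) N" by simp
    then have "opn A f x \<in> N" using N f by (simp add: closed_under_def)
    then show "restrict h N (opn (restr \<Sigma> A N) f x) = opn B f (compose {..<opar \<Sigma> f} (restrict h N) x)"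
      using hom_op[OF h f sub[OF x]] eq[OF x] by simp
  qed
qed

lemma closed_under_image:
  assumes A: "is_struc \<Sigma> A" and h: "h \<in> hom \<Sigma> A B"
  shows "closed_under \<Sigma> B (h ` carrier A)"
  unfolding closed_under_def
proof (intro conjI ballI)
  show "h ` carrier A \<subseteq> carrier B" using hom_PiE[OF h] by auto
next
  fix f y assume f: "f \<in> ops \<Sigma>" and y: "y \<in> tuples (opar \<Sigma> f) (h ` carrier A)"
  define x where "x = (\<lambda>i\<in>{..<opar \<Sigma> f}. inv_into (carrier A) h (y i))"
  have x: "x \<in> tuples (opar \<Sigma> f) (carrier A)"
    using y by (auto simp: x_def PiE_iff intro: inv_into_into)
  have "compose {..<opar \<Sigma> f} h x i = y i" for i
    using y by (cases "i < opar \<Sigma> f") (auto simp: x_def compose_def PiE_iff extensional_def f_inv_into_f)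
  then have "compose {..<opar \<Sigma> f} h x = y" ..
  then have "opn B f y = h (opn A f x)" using hom_op[OF h f x] by simp
  moreover have "opn A f x \<in> carrier A" using A f x by (auto simp: is_struc_def)
  ultimately show "opn B f y \<in> h ` carrier A" by simp
qed

text \<open>An embedding into \<open>M\<^sup>S\<close> can be reindexed along \<open>s \<mapsto> \<lambda>x. h x s\<close>.\<close>

lemma reindex_isom:
  fixes A :: "('a, 'f, 'r, 'y) struc_scheme" and M :: "('m, 'f, 'r, 'z) struc_scheme" and S :: "'s set"
  assumes M: "is_struc \<Sigma> M" and A: "is_struc \<Sigma> A"
    and N: "closed_under \<Sigma> (pow_struc \<Sigma> M S) N"
    and h: "h \<in> hom \<Sigma> A (restr \<Sigma> (pow_struc \<Sigma> M S) N)"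
    and k: "k \<in> hom \<Sigma> (restr \<Sigma> (pow_struc \<Sigma> M S) N) A"
    and kh: "\<And>a. a \<in> carrier A \<Longrightarrow> k (h a) = a"
    and hk: "\<And>b. b \<in> N \<Longrightarrow> h (k b) = b"
    and \<phi>_def: "\<phi> = (\<lambda>s x. h x s)"
    and \<rho>_def: "\<rho> = (\<lambda>y\<in>\<phi> ` S \<rightarrow>\<^sub>E carrier M. \<lambda>s\<in>S. y (\<phi> s))"
    and g_def: "g = (\<lambda>a\<in>carrier A. \<lambda>t\<in>\<phi> ` S. t a)"
    and N'_def: "N' = g ` carrier A"
    and k'_def: "k' = compose N' k (restrict \<rho> N')"
  shows "closed_under \<Sigma> (pow_struc \<Sigma> M (\<phi> ` S)) N'"
    and "g \<in> hom \<Sigma> A (restr \<Sigma> (pow_struc \<Sigma> M (\<phi> ` S)) N')"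
    and "k' \<in> hom \<Sigma> (restr \<Sigma> (pow_struc \<Sigma> M (\<phi> ` S)) N') A"
    and "\<forall>a\<in>carrier A. k' (g a) = a" and "\<forall>b\<in>N'. g (k' b) = b"
    and "N' = {y \<in> \<phi> ` S \<rightarrow>\<^sub>E carrier M. \<rho> y \<in> N}"
proof -
  have NP: "N \<subseteq> S \<rightarrow>\<^sub>E carrier M" using N by (simp add: closed_under_def)
  have h': "h \<in> hom \<Sigma> A (pow_struc \<Sigma> M S)"
    using hom_from_restr_codomain[OF h] NP by simp
  have hN: "h a \<in> N" if "a \<in> carrier A" for a
    using hom_PiE[OF h] that by auto
  have p: "restrict t (carrier A) \<in> hom \<Sigma> A M" if "t \<in> \<phi> ` S" for t
  proof -
    from that obtain s where s: "s \<in> S" and t: "t = \<phi> s" by auto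
    have "compose (carrier A) (\<lambda>y\<in>S \<rightarrow>\<^sub>E carrier M. y s) h = restrict t (carrier A)"
      using hN NP by (auto simp: compose_def t \<phi>_def fun_eq_iff)
    then show ?thesis
      using hom_compose[OF A h' proj_hom[OF M s]] by simp
  qed
  have "g = (\<lambda>a\<in>carrier A. \<lambda>t\<in>\<phi> ` S. restrict t (carrier A) a)"
    by (auto simp: g_def fun_eq_iff)
  then have g: "g \<in> hom \<Sigma> A (pow_struc \<Sigma> M (\<phi> ` S))"
    using prod_hom[OF A p] by simp
  show N': "closed_under \<Sigma> (pow_struc \<Sigma> M (\<phi> ` S)) N'"
    unfolding N'_def by (rule closed_under_image[OF A g])
  show "g \<in> hom \<Sigma> A (restr \<Sigma> (pow_struc \<Sigma> M (\<phi> ` S)) N')"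
    by (rule hom_into_restr[OF A g]) (simp add: N'_def)
  have gP: "g a \<in> \<phi> ` S \<rightarrow>\<^sub>E carrier M" if "a \<in> carrier A" for a
    using hom_PiE[OF g] that by auto
  have \<rho>g: "\<rho> (g a) = h a" if a: "a \<in> carrier A" for a
  proof
    fix s
    show "\<rho> (g a) s = h a s"
    proof (cases "s \<in> S")
      case True
      then show ?thesis using gP[OF a] a by (simp add: \<rho>_def g_def \<phi>_def)
    next
      case False
      moreover have "h a \<in> extensional S" using hN[OF a] NP by (auto simp: PiE_iff)
      ultimately show ?thesis using gP[OF a] by (simp add: \<rho>_def extensional_def)
    qed
  qed
  have \<rho>: "\<rho> \<in> hom \<Sigma> (pow_struc \<Sigma> M (\<phi> ` S)) (pow_struc \<Sigma> M S)"
    unfolding \<rho>_def by (rule reindex_hom[OF M]) simp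
  have "restrict \<rho> N' \<in> hom \<Sigma> (restr \<Sigma> (pow_struc \<Sigma> M (\<phi> ` S)) N') (restr \<Sigma> (pow_struc \<Sigma> M S) N)"
    by (rule hom_into_restr[OF is_struc_restr[OF N'] restrict_hom[OF \<rho> N']])
       (auto simp: N'_def \<rho>g hN)
  from hom_compose[OF is_struc_restr[OF N'] this k]
  show "k' \<in> hom \<Sigma> (restr \<Sigma> (pow_struc \<Sigma> M (\<phi> ` S)) N') A"
    by (simp add: k'_def)
  show k'g: "\<forall>a\<in>carrier A. k' (g a) = a"
    by (simp add: k'_def compose_def N'_def \<rho>g kh)
  then show "\<forall>b\<in>N'. g (k' b) = b"
    by (simp add: N'_def)
  show "N' = {y \<in> \<phi> ` S \<rightarrow>\<^sub>E carrier M. \<rho> y \<in> N}"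
  proof (intro equalityI subsetI)
    fix y assume "y \<in> N'"
    then show "y \<in> {y \<in> \<phi> ` S \<rightarrow>\<^sub>E carrier M. \<rho> y \<in> N}"
      using gP \<rho>g hN by (auto simp: N'_def simp del: PiE_iff)
  next
    fix y assume "y \<in> {y \<in> \<phi> ` S \<rightarrow>\<^sub>E carrier M. \<rho> y \<in> N}"
    then have y: "y \<in> \<phi> ` S \<rightarrow>\<^sub>E carrier M" and \<rho>y: "\<rho> y \<in> N" by auto
    define a where "a = k (\<rho> y)"
    have a: "a \<in> carrier A" using hom_PiE[OF k] \<rho>y by (auto simp: a_def)
    have ha: "h a = \<rho> y" using hk[OF \<rho>y] by (simp add: a_def)
    have "y t = g a t" for t
    proof (cases "t \<in> \<phi> ` S")
      case True
      then obtain s where s: "s \<in> S" "t = \<phi> s" by auto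
      have "h a s = y t" using ha y s by (simp add: \<rho>_def)
      then show ?thesis using True a s by (simp add: g_def \<phi>_def)
    next
      case False
      then show ?thesis using y a by (auto simp: g_def PiE_iff extensional_def)
    qed
    then have "y = g a" ..
    then show "y \<in> N'" using a by (simp add: N'_def)
  qed
qed

lemma ISPI:
  fixes A :: "('a, 'f, 'r) struc" and M :: "('m, 'f, 'r) struc" and S :: "'s set"
  assumes M: "is_struc \<Sigma> M" and A: "is_struc \<Sigma> A"
    and N: "forms_substruc \<Sigma> (pow_struc \<Sigma> M S) N"
    and h: "isom \<Sigma> A (restr \<Sigma> (pow_struc \<Sigma> M S) N) h"
  shows "A \<in> ISP \<Sigma> M"
proof -
  from h obtain k where hh: "h \<in> hom \<Sigma> A (restr \<Sigma> (pow_struc \<Sigma> M S) N)"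
    and k: "k \<in> hom \<Sigma> (restr \<Sigma> (pow_struc \<Sigma> M S) N) A"
    and kh: "\<And>a. a \<in> carrier A \<Longrightarrow> k (h a) = a" and hk: "\<And>b. b \<in> N \<Longrightarrow> h (k b) = b"
    by (auto simp: isom_def)
  have Nc: "closed_under \<Sigma> (pow_struc \<Sigma> M S) N" and "N \<noteq> {}"
    using N by (auto simp: forms_substruc_def)
  then have "carrier A \<noteq> {}" using hom_PiE[OF k] by auto
  let ?\<phi> = "\<lambda>s x. h x s"
  note * = reindex_isom[OF M A Nc hh k kh hk refl refl refl refl refl]
  have "forms_substruc \<Sigma> (pow_struc \<Sigma> M (?\<phi> ` S)) ((\<lambda>a\<in>carrier A. \<lambda>t\<in>?\<phi> ` S. t a) ` carrier A)"
    using *(1) \<open>carrier A \<noteq> {}\<close> by (simp add: forms_substruc_def)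
  moreover have "isom \<Sigma> A (restr \<Sigma> (pow_struc \<Sigma> M (?\<phi> ` S))
      ((\<lambda>a\<in>carrier A. \<lambda>t\<in>?\<phi> ` S. t a) ` carrier A)) (\<lambda>a\<in>carrier A. \<lambda>t\<in>?\<phi> ` S. t a)"
    unfolding isom_def restr_simps using *(2-5) by blast
  ultimately show ?thesis
    using A unfolding ISP_def by blast
qed

lemma pow_tstruc_simps [simp]:
  "carrier (pow_tstruc \<Sigma> X S) = S \<rightarrow>\<^sub>E carrier X"
  "opn (pow_tstruc \<Sigma> X S) = opn (pow_struc \<Sigma> X S)"
  "rel (pow_tstruc \<Sigma> X S) = rel (pow_struc \<Sigma> X S)"
  "topo (pow_tstruc \<Sigma> X S) = product_topology (\<lambda>_. topo X) S"
  by (simp_all add: pow_tstruc_def pow_struc_def struc.extend_def)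

lemma trestr_simps [simp]:
  "carrier (trestr \<Sigma> X N) = N"
  "opn (trestr \<Sigma> X N) = opn X"
  "rel (trestr \<Sigma> X N) r = rel X r \<inter> tuples (relar \<Sigma> r) N"
  "topo (trestr \<Sigma> X N) = subtopology (topo X) N"
  by (simp_all add: trestr_def struc.extend_def)

lemma thom_trestr_pow:
  "thom \<Sigma> X (trestr \<Sigma> (pow_tstruc \<Sigma> M S) N) =
     {h \<in> hom \<Sigma> X (restr \<Sigma> (pow_struc \<Sigma> M S) N).
        continuous_map (topo X) (subtopology (product_topology (\<lambda>_. topo M) S) N) h}"
  "thom \<Sigma> (trestr \<Sigma> (pow_tstruc \<Sigma> M S) N) X =
     {h \<in> hom \<Sigma> (restr \<Sigma> (pow_struc \<Sigma> M S) N) X.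
        continuous_map (subtopology (product_topology (\<lambda>_. topo M) S) N) (topo X) h}"
  by (simp_all add: thom_def hom_def)

lemma reindex_continuous:
  assumes T: "topspace T = C" and \<phi>: "\<And>s. s \<in> S \<Longrightarrow> \<phi> s \<in> S'"
  shows "continuous_map (product_topology (\<lambda>_. T) S') (product_topology (\<lambda>_. T) S)
           (\<lambda>y\<in>S' \<rightarrow>\<^sub>E C. \<lambda>s\<in>S. y (\<phi> s))"
proof -
  have "continuous_map (product_topology (\<lambda>_. T) S') T
          (\<lambda>y. (\<lambda>y\<in>S' \<rightarrow>\<^sub>E C. \<lambda>s\<in>S. y (\<phi> s)) y s)" if "s \<in> S" for s
    by (rule continuous_map_eq[OF continuous_map_product_projection[OF \<phi>[OF that]]])
       (use that T in auto)
  then show ?thesis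
    using T by (auto simp: continuous_map_componentwise)
qed

lemma IScPI:
  fixes X :: "('x, 'f, 'r) tstruc" and M :: "('m, 'f, 'r) tstruc" and S :: "'s set"
  assumes M: "is_struc \<Sigma> M" "topspace (topo M) = carrier M"
    and X: "is_struc \<Sigma> X" "topspace (topo X) = carrier X" and "S \<noteq> {}"
    and N: "forms_closed_tsubstruc \<Sigma> (pow_tstruc \<Sigma> M S) N"
    and h: "tisom \<Sigma> X (trestr \<Sigma> (pow_tstruc \<Sigma> M S) N) h"
  shows "X \<in> IScP \<Sigma> M"
proof -
  let ?P = "\<lambda>S. product_topology (\<lambda>_. topo M) S"
  from h obtain k where hh: "h \<in> hom \<Sigma> X (restr \<Sigma> (pow_struc \<Sigma> M S) N)"
    and hc: "continuous_map (topo X) (subtopology (?P S) N) h"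
    and k: "k \<in> hom \<Sigma> (restr \<Sigma> (pow_struc \<Sigma> M S) N) X"
    and kc: "continuous_map (subtopology (?P S) N) (topo X) k"
    and kh: "\<And>a. a \<in> carrier X \<Longrightarrow> k (h a) = a" and hk: "\<And>b. b \<in> N \<Longrightarrow> h (k b) = b"
    by (auto simp: tisom_def thom_trestr_pow)
  have Nc: "closed_under \<Sigma> (pow_struc \<Sigma> M S) N" and Ncl: "closedin (?P S) N"
    using N by (auto simp: forms_closed_tsubstruc_def closed_under_def)
  define \<phi> where "\<phi> = (\<lambda>s x. h x s)"
  define \<rho> where "\<rho> = (\<lambda>y\<in>\<phi> ` S \<rightarrow>\<^sub>E carrier M. \<lambda>s\<in>S. y (\<phi> s))"
  define g where "g = (\<lambda>a\<in>carrier X. \<lambda>t\<in>\<phi> ` S. t a)"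
  define N' where "N' = g ` carrier X"
  define k' where "k' = compose N' k (restrict \<rho> N')"
  note * = reindex_isom[OF M(1) X(1) Nc hh k kh hk \<phi>_def \<rho>_def g_def N'_def k'_def]
  have \<rho>c: "continuous_map (?P (\<phi> ` S)) (?P S) \<rho>"
    unfolding \<rho>_def by (rule reindex_continuous[OF M(2)]) simp
  have gc: "continuous_map (topo X) (subtopology (?P (\<phi> ` S)) N') g"
  proof -
    have comp: "continuous_map (topo X) (topo M) (\<lambda>x. g x t)" if "t \<in> \<phi> ` S" for t
    proof -
      from that obtain s where s: "s \<in> S" and t: "t = \<phi> s" by auto
      have "continuous_map (topo X) (topo M) (\<lambda>x. h x s)"
        using hc s by (simp add: continuous_map_in_subtopology continuous_map_componentwise)
      then show ?thesis
        by (rule continuous_map_eq) (use that t X(2) in \<open>auto simp: g_def \<phi>_def\<close>)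
    qed
    show ?thesis
      using comp X(2)
      by (auto simp: continuous_map_in_subtopology continuous_map_componentwise N'_def g_def)
  qed
  have N'cl: "closedin (?P (\<phi> ` S)) N'"
    using closedin_continuous_map_preimage[OF \<rho>c Ncl] *(6) M(2) by simp
  have k'c: "continuous_map (subtopology (?P (\<phi> ` S)) N') (topo X) k'"
  proof -
    have "continuous_map (subtopology (?P (\<phi> ` S)) N') (subtopology (?P S) N) \<rho>"
      using *(6) \<rho>c
      by (auto simp: continuous_map_in_subtopology intro: continuous_map_from_subtopology)
    from continuous_map_compose[OF this kc] show ?thesis
      by (rule continuous_map_eq) (auto simp: k'_def compose_def)
  qed
  show ?thesis
    unfolding IScP_def
  proof (intro CollectI conjI exI)
    show "is_struc \<Sigma> X" "topspace (topo X) = carrier X" by fact+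
    show "\<phi> ` S \<noteq> {}" using \<open>S \<noteq> {}\<close> by simp
    show "forms_closed_tsubstruc \<Sigma> (pow_tstruc \<Sigma> M (\<phi> ` S)) N'"
      using *(1) N'cl by (simp add: forms_closed_tsubstruc_def closed_under_def)
    show "tisom \<Sigma> X (trestr \<Sigma> (pow_tstruc \<Sigma> M (\<phi> ` S)) N') g"
      using *(2-5) gc k'c by (auto simp: tisom_def thom_trestr_pow)
  qed
qed


lemma dualD_closed:
  assumes M: "is_struc \<Sigma>1 M" and Mt: "is_struc \<Sigma>2 Mt" and ae: "alter_ego \<Sigma>1 M \<Sigma>2 Mt"
    and A: "is_struc \<Sigma>1 A"
  shows "closed_under \<Sigma>2 (pow_struc \<Sigma>2 Mt (carrier A)) (hom \<Sigma>1 A M)"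
  unfolding closed_under_def
proof (intro conjI ballI)
  have cM: "carrier Mt = carrier M" using ae by (simp add: alter_ego_def)
  show "hom \<Sigma>1 A M \<subseteq> carrier (pow_struc \<Sigma>2 Mt (carrier A))"
    using cM by (auto dest: hom_PiE)
  fix g x assume g: "g \<in> ops \<Sigma>2" and x: "x \<in> tuples (opar \<Sigma>2 g) (hom \<Sigma>1 A M)"
  let ?n = "opar \<Sigma>2 g"
  let ?p = "\<lambda>a\<in>carrier A. \<lambda>i\<in>{..<?n}. x i a"
  let ?g = "restrict (opn Mt g) (tuples ?n (carrier M))"
  have p: "?p \<in> hom \<Sigma>1 A (pow_struc \<Sigma>1 M {..<?n})"
    by (rule prod_hom[OF A]) (use x in auto)
  have g': "?g \<in> hom \<Sigma>1 (pow_struc \<Sigma>1 M {..<?n}) M"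
    using ae g by (simp add: alter_ego_def)
  have "opn (pow_struc \<Sigma>2 Mt (carrier A)) g x = compose (carrier A) ?g ?p"
  proof
    fix a
    show "opn (pow_struc \<Sigma>2 Mt (carrier A)) g x a = compose (carrier A) ?g ?p a"
    proof (cases "a \<in> carrier A")
      case True
      then have "?p a \<in> tuples ?n (carrier M)"
        using PiE_mem[OF hom_PiE[OF p]] by simp
      then show ?thesis using True by (simp add: pow_struc_def compose_def)
    qed (simp add: pow_struc_def compose_def)
  qed
  then show "opn (pow_struc \<Sigma>2 Mt (carrier A)) g x \<in> hom \<Sigma>1 A M"
    using hom_compose[OF A p g'] by simp
qed

text \<open>
  Entailment tested on structures with carrier type \<open>nat \<Rightarrow> 'm\<close> is entailment tested on all
  structures in \<open>ISP(M)\<close>, because \<open>r\<close> itself carries a structure of this type.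
\<close>

lemma entails_all:
  fixes \<Sigma>1 :: "('f, 'r) signature" and M :: "('m, 'f, 'r) struc"
    and \<Sigma>2 :: "('g, 's) signature" and Mt :: "('m, 'g, 's) tstruc"
  assumes M: "total_struc \<Sigma>1 M" and Mt: "total_tstruc \<Sigma>2 Mt" and ae: "alter_ego \<Sigma>1 M \<Sigma>2 Mt"
    and r: "entails TYPE(nat \<Rightarrow> 'm) \<Sigma>1 M \<Sigma>2 Mt n r"
  shows "entails TYPE('a) \<Sigma>1 M \<Sigma>2 Mt n r"
  unfolding entails_def
proof (intro conjI ballI impI)
  have M': "is_struc \<Sigma>1 M" and Mt': "is_struc \<Sigma>2 Mt" and tM: "topspace (topo Mt) = carrier Mt"
    and cM: "carrier Mt = carrier M"
    using M Mt ae by (auto simp: total_struc_def total_tstruc_def alter_ego_def)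
  show fr: "forms_substruc \<Sigma>1 (pow_struc \<Sigma>1 M {..<n}) r"
    using r by (simp add: entails_def)
  then have cr: "closed_under \<Sigma>1 (pow_struc \<Sigma>1 M {..<n}) r"
    by (simp add: forms_substruc_def)
  have r_tup: "r \<subseteq> tuples n (carrier M)" using cr by (simp add: closed_under_def)
  define R where "R = restr \<Sigma>1 (pow_struc \<Sigma>1 M {..<n}) r"
  have Rc: "carrier R = r" by (simp add: R_def)
  have R: "is_struc \<Sigma>1 R" unfolding R_def by (rule is_struc_restr[OF cr])
  have idR: "restrict id r \<in> hom \<Sigma>1 R R"
  proof -
    have "compose {..<k} (restrict id r) z = z" if "z \<in> tuples k r" for k z
      using that by (fastforce simp: compose_def)
    then show ?thesis
      using R by (auto simp: hom_def Rc is_struc_def subset_iff)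
  qed
  have R_ISP: "R \<in> ISP \<Sigma>1 M"
    by (rule ISPI[OF M' R fr, of "restrict id r"])
       (use idR Rc in \<open>auto simp: isom_def simp flip: R_def intro!: bexI[of _ "restrict id r"]\<close>)
  define \<pi> where "\<pi> = (\<lambda>i\<in>{..<n}. \<lambda>b\<in>r. b i)"
  have \<pi>: "\<pi> i \<in> hom \<Sigma>1 R M" if "i < n" for i
  proof -
    have "\<pi> i = restrict (\<lambda>y\<in>{..<n} \<rightarrow>\<^sub>E carrier M. y i) r"
      using r_tup that by (auto simp: \<pi>_def fun_eq_iff)
    then show ?thesis
      using restrict_hom[OF proj_hom[OF M'] cr] that by (simp add: R_def)
  qed
  fix A :: "('a, 'f, 'r) struc" and \<alpha> x
  assume A_ISP: "A \<in> ISP \<Sigma>1 M" and \<alpha>: "\<alpha> \<in> thom \<Sigma>2 (dualD \<Sigma>1 M \<Sigma>2 Mt A) Mt"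
    and x: "x \<in> tuples n (hom \<Sigma>1 A M)"
    and xr: "\<forall>a\<in>carrier A. (\<lambda>i\<in>{..<n}. x i a) \<in> r"
  have A: "is_struc \<Sigma>1 A" using A_ISP by (simp add: ISP_def)
  define H where "H = (\<lambda>a\<in>carrier A. \<lambda>i\<in>{..<n}. x i a)"
  have H: "H \<in> hom \<Sigma>1 A R"
    unfolding R_def H_def
    by (rule hom_into_restr[OF A prod_hom[OF A]]) (use x xr in auto)
  have HR: "H a \<in> r" if "a \<in> carrier A" for a
    using that xr by (simp add: H_def)
  define \<rho> where "\<rho> = (\<lambda>y\<in>r \<rightarrow>\<^sub>E carrier Mt. \<lambda>a\<in>carrier A. y (H a))"
  let ?DR = "hom \<Sigma>1 R M" and ?DA = "hom \<Sigma>1 A M"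
  have \<rho>z: "\<rho> z = compose (carrier A) z H" if "z \<in> ?DR" for z
    using hom_PiE[OF that] by (simp add: \<rho>_def Rc cM compose_def)
  have \<rho>: "\<rho> \<in> hom \<Sigma>2 (pow_struc \<Sigma>2 Mt (carrier R)) (pow_struc \<Sigma>2 Mt (carrier A))"
    unfolding \<rho>_def Rc by (rule reindex_hom[OF Mt']) (rule HR)
  have \<rho>c: "continuous_map (product_topology (\<lambda>_. topo Mt) (carrier R))
              (product_topology (\<lambda>_. topo Mt) (carrier A)) \<rho>"
    unfolding \<rho>_def Rc by (rule reindex_continuous[OF tM]) (rule HR)
  note cR = dualD_closed[OF M' Mt' ae R]
  have \<rho>DA: "\<rho> ` ?DR \<subseteq> ?DA"
    using hom_compose[OF A H] by (auto simp: \<rho>z)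
  have \<alpha>': "\<alpha> \<in> hom \<Sigma>2 (restr \<Sigma>2 (pow_struc \<Sigma>2 Mt (carrier A)) ?DA) Mt"
    and \<alpha>c: "continuous_map (subtopology (product_topology (\<lambda>_. topo Mt) (carrier A)) ?DA) (topo Mt) \<alpha>"
    using \<alpha> by (auto simp: dualD_def thom_trestr_pow)
  define \<beta> where "\<beta> = compose ?DR \<alpha> (restrict \<rho> ?DR)"
  have \<beta>: "\<beta> \<in> thom \<Sigma>2 (dualD \<Sigma>1 M \<Sigma>2 Mt R) Mt"
    unfolding dualD_def thom_trestr_pow
  proof (intro CollectI conjI)
    have "restrict \<rho> ?DR \<in> hom \<Sigma>2 (restr \<Sigma>2 (pow_struc \<Sigma>2 Mt (carrier R)) ?DR)
            (restr \<Sigma>2 (pow_struc \<Sigma>2 Mt (carrier A)) ?DA)"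
      by (rule hom_into_restr[OF is_struc_restr[OF cR] restrict_hom[OF \<rho> cR]]) (use \<rho>DA in auto)
    from hom_compose[OF is_struc_restr[OF cR] this \<alpha>']
    show "\<beta> \<in> hom \<Sigma>2 (restr \<Sigma>2 (pow_struc \<Sigma>2 Mt (carrier R)) ?DR) Mt"
      by (simp add: \<beta>_def)
    have "continuous_map (subtopology (product_topology (\<lambda>_. topo Mt) (carrier R)) ?DR)
            (subtopology (product_topology (\<lambda>_. topo Mt) (carrier A)) ?DA) \<rho>"
      using \<rho>c \<rho>DA
      by (auto simp: continuous_map_in_subtopology intro: continuous_map_from_subtopology)
    from continuous_map_compose[OF this \<alpha>c]
    show "continuous_map (subtopology (product_topology (\<lambda>_. topo Mt) (carrier R)) ?DR) (topo Mt) \<beta>"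
      by (rule continuous_map_eq) (auto simp: \<beta>_def compose_def)
  qed
  have "\<pi> \<in> tuples n ?DR" using \<pi> by (auto simp: \<pi>_def)
  moreover have "(\<lambda>i\<in>{..<n}. \<pi> i b) = b" if "b \<in> r" for b
    using that r_tup by (auto simp: \<pi>_def fun_eq_iff PiE_iff extensional_def)
  then have "\<forall>b\<in>carrier R. (\<lambda>i\<in>{..<n}. \<pi> i b) \<in> r" by (simp add: Rc)
  ultimately have "compose {..<n} \<beta> \<pi> \<in> r"
    using r R_ISP \<beta> unfolding entails_def by blast
  moreover have "compose {..<n} \<beta> \<pi> = compose {..<n} \<alpha> x"
  proof
    fix i
    show "compose {..<n} \<beta> \<pi> i = compose {..<n} \<alpha> x i"
    proof (cases "i < n")
      case True
      then have xi: "x i \<in> extensional (carrier A)" using x hom_PiE by (fastforce simp: PiE_iff)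
      have "compose (carrier A) (\<pi> i) H = x i"
        using True HR xi by (auto simp: \<pi>_def H_def compose_def fun_eq_iff extensional_def)
      then show ?thesis
        using True \<pi>[OF True] by (simp add: \<beta>_def compose_def[of "{..<n}"] compose_def[of ?DR] \<rho>z)
    qed (simp add: compose_def)
  qed
  ultimately show "compose {..<n} \<alpha> x \<in> r" by simp
qed

end

theory Submission
  imports Defs
begin

text \<open>
  Consider a pairing \<open>b : A \<times> X \<rightarrow> M\<close> with all \<open>b(-, x) : A \<rightarrow> M\<close> homomorphisms and all
  \<open>b(a, -) : X \<rightarrow> M\<close> continuous homomorphisms.  By (2) the lattice homomorphisms \<open>\<omega> \<circ> b(-, x)\<close> separate
  the points of \<open>A\<close> as soon as the maps \<open>b(-, x)\<close> do, and then a compactness argument shows that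
  every lattice homomorphism \<open>A \<rightarrow> {0, 1}\<close> is some \<open>\<omega> \<circ> b(-, x)\<close>.  Dually, by (3) the maps
  \<open>\<omega> \<circ> b(a, -)\<close> separate the order of \<open>X\<close> as soon as the maps \<open>b(a, -)\<close> do, and then every continuous
  order-preserving map \<open>X \<rightarrow> {0, 1}\<close> is some \<open>\<omega> \<circ> b(a, -)\<close>.  Since \<open>x \<mapsto> \<omega> \<circ> x\<close> and \<open>\<alpha> \<mapsto> \<omega> \<circ> \<alpha>\<close> are
  injective, again by (3) and (2), all homomorphisms \<open>A \<rightarrow> M\<close> and all morphisms \<open>X \<rightarrow> M\<close> then come
  from the pairing as well.

  The evaluation pairings \<open>A \<times> D(A) \<rightarrow> M\<close> and \<open>E(X) \<times> X \<rightarrow> M\<close> give the full duality and the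
  isomorphisms in (c); pulling them back along embeddings \<open>A \<rightarrow> B\<close> and \<open>X \<rightarrow> Y\<close> gives injectivity.
\<close>

section \<open>Terms, formulas and homomorphisms\<close>

lemma compose_nth [simp]: "i < n \<Longrightarrow> compose {..<n} h x i = h (x i)"
  by (simp add: compose_def)

lemma trm_val_hom:
  assumes A: "is_struc \<Sigma> A" and x: "x \<in> tuples n (carrier A)" and t: "wf_trm \<Sigma> n t"
  shows trm_val_closed: "trm_val A t x \<in> carrier A"
    and "h \<in> hom \<Sigma> A B \<Longrightarrow> h (trm_val A t x) = trm_val B t (compose {..<n} h x)"
proof -
  \<comment> \<open>Both claims go through one induction: \<open>hom_op\<close> speaks only of
    tuples over the carrier, so the argument tuple must be known to lie there.\<close>
  have "trm_val A t x \<in> carrier A \<and>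
      (h \<in> hom \<Sigma> A B \<longrightarrow> h (trm_val A t x) = trm_val B t (compose {..<n} h x))"
    using t
  proof (induction t)
    case (Var i)
    then show ?case using x by auto
  next
    case (App f ts)
    let ?args = "\<lambda>C z. \<lambda>i\<in>{..<length ts}. map (\<lambda>t. trm_val C t z) ts ! i"
    have args: "?args A x \<in> tuples (opar \<Sigma> f) (carrier A)"
      using App by auto
    then have "opn A f (?args A x) \<in> carrier A"
      using A App.prems by (auto simp: is_struc_def)
    moreover have "compose {..<opar \<Sigma> f} h (?args A x) = ?args B (compose {..<n} h x)"
      if "h \<in> hom \<Sigma> A B"
      unfolding compose_def[of "{..<opar \<Sigma> f}"]
      by (rule ext) (use App that in \<open>auto simp: nth_mem\<close>)
    moreover have "h (opn A f (?args A x)) = opn B f (compose {..<opar \<Sigma> f} h (?args A x))"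
      if "h \<in> hom \<Sigma> A B"
      using hom_op[OF that _ args] App.prems by simp
    ultimately show ?case
      using App.prems by simp
  qed
  then show "trm_val A t x \<in> carrier A"
    and "h \<in> hom \<Sigma> A B \<Longrightarrow> h (trm_val A t x) = trm_val B t (compose {..<n} h x)"
    by auto
qed

lemma args_tuples:
  assumes "is_struc \<Sigma> A" "x \<in> tuples n (carrier A)" "\<forall>t\<in>set ts. wf_trm \<Sigma> n t"
  shows "(\<lambda>i\<in>{..<length ts}. map (\<lambda>t. trm_val A t x) ts ! i) \<in> tuples (length ts) (carrier A)"
  using trm_val_closed[OF assms(1,2)] assms(3) by auto

lemma args_hom:
  assumes "is_struc \<Sigma> A" "x \<in> tuples n (carrier A)" "\<forall>t\<in>set ts. wf_trm \<Sigma> n t" "h \<in> hom \<Sigma> A B"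
  shows "compose {..<length ts} h (\<lambda>i\<in>{..<length ts}. map (\<lambda>t. trm_val A t x) ts ! i)
    = (\<lambda>i\<in>{..<length ts}. map (\<lambda>t. trm_val B t (compose {..<n} h x)) ts ! i)"
  using trm_val_hom(2)[OF assms(1,2) _ assms(4)] assms(3)
  by (auto simp: compose_def[of "{..<length ts}"] fun_eq_iff)

lemma sat_hom:
  assumes A: "is_struc \<Sigma> A" and x: "x \<in> tuples n (carrier A)" and h: "h \<in> hom \<Sigma> A B"
    and \<phi>: "wf_atom \<Sigma> n \<phi>" and s: "sat A \<phi> x"
  shows "sat B \<phi> (compose {..<n} h x)"
proof (cases \<phi>)
  case (EqAtom s t)
  then show ?thesis
    using \<phi> s by (simp flip: trm_val_hom(2)[OF A x _ h])
next
  case (RelAtom r ts)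
  then have r: "r \<in> rels \<Sigma>" "length ts = relar \<Sigma> r" and ts: "\<forall>t\<in>set ts. wf_trm \<Sigma> n t"
    using \<phi> by auto
  have "(\<lambda>i\<in>{..<length ts}. map (\<lambda>t. trm_val A t x) ts ! i) \<in> rel A r"
    using RelAtom s by simp
  from hom_rel[OF h r(1) this] show ?thesis
    using RelAtom r(2) args_hom[OF A x ts h] by simp
qed

text \<open>In other words, the maps in \<open>H\<close> jointly embed \<open>A\<close> in the power \<open>M\<^sup>H\<close>.\<close>

definition separating ::
  "('f, 'r) signature \<Rightarrow> ('a, 'f, 'r, 'y) struc_scheme \<Rightarrow> ('m, 'f, 'r, 'z) struc_scheme \<Rightarrow> ('a \<Rightarrow> 'm) set \<Rightarrow> bool"
where
  "separating \<Sigma> A M H \<longleftrightarrow>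
     (\<forall>a\<in>carrier A. \<forall>b\<in>carrier A. (\<forall>h\<in>H. h a = h b) \<longrightarrow> a = b) \<and>
     (\<forall>r\<in>rels \<Sigma>. \<forall>x\<in>tuples (relar \<Sigma> r) (carrier A).
        (\<forall>h\<in>H. compose {..<relar \<Sigma> r} h x \<in> rel M r) \<longrightarrow> x \<in> rel A r)"

lemma separating_pointsD:
  "separating \<Sigma> A M H \<Longrightarrow> a \<in> carrier A \<Longrightarrow> b \<in> carrier A \<Longrightarrow> (\<And>h. h \<in> H \<Longrightarrow> h a = h b) \<Longrightarrow> a = b"
  unfolding separating_def by blast

lemma separating_relD:
  "separating \<Sigma> A M H \<Longrightarrow> r \<in> rels \<Sigma> \<Longrightarrow> x \<in> tuples (relar \<Sigma> r) (carrier A) \<Longrightarrow>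
    (\<And>h. h \<in> H \<Longrightarrow> compose {..<relar \<Sigma> r} h x \<in> rel M r) \<Longrightarrow> x \<in> rel A r"
  unfolding separating_def by blast

text \<open>Terms commute with every \<open>h\<close> in \<open>H\<close>, so each \<open>h\<close>
  turns the atom at \<open>x\<close> into the same equation or relation between images of term
  values; the two clauses of \<open>separating\<close> reflect exactly these two kinds of
  atoms.\<close>

lemma sat_separating:
  assumes A: "is_struc \<Sigma> A" and x: "x \<in> tuples n (carrier A)" and \<phi>: "wf_atom \<Sigma> n \<phi>"
    and H: "separating \<Sigma> A M H" "H \<subseteq> hom \<Sigma> A M"
    and s: "\<And>h. h \<in> H \<Longrightarrow> sat M \<phi> (compose {..<n} h x)"
  shows "sat A \<phi> x"
proof (cases \<phi>)
  case (EqAtom t u)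
  have "trm_val A t x = trm_val A u x"
  proof (rule separating_pointsD[OF H(1)])
    fix h assume h: "h \<in> H"
    then have "h \<in> hom \<Sigma> A M" using H(2) by auto
    then show "h (trm_val A t x) = h (trm_val A u x)"
      using s[OF h] \<phi> trm_val_hom(2)[OF A x _ \<open>h \<in> hom \<Sigma> A M\<close>] EqAtom by simp
  qed (use \<phi> EqAtom trm_val_closed[OF A x] in auto)
  then show ?thesis using EqAtom by simp
next
  case (RelAtom r ts)
  then have r: "r \<in> rels \<Sigma>" "length ts = relar \<Sigma> r" and ts: "\<forall>t\<in>set ts. wf_trm \<Sigma> n t"
    using \<phi> by auto
  have "(\<lambda>i\<in>{..<length ts}. map (\<lambda>t. trm_val A t x) ts ! i) \<in> rel A r"
  proof (rule separating_relD[OF H(1) r(1)])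
    show "(\<lambda>i\<in>{..<length ts}. map (\<lambda>t. trm_val A t x) ts ! i) \<in> tuples (relar \<Sigma> r) (carrier A)"
      using args_tuples[OF A x ts] r(2) by simp
    fix h assume h: "h \<in> H"
    then have "h \<in> hom \<Sigma> A M" using H(2) by auto
    from args_hom[OF A x ts this] s[OF h] RelAtom r(2)
    show "compose {..<relar \<Sigma> r} h (\<lambda>i\<in>{..<length ts}. map (\<lambda>t. trm_val A t x) ts ! i) \<in> rel M r"
      by simp
  qed
  then show ?thesis using RelAtom by simp
qed

section \<open>Embeddings into powers and their coordinate maps\<close>

lemma pow_embedding_component:
  assumes M: "is_struc \<Sigma> M" and A: "is_struc \<Sigma> A"
    and N: "N \<subseteq> S \<rightarrow>\<^sub>E carrier M"
    and h: "h \<in> hom \<Sigma> A (restr \<Sigma> (pow_struc \<Sigma> M S) N)"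
    and s: "s \<in> S"
  shows "(\<lambda>a\<in>carrier A. h a s) \<in> hom \<Sigma> A M"
proof -
  have h': "h \<in> hom \<Sigma> A (pow_struc \<Sigma> M S)"
    using hom_from_restr_codomain[OF h] N by simp
  have "compose (carrier A) (\<lambda>y\<in>S \<rightarrow>\<^sub>E carrier M. y s) h = (\<lambda>a\<in>carrier A. h a s)"
    unfolding compose_def by (rule restrict_ext) (use hom_PiE[OF h'] in auto)
  then show ?thesis using hom_compose[OF A h' proj_hom[OF M s]] by simp
qed

text \<open>Points that agree in all coordinates have the same image under \<open>h\<close>, and the
  left inverse \<open>k\<close> recovers them. Relations of a power hold coordinatewise, so a
  relation valid under all coordinate maps holds for the image in \<open>N\<close>, and
  \<open>k\<close> transports it back to \<open>A\<close>. As \<open>H\<close> need only contain the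
  coordinate maps, it can be taken to be all homomorphisms or all continuous ones.\<close>

lemma pow_embedding_separating:
  assumes A: "is_struc \<Sigma> A"
    and N: "N \<subseteq> S \<rightarrow>\<^sub>E carrier M"
    and h: "h \<in> hom \<Sigma> A (restr \<Sigma> (pow_struc \<Sigma> M S) N)"
    and k: "k \<in> hom \<Sigma> (restr \<Sigma> (pow_struc \<Sigma> M S) N) A"
    and kh: "\<And>a. a \<in> carrier A \<Longrightarrow> k (h a) = a"
    and H: "\<And>s. s \<in> S \<Longrightarrow> (\<lambda>a\<in>carrier A. h a s) \<in> H"
  shows "separating \<Sigma> A M H"
  unfolding separating_def
proof (intro conjI ballI impI)
  have hN: "h a \<in> N" if "a \<in> carrier A" for a
    using hom_PiE[OF h] that by auto
  fix a b assume ab: "a \<in> carrier A" "b \<in> carrier A" and eq: "\<forall>h\<in>H. h a = h b"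
  have "h a s = h b s" for s
  proof (cases "s \<in> S")
    case True
    then show ?thesis using eq[rule_format, OF H[OF True]] ab by simp
  next
    case False
    \<comment> \<open>Outside \<open>S\<close> both functions take the default value
      \<open>undefined\<close>.\<close>
    have "h a \<in> extensional S" "h b \<in> extensional S"
      using hN[OF ab(1)] hN[OF ab(2)] N by (auto simp: PiE_iff)
    then show ?thesis using False by (simp add: extensional_def)
  qed
  then show "a = b" using kh ab by (metis ext)
next
  fix r x assume r: "r \<in> rels \<Sigma>" and x: "x \<in> tuples (relar \<Sigma> r) (carrier A)"
    and R: "\<forall>h\<in>H. compose {..<relar \<Sigma> r} h x \<in> rel M r"
  have hx: "compose {..<relar \<Sigma> r} h x \<in> tuples (relar \<Sigma> r) N"
    using hom_PiE[OF h] by (intro tuples_compose[OF _ x]) auto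
  have "(\<lambda>i\<in>{..<relar \<Sigma> r}. compose {..<relar \<Sigma> r} h x i s) \<in> rel M r" if "s \<in> S" for s
  proof -
    have "(\<lambda>i\<in>{..<relar \<Sigma> r}. compose {..<relar \<Sigma> r} h x i s)
        = compose {..<relar \<Sigma> r} (\<lambda>a\<in>carrier A. h a s) x"
      unfolding compose_def by (rule restrict_ext) (use x in auto)
    then show ?thesis using R H[OF that] by simp
  qed
  moreover have "compose {..<relar \<Sigma> r} h x \<in> tuples (relar \<Sigma> r) (S \<rightarrow>\<^sub>E carrier M)"
    using hx N PiE_mono[of "{..<relar \<Sigma> r}" "\<lambda>_. N"] by blast
  ultimately have "compose {..<relar \<Sigma> r} h x \<in> rel (restr \<Sigma> (pow_struc \<Sigma> M S) N) r"
    using hx by (simp add: pow_struc_def del: restrict_apply)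
  from hom_rel[OF k r this]
  have "compose {..<relar \<Sigma> r} k (compose {..<relar \<Sigma> r} h x) \<in> rel A r" .
  moreover have "compose {..<relar \<Sigma> r} k (compose {..<relar \<Sigma> r} h x) = x"
    by (rule ext) (use x kh in \<open>auto simp: compose_def PiE_iff extensional_def\<close>)
  ultimately show "x \<in> rel A r" by simp
qed

lemma ISP_D:
  fixes A :: "('a, 'f, 'r) struc" and M :: "('m, 'f, 'r) struc"
  assumes M: "is_struc \<Sigma> M" and A: "A \<in> ISP \<Sigma> M"
  shows "is_struc \<Sigma> A" and "separating \<Sigma> A M (hom \<Sigma> A M)"
proof -
  show A': "is_struc \<Sigma> A" using A by (simp add: ISP_def)
  from A obtain S N h k where N: "forms_substruc \<Sigma> (pow_struc \<Sigma> M (S :: ('a \<Rightarrow> 'm) set)) N"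
    and h: "h \<in> hom \<Sigma> A (restr \<Sigma> (pow_struc \<Sigma> M S) N)"
    and k: "k \<in> hom \<Sigma> (restr \<Sigma> (pow_struc \<Sigma> M S) N) A"
    and kh: "\<forall>a\<in>carrier A. k (h a) = a"
    unfolding ISP_def isom_def by blast
  have N': "N \<subseteq> S \<rightarrow>\<^sub>E carrier M"
    using N by (simp add: forms_substruc_def closed_under_def)
  show "separating \<Sigma> A M (hom \<Sigma> A M)"
    by (rule pow_embedding_separating[OF A' N' h k])
       (use kh pow_embedding_component[OF M A' N' h] in auto)
qed

lemma IScP_D:
  fixes X :: "('x, 'f, 'r) tstruc" and M :: "('m, 'f, 'r) tstruc"
  assumes M: "total_tstruc \<Sigma> M" and X: "X \<in> IScP \<Sigma> M"
  shows "is_struc \<Sigma> X" and "topspace (topo X) = carrier X" and "compact_space (topo X)"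
    and "separating \<Sigma> X M (thom \<Sigma> X M)"
proof -
  have M': "is_struc \<Sigma> M" "compact_space (topo M)" "topspace (topo M) = carrier M"
    using M by (auto simp: total_tstruc_def total_struc_def)
  show X': "is_struc \<Sigma> X" and tX: "topspace (topo X) = carrier X"
    using X by (auto simp: IScP_def)
  from X obtain S N h k where N: "forms_closed_tsubstruc \<Sigma> (pow_tstruc \<Sigma> M (S :: ('x \<Rightarrow> 'm) set)) N"
    and h: "h \<in> hom \<Sigma> X (restr \<Sigma> (pow_struc \<Sigma> M S) N)"
    and hc: "continuous_map (topo X) (subtopology (product_topology (\<lambda>_. topo M) S) N) h"
    and k: "k \<in> hom \<Sigma> (restr \<Sigma> (pow_struc \<Sigma> M S) N) X"
    and kc: "continuous_map (subtopology (product_topology (\<lambda>_. topo M) S) N) (topo X) k"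
    and kh: "\<forall>a\<in>carrier X. k (h a) = a"
    unfolding IScP_def tisom_def thom_trestr_pow by blast
  have N': "N \<subseteq> S \<rightarrow>\<^sub>E carrier M" and Ncl: "closedin (product_topology (\<lambda>_. topo M) S) N"
    using N by (auto simp: forms_closed_tsubstruc_def closed_under_def)
  have "(\<lambda>x\<in>carrier X. h x s) \<in> thom \<Sigma> X M" if "s \<in> S" for s
  proof -
    have "continuous_map (topo X) (topo M) (\<lambda>x. h x s)"
      using hc that by (simp add: continuous_map_in_subtopology continuous_map_componentwise)
    then have "continuous_map (topo X) (topo M) (\<lambda>x\<in>carrier X. h x s)"
      by (rule continuous_map_eq) (simp add: tX)
    then show ?thesis
      using pow_embedding_component[OF M'(1) X' N' h that] by (simp add: thom_def)
  qed
  then show "separating \<Sigma> X M (thom \<Sigma> X M)"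
    by (intro pow_embedding_separating[OF X' N' h k]) (use kh in auto)
  \<comment> \<open>Compactness of \<open>X\<close>: the power is compact by Tychonoff's theorem,
    \<open>N\<close> is closed in it, and \<open>X\<close> is the continuous image of
    \<open>N\<close> under \<open>k\<close>.\<close>
  have "compact_space (product_topology (\<lambda>_. topo M) S)"
    using M'(2) by (simp add: compact_space_product_topology)
  then have "compactin (product_topology (\<lambda>_. topo M) S) N"
    using Ncl by (rule closedin_compact_space)
  then have "compact_space (subtopology (product_topology (\<lambda>_. topo M) S) N)"
    by (rule compact_space_subtopology)
  then have "compactin (topo X) (k ` topspace (subtopology (product_topology (\<lambda>_. topo M) S) N))"
    using image_compactin[OF _ kc] by (simp add: compact_space_def)
  moreover have "k ` topspace (subtopology (product_topology (\<lambda>_. topo M) S) N) = carrier X"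
  proof -
    have "topspace (subtopology (product_topology (\<lambda>_. topo M) S) N) = N"
      using closedin_subset[OF Ncl] by auto
    moreover have "k ` N \<subseteq> carrier X" using hom_PiE[OF k] by auto
    moreover have "x \<in> k ` N" if "x \<in> carrier X" for x
      using kh that hom_PiE[OF h] that by (metis PiE_mem imageI restr_simps(1))
    ultimately show ?thesis by blast
  qed
  ultimately show "compact_space (topo X)" by (simp add: compact_space_def tX)
qed

section \<open>Criteria for a bijective homomorphism to be an isomorphism\<close>

text \<open>By surjectivity every tuple over \<open>B\<close> is an image, so the laws for
  \<open>h\<close>, together with reflection of relations, become the laws for the inverse. The
  inverse is named by an equation so that its continuity can be discussed separately.\<close>

lemma isomI:
  assumes B: "\<And>r. r \<in> rels \<Sigma> \<Longrightarrow> rel B r \<subseteq> tuples (relar \<Sigma> r) (carrier B)"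
    and h: "h \<in> hom \<Sigma> A B" and A: "is_struc \<Sigma> A"
    and bij: "bij_betw h (carrier A) (carrier B)"
    and refl: "\<And>r x. r \<in> rels \<Sigma> \<Longrightarrow> x \<in> tuples (relar \<Sigma> r) (carrier A) \<Longrightarrow>
      compose {..<relar \<Sigma> r} h x \<in> rel B r \<Longrightarrow> x \<in> rel A r"
    and k_def: "k = restrict (inv_into (carrier A) h) (carrier B)"
  shows "k \<in> hom \<Sigma> B A" and "\<forall>a\<in>carrier A. k (h a) = a" and "\<forall>b\<in>carrier B. h (k b) = b"
    and "isom \<Sigma> A B h"
proof -
  have kA: "k b \<in> carrier A" and hk: "h (k b) = b" if "b \<in> carrier B" for b
    using that bij by (auto simp: k_def bij_betw_def inv_into_into f_inv_into_f)
  then show hk': "\<forall>b\<in>carrier B. h (k b) = b" by simp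
  show kh: "\<forall>a\<in>carrier A. k (h a) = a"
    using bij hom_PiE[OF h] by (auto simp: k_def bij_betw_def)
  have hkx: "compose {..<n} h (compose {..<n} k x) = x" if "x \<in> tuples n (carrier B)" for n x
    using that hk by (fastforce simp: compose_def PiE_iff extensional_def)
  have kx: "compose {..<n} k x \<in> tuples n (carrier A)" if "x \<in> tuples n (carrier B)" for n x
    using that kA by (intro tuples_compose) auto
  show k: "k \<in> hom \<Sigma> B A"
    unfolding hom_def
  proof (intro CollectI conjI ballI)
    show "k \<in> carrier B \<rightarrow>\<^sub>E carrier A" using kA by (auto simp: k_def)
  next
    fix f x assume f: "f \<in> ops \<Sigma>" and x: "x \<in> tuples (opar \<Sigma> f) (carrier B)"
    have "h (opn A f (compose {..<opar \<Sigma> f} k x)) = opn B f x"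
      using hom_op[OF h f kx[OF x]] hkx[OF x] by simp
    moreover have "opn A f (compose {..<opar \<Sigma> f} k x) \<in> carrier A"
      using A f kx[OF x] by (auto simp: is_struc_def)
    ultimately show "k (opn B f x) = opn A f (compose {..<opar \<Sigma> f} k x)"
      using kh by metis
  next
    fix r x assume r: "r \<in> rels \<Sigma>" and x: "x \<in> rel B r"
    have xt: "x \<in> tuples (relar \<Sigma> r) (carrier B)" using B[OF r] x by blast
    show "compose {..<relar \<Sigma> r} k x \<in> rel A r"
      using refl[OF r kx[OF xt]] hkx[OF xt] x by simp
  qed
  then show "isom \<Sigma> A B h" using h kh hk' by (auto simp: isom_def)
qed

text \<open>A continuous bijection from a compact space to a Hausdorff space is a homeomorphism; the
  algebraic part is the criterion without topology.\<close>

lemma tisomI: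
  fixes X :: "('x, 'f, 'r) tstruc" and Y :: "('y, 'f, 'r) tstruc"
  assumes X: "is_struc \<Sigma> X" "topspace (topo X) = carrier X" "compact_space (topo X)"
    and Y: "is_struc \<Sigma> Y" "topspace (topo Y) = carrier Y" "Hausdorff_space (topo Y)"
    and h: "h \<in> thom \<Sigma> X Y" and bij: "bij_betw h (carrier X) (carrier Y)"
    and refl: "\<And>r x. r \<in> rels \<Sigma> \<Longrightarrow> x \<in> tuples (relar \<Sigma> r) (carrier X) \<Longrightarrow>
      compose {..<relar \<Sigma> r} h x \<in> rel Y r \<Longrightarrow> x \<in> rel X r"
  shows "tisom \<Sigma> X Y h"
proof -
  define k where "k = restrict (inv_into (carrier X) h) (carrier Y)"
  have h': "h \<in> hom \<Sigma> X Y" and hc: "continuous_map (topo X) (topo Y) h"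
    using h by (auto simp: thom_def)
  have "\<And>r. r \<in> rels \<Sigma> \<Longrightarrow> rel Y r \<subseteq> tuples (relar \<Sigma> r) (carrier Y)"
    using Y(1) by (simp add: is_struc_def)
  note k = isomI(1-3)[OF this h' X(1) bij refl k_def]
  have "homeomorphic_map (topo X) (topo Y) h"
    using bij X Y hc by (intro continuous_imp_homeomorphic_map) (auto simp: bij_betw_def)
  then obtain g where g: "homeomorphic_maps (topo X) (topo Y) h g"
    by (auto simp: homeomorphic_map_maps)
  \<comment> \<open>The topological inverse \<open>g\<close> is determined only on the space;
    \<open>k\<close> agrees with it there and is extensional, as members of \<open>hom\<close> must
    be.\<close>
  have "continuous_map (topo Y) (topo X) k"
  proof (rule continuous_map_eq)
    show gc: "continuous_map (topo Y) (topo X) g" using g by (simp add: homeomorphic_maps_def)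
    fix y assume y: "y \<in> topspace (topo Y)"
    then have "g y \<in> carrier X" "h (g y) = y"
      using g X(2) gc by (auto simp: homeomorphic_maps_def continuous_map_def)
    then show "g y = k y" using k(2) by metis
  qed
  then show ?thesis using k h by (auto simp: tisom_def thom_def)
qed

section \<open>Algebras and topological structures of morphisms\<close>

text \<open>A \<open>k\<close>-tuple of \<open>n\<close>-tuples is a matrix with rows
  \<open>x j\<close>. Commutation of two operations compares evaluation along rows and along
  columns, hence the transpose.\<close>

lemma transpose_tuples:
  assumes x: "x \<in> tuples k (tuples n C)"
  shows "(\<lambda>i\<in>{..<n}. \<lambda>j\<in>{..<k}. x j i) \<in> tuples n (tuples k C)"
    and "j < k \<Longrightarrow> (\<lambda>i\<in>{..<n}. (\<lambda>i\<in>{..<n}. \<lambda>j\<in>{..<k}. x j i) i j) = x j"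
proof -
  have xij: "x j i \<in> C" if "i < n" "j < k" for i j
    using tuples_nth[OF tuples_nth[OF x that(2)] that(1)] .
  then show "(\<lambda>i\<in>{..<n}. \<lambda>j\<in>{..<k}. x j i) \<in> tuples n (tuples k C)" by auto
  show "(\<lambda>i\<in>{..<n}. (\<lambda>i\<in>{..<n}. \<lambda>j\<in>{..<k}. x j i) i j) = x j" if "j < k"
    using tuples_nth[OF x that] that by (auto simp: fun_eq_iff PiE_iff extensional_def)
qed

text \<open>Coordinate \<open>j\<close> of the operation in the power, applied to the columns, sees
  precisely row \<open>j\<close>.\<close>

lemma pow_op_transpose:
  assumes x: "x \<in> tuples k (tuples n (carrier M))" and n: "n = opar \<Sigma> f"
  shows "opn (pow_struc \<Sigma> M {..<k}) f (\<lambda>i\<in>{..<n}. \<lambda>j\<in>{..<k}. x j i)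
    = compose {..<k} (restrict (opn M f) (tuples n (carrier M))) x"
proof
  fix j
  show "opn (pow_struc \<Sigma> M {..<k}) f (\<lambda>i\<in>{..<n}. \<lambda>j\<in>{..<k}. x j i) j
      = compose {..<k} (restrict (opn M f) (tuples n (carrier M))) x j"
  proof (cases "j < k")
    case True
    have "opn (pow_struc \<Sigma> M {..<k}) f (\<lambda>i\<in>{..<n}. \<lambda>j\<in>{..<k}. x j i) j
        = opn M f (\<lambda>i\<in>{..<n}. (\<lambda>i\<in>{..<n}. \<lambda>j\<in>{..<k}. x j i) i j)"
      using True by (simp add: pow_struc_def n)
    then show ?thesis
      using True tuples_nth[OF x True] by (simp only: transpose_tuples(2)[OF x True]) simp
  qed (simp add: pow_struc_def compose_def)
qed

text \<open>That an operation of \<open>M\<close> commutes with one of \<open>Mt\<close> is a condition symmetric in the two.\<close>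

lemma alter_ego_op_hom:
  assumes M: "is_struc \<Sigma>1 M" and Mt: "is_struc \<Sigma>2 Mt" and ae: "alter_ego \<Sigma>1 M \<Sigma>2 Mt"
    and f: "f \<in> ops \<Sigma>1"
  shows "restrict (opn M f) (tuples (opar \<Sigma>1 f) (carrier M))
    \<in> hom \<Sigma>2 (pow_struc \<Sigma>2 Mt {..<opar \<Sigma>1 f}) Mt"
    (is "?F \<in> _")
  unfolding hom_def
proof (intro CollectI conjI ballI)
  have cM: "carrier Mt = carrier M" using ae by (simp add: alter_ego_def)
  let ?n = "opar \<Sigma>1 f"
  show F: "?F \<in> carrier (pow_struc \<Sigma>2 Mt {..<?n}) \<rightarrow>\<^sub>E carrier Mt"
    using M f by (auto simp: cM is_struc_def)
  fix r x assume r: "r \<in> rels \<Sigma>2" and x: "x \<in> rel (pow_struc \<Sigma>2 Mt {..<?n}) r"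
  let ?k = "relar \<Sigma>2 r"
  let ?x = "\<lambda>i\<in>{..<?n}. \<lambda>j\<in>{..<?k}. x j i"
  have xt: "x \<in> tuples ?k (tuples ?n (carrier M))"
    using x by (simp add: pow_struc_def cM)
  \<comment> \<open>A relation of \<open>Mt\<close> is a substructure of a power of
    \<open>M\<close>, so it absorbs \<open>f\<close> applied to its members, here the columns of
    \<open>x\<close>.\<close>
  have "closed_under \<Sigma>1 (pow_struc \<Sigma>1 M {..<?k}) (rel Mt r)"
    using ae r by (simp add: alter_ego_def forms_substruc_def)
  moreover have "?x \<in> tuples ?n (rel Mt r)"
    using x by (auto simp: pow_struc_def)
  ultimately have "opn (pow_struc \<Sigma>1 M {..<?k}) f ?x \<in> rel Mt r"
    using f by (simp add: closed_under_def)
  then show "compose {..<?k} ?F x \<in> rel Mt r"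
    by (simp only: pow_op_transpose[OF xt refl])
next
  have cM: "carrier Mt = carrier M" using ae by (simp add: alter_ego_def)
  let ?n = "opar \<Sigma>1 f"
  fix g x assume g: "g \<in> ops \<Sigma>2" and x: "x \<in> tuples (opar \<Sigma>2 g) (carrier (pow_struc \<Sigma>2 Mt {..<?n}))"
  let ?k = "opar \<Sigma>2 g"
  let ?x = "\<lambda>i\<in>{..<?n}. \<lambda>j\<in>{..<?k}. x j i"
  let ?G = "restrict (opn Mt g) (tuples ?k (carrier M))"
  have xt: "x \<in> tuples ?k (tuples ?n (carrier M))" using x by (simp add: cM)
  have xt': "?x \<in> tuples ?n (tuples ?k (carrier M))" by (rule transpose_tuples[OF xt])
  have G: "?G \<in> hom \<Sigma>1 (pow_struc \<Sigma>1 M {..<?k}) M"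
    using ae g by (simp add: alter_ego_def)
  have gx: "opn (pow_struc \<Sigma>2 Mt {..<?n}) g x = compose {..<?n} ?G ?x"
  proof
    fix i
    show "opn (pow_struc \<Sigma>2 Mt {..<?n}) g x i = compose {..<?n} ?G ?x i"
      using tuples_nth[OF xt', of i] by (cases "i < ?n") (simp_all add: pow_struc_def compose_def)
  qed
  have Fx: "compose {..<?k} ?F x \<in> tuples ?k (carrier M)"
    using M f by (intro tuples_compose[OF _ xt]) (auto simp: is_struc_def)
  have "compose {..<?n} ?G ?x \<in> tuples ?n (carrier M)"
    using hom_PiE[OF G] by (intro tuples_compose[OF _ xt']) auto
  \<comment> \<open>The two sides evaluate the matrix \<open>x\<close> in two orders:
    \<open>g\<close> on columns and then \<open>f\<close>, or \<open>f\<close> on rows and then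
    \<open>g\<close>. They agree because \<open>?G\<close> is a homomorphism.\<close>
  then have "?F (opn (pow_struc \<Sigma>2 Mt {..<?n}) g x) = opn M f (compose {..<?n} ?G ?x)"
    by (simp add: gx)
  also have "\<dots> = ?G (opn (pow_struc \<Sigma>1 M {..<?k}) f ?x)"
    using hom_op[OF G f, of ?x] xt' by simp
  also have "\<dots> = opn Mt g (compose {..<?k} ?F x)"
    using Fx by (simp only: pow_op_transpose[OF xt refl]) simp
  finally show "?F (opn (pow_struc \<Sigma>2 Mt {..<?n}) g x) = opn Mt g (compose {..<?k} ?F x)" .
qed

text \<open>Applying \<open>f\<close> pointwise to morphisms is composing their product map into a
  power of \<open>Mt\<close> with \<open>f\<close>, and \<open>f\<close> is a homomorphism out of
  that power by the symmetric form of commutation and continuous by the alter ego condition.\<close>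

lemma dualE_closed:
  assumes M: "is_struc \<Sigma>1 M" and Mt: "is_struc \<Sigma>2 Mt" "topspace (topo Mt) = carrier Mt"
    and ae: "alter_ego \<Sigma>1 M \<Sigma>2 Mt"
    and X: "is_struc \<Sigma>2 X" "topspace (topo X) = carrier X"
  shows "closed_under \<Sigma>1 (pow_struc \<Sigma>1 M (carrier X)) (thom \<Sigma>2 X Mt)"
  unfolding closed_under_def
proof (intro conjI ballI)
  have cM: "carrier Mt = carrier M" using ae by (simp add: alter_ego_def)
  show "thom \<Sigma>2 X Mt \<subseteq> carrier (pow_struc \<Sigma>1 M (carrier X))"
    using cM by (auto simp: thom_def dest: hom_PiE)
  fix f y assume f: "f \<in> ops \<Sigma>1" and y: "y \<in> tuples (opar \<Sigma>1 f) (thom \<Sigma>2 X Mt)"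
  let ?n = "opar \<Sigma>1 f"
  let ?p = "\<lambda>x\<in>carrier X. \<lambda>i\<in>{..<?n}. y i x"
  let ?F = "restrict (opn M f) (tuples ?n (carrier M))"
  have yi: "y i \<in> thom \<Sigma>2 X Mt" if "i < ?n" for i using y that by auto
  then have p: "?p \<in> hom \<Sigma>2 X (pow_struc \<Sigma>2 Mt {..<?n})"
    by (intro prod_hom[OF X(1)]) (auto simp: thom_def)
  then have pM: "?p x \<in> tuples ?n (carrier M)" if "x \<in> carrier X" for x
    using PiE_mem[OF hom_PiE[OF p] that] cM by simp
  have eq: "opn (pow_struc \<Sigma>1 M (carrier X)) f y x = compose (carrier X) ?F ?p x" for x
    using pM[of x] by (cases "x \<in> carrier X") (simp_all add: pow_struc_def compose_def)
  then have eq': "opn (pow_struc \<Sigma>1 M (carrier X)) f y = compose (carrier X) ?F ?p" ..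
  have "continuous_map (topo X) (product_topology (\<lambda>_. topo Mt) {..<?n}) (\<lambda>x. \<lambda>i\<in>{..<?n}. y i x)"
    using yi by (auto simp: continuous_map_componentwise thom_def)
  moreover have "continuous_map (product_topology (\<lambda>_. topo Mt) {..<?n}) (topo Mt) (opn M f)"
    using ae f by (simp add: alter_ego_def)
  ultimately have "continuous_map (topo X) (topo Mt) (opn M f \<circ> (\<lambda>x. \<lambda>i\<in>{..<?n}. y i x))"
    by (rule continuous_map_compose)
  then have "continuous_map (topo X) (topo Mt) (opn (pow_struc \<Sigma>1 M (carrier X)) f y)"
    by (rule continuous_map_eq) (simp add: X(2) pow_struc_def)
  moreover have "opn (pow_struc \<Sigma>1 M (carrier X)) f y \<in> hom \<Sigma>2 X Mt"
    using hom_compose[OF X(1) p alter_ego_op_hom[OF M Mt(1) ae f]] unfolding eq' .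
  ultimately show "opn (pow_struc \<Sigma>1 M (carrier X)) f y \<in> thom \<Sigma>2 X Mt"
    by (simp add: thom_def)
qed

section \<open>Closedness of the set of homomorphisms in the power\<close>

lemma closedin_Ball:
  assumes "\<And>i. i \<in> I \<Longrightarrow> closedin T {y \<in> topspace T. P i y}"
  shows "closedin T {y \<in> topspace T. \<forall>i\<in>I. P i y}"
\<comment> \<open>For empty \<open>I\<close> the set is the whole space, which is not given by an
  intersection over \<open>I\<close>.\<close>
proof (cases "I = {}")
  case False
  then have "{y \<in> topspace T. \<forall>i\<in>I. P i y} = (\<Inter>i\<in>I. {y \<in> topspace T. P i y})" by auto
  then show ?thesis using assms False by (simp add: closedin_INT)
qed simp

text \<open>Every instance of the homomorphism conditions is closed: an equation between continuous
  maps into a Hausdorff space, as the operations of \<open>M\<close> are continuous, or the preimage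
  of a closed relation of \<open>M\<close>. The homomorphisms are the intersection.\<close>

lemma dualD_closedin:
  assumes Mt: "total_tstruc \<Sigma>2 Mt" and ae: "alter_ego \<Sigma>1 M \<Sigma>2 Mt" and A: "is_struc \<Sigma>1 A"
  shows "closedin (product_topology (\<lambda>_. topo Mt) (carrier A)) (hom \<Sigma>1 A M)" (is "closedin ?P _")
proof -
  have cM: "carrier Mt = carrier M" using ae by (simp add: alter_ego_def)
  have tM: "topspace (topo Mt) = carrier M" and haus: "Hausdorff_space (topo Mt)"
    using Mt cM by (auto simp: total_tstruc_def)
  have tP: "topspace ?P = carrier A \<rightarrow>\<^sub>E carrier M" by (simp add: tM)
  have comp: "continuous_map ?P (product_topology (\<lambda>_. topo Mt) {..<n}) (\<lambda>y. compose {..<n} y x)"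
    if "x \<in> tuples n (carrier A)" for n x
    using that unfolding compose_def
    by (auto simp: continuous_map_componentwise intro!: continuous_map_product_projection)
  have "closedin ?P {y \<in> topspace ?P. \<forall>f\<in>ops \<Sigma>1. \<forall>x\<in>tuples (opar \<Sigma>1 f) (carrier A).
      y (opn A f x) = opn M f (compose {..<opar \<Sigma>1 f} y x)}"
  proof (intro closedin_Ball closedin_continuous_maps_eq[OF haus])
    fix f x assume f: "f \<in> ops \<Sigma>1" and x: "x \<in> tuples (opar \<Sigma>1 f) (carrier A)"
    have "opn A f x \<in> carrier A" using A f x by (auto simp: is_struc_def)
    then show "continuous_map ?P (topo Mt) (\<lambda>y. y (opn A f x))"
      by (rule continuous_map_product_projection)
    have "continuous_map (product_topology (\<lambda>_. topo Mt) {..<opar \<Sigma>1 f}) (topo Mt) (opn M f)"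
      using ae f by (simp add: alter_ego_def)
    from continuous_map_compose[OF comp[OF x] this]
    show "continuous_map ?P (topo Mt) (\<lambda>y. opn M f (compose {..<opar \<Sigma>1 f} y x))"
      by (simp add: o_def)
  qed
  moreover have "closedin ?P {y \<in> topspace ?P. \<forall>r\<in>rels \<Sigma>1. \<forall>x\<in>rel A r.
      compose {..<relar \<Sigma>1 r} y x \<in> rel M r}"
  proof (intro closedin_Ball)
    fix r x assume r: "r \<in> rels \<Sigma>1" and x: "x \<in> rel A r"
    show "closedin ?P {y \<in> topspace ?P. compose {..<relar \<Sigma>1 r} y x \<in> rel M r}"
      by (rule closedin_continuous_map_preimage[OF comp[OF rel_tuples[OF A r x]]])
         (use ae r in \<open>simp add: alter_ego_def\<close>)
  qed
  ultimately have "closedin ?P ({y \<in> topspace ?P. \<forall>f\<in>ops \<Sigma>1. \<forall>x\<in>tuples (opar \<Sigma>1 f) (carrier A).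
      y (opn A f x) = opn M f (compose {..<opar \<Sigma>1 f} y x)} \<inter> {y \<in> topspace ?P.
      \<forall>r\<in>rels \<Sigma>1. \<forall>x\<in>rel A r. compose {..<relar \<Sigma>1 r} y x \<in> rel M r})" (is "closedin ?P ?S")
    by (rule closedin_Int)
  moreover have "?S = hom \<Sigma>1 A M"
    unfolding tP hom_def
    by (rule set_eqI) (simp only: Int_iff mem_Collect_eq conj_ac conj_left_absorb conj_absorb)
  ultimately show ?thesis by (rule back_subst)
qed

section \<open>Compactness arguments for bounded distributive lattices\<close>

lemma sigD_simps [simp]:
  "ops sigD = UNIV" "rels sigD = {}"
  "opar sigD Join = 2" "opar sigD Meet = 2" "opar sigD Zero = 0" "opar sigD One = 0"
  by (simp_all add: sigD_def)

lemma sigP_simps [simp]: "ops sigP = {}" "rels sigP = UNIV" "relar sigP r = 2"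
  by (simp_all add: sigP_def)

lemma pair_nth [simp]: "pair a b 0 = a" "pair a b (Suc 0) = b"
  by (simp_all add: pair_def)

lemma pair_tuples [simp]: "pair a b \<in> tuples 2 C \<longleftrightarrow> a \<in> C \<and> b \<in> C"
  by (simp add: pair_def restrict_PiE_iff numeral_2_eq_2 lessThan_Suc)

lemma tuples_2_eq: "x \<in> tuples 2 C \<Longrightarrow> x = pair (x 0) (x 1)"
  by (auto simp: pair_def fun_eq_iff PiE_iff extensional_def less_2_cases_iff)

lemma compose_pair: "compose {..<2} h (pair a b) = pair (h a) (h b)"
  by (auto simp: pair_def compose_def fun_eq_iff)

lemma hom_latD:
  assumes L: "is_struc sigD L" and \<psi>: "\<psi> \<in> hom sigD L latD"
  shows "a \<in> carrier L \<Longrightarrow> b \<in> carrier L \<Longrightarrow> \<psi> (opn L Join (pair a b)) \<longleftrightarrow> \<psi> a \<or> \<psi> b"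
    and "a \<in> carrier L \<Longrightarrow> b \<in> carrier L \<Longrightarrow> \<psi> (opn L Meet (pair a b)) \<longleftrightarrow> \<psi> a \<and> \<psi> b"
    and "\<not> \<psi> (opn L Zero (\<lambda>_. undefined))" and "\<psi> (opn L One (\<lambda>_. undefined))"
  using hom_op[OF \<psi>, of Join "pair a b"] hom_op[OF \<psi>, of Meet "pair a b"]
    hom_op[OF \<psi>, of Zero "\<lambda>_. undefined"] hom_op[OF \<psi>, of One "\<lambda>_. undefined"]
  by (simp_all add: latD_def compose_pair)

lemma sigD_closed:
  assumes "is_struc sigD L"
  shows "a \<in> carrier L \<Longrightarrow> b \<in> carrier L \<Longrightarrow> opn L Join (pair a b) \<in> carrier L"
    and "a \<in> carrier L \<Longrightarrow> b \<in> carrier L \<Longrightarrow> opn L Meet (pair a b) \<in> carrier L"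
    and "opn L Zero (\<lambda>_. undefined) \<in> carrier L" and "opn L One (\<lambda>_. undefined) \<in> carrier L"
proof -
  have *: "opn L f x \<in> carrier L" if "x \<in> tuples (opar sigD f) (carrier L)" for f x
    using assms that by (auto simp: is_struc_def)
  show "a \<in> carrier L \<Longrightarrow> b \<in> carrier L \<Longrightarrow> opn L Join (pair a b) \<in> carrier L"
    "a \<in> carrier L \<Longrightarrow> b \<in> carrier L \<Longrightarrow> opn L Meet (pair a b) \<in> carrier L"
    "opn L Zero (\<lambda>_. undefined) \<in> carrier L" "opn L One (\<lambda>_. undefined) \<in> carrier L"
    by (rule *; simp)+
qed

text \<open>The meet is described by its values under homomorphisms to the two-element lattice,
  because elements are compared below only through such values. The empty meet is
  \<open>One\<close>.\<close>

lemma finite_meet: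
  assumes L: "is_struc sigD L" and "finite F" "F \<subseteq> carrier L"
  shows "\<exists>\<mu>\<in>carrier L. \<forall>\<psi>\<in>hom sigD L latD. \<psi> \<mu> \<longleftrightarrow> (\<forall>a\<in>F. \<psi> a)"
  using assms(2,3)
proof (induction F)
  case empty
  then show ?case using sigD_closed(4)[OF L] hom_latD(4)[OF L] by auto
next
  case (insert a F)
  then obtain \<mu> where "\<mu> \<in> carrier L" "\<forall>\<psi>\<in>hom sigD L latD. \<psi> \<mu> \<longleftrightarrow> (\<forall>a\<in>F. \<psi> a)" by auto
  then show ?case
    using insert.prems sigD_closed(2)[OF L] hom_latD(2)[OF L]
    by (intro bexI[of _ "opn L Meet (pair a \<mu>)"]) auto
qed

lemma finite_join:
  assumes L: "is_struc sigD L" and "finite F" "F \<subseteq> carrier L"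
  shows "\<exists>\<sigma>\<in>carrier L. \<forall>\<psi>\<in>hom sigD L latD. \<psi> \<sigma> \<longleftrightarrow> (\<exists>a\<in>F. \<psi> a)"
  using assms(2,3)
proof (induction F)
  case empty
  then show ?case using sigD_closed(3)[OF L] hom_latD(3)[OF L] by auto
next
  case (insert a F)
  then obtain \<sigma> where "\<sigma> \<in> carrier L" "\<forall>\<psi>\<in>hom sigD L latD. \<psi> \<sigma> \<longleftrightarrow> (\<exists>a\<in>F. \<psi> a)" by auto
  then show ?case
    using insert.prems sigD_closed(1)[OF L] hom_latD(1)[OF L]
    by (intro bexI[of _ "opn L Join (pair a \<sigma>)"]) auto
qed

text \<open>A finite set of indices is wanted, not of cover members: the indices will be lattice
  elements that are combined into a meet or a join.\<close>

lemma compact_space_indexed: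
  assumes "compact_space T" and "\<And>i. i \<in> I \<Longrightarrow> openin T (W i)"
    and "\<And>x. x \<in> topspace T \<Longrightarrow> \<exists>i\<in>I. x \<in> W i"
  shows "\<exists>F\<subseteq>I. finite F \<and> (\<forall>x\<in>topspace T. \<exists>i\<in>F. x \<in> W i)"
proof -
  have "Ball (W ` I) (openin T)" and "\<Union> (W ` I) = topspace T"
    using assms(2,3) openin_subset by fast+
  then obtain \<F> where "finite \<F>" "\<F> \<subseteq> W ` I" "topspace T = \<Union> \<F>"
    using assms(1) unfolding compact_space by metis
  then obtain F where "F \<subseteq> I" "finite F" "\<F> = W ` F" by (meson finite_subset_image)
  then show ?thesis using \<open>topspace T = \<Union> \<F>\<close> by auto
qed

text \<open>The disjunctive form covers implications between two maps; taking the same map twice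
  gives a single condition.\<close>

lemma openin_bool:
  assumes "continuous_map T (discrete_topology UNIV) f" "continuous_map T (discrete_topology UNIV) g"
  shows "openin T {x \<in> topspace T. f x = b \<or> g x = c}"
proof -
  have "{x \<in> topspace T. f x = b \<or> g x = c}
      = {x \<in> topspace T. f x \<in> {b}} \<union> {x \<in> topspace T. g x \<in> {c}}" by auto
  then show ?thesis
    using openin_continuous_map_preimage[OF assms(1), of "{b}"]
      openin_continuous_map_preimage[OF assms(2), of "{c}"]
    by (simp only: openin_Un openin_discrete_topology subset_UNIV)
qed

text \<open>If \<open>\<phi>\<close> differs from every \<open>v x\<close>, then by compactness
  finitely many elements witness this. Let \<mu> be the meet of those sent to 1 by \<phi> and
  \<sigma> the join of those sent to 0. No \<open>v x\<close> sends \<mu> to 1 and \<sigma> to 0, so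
  \<mu> lies below \<sigma> by separation, yet \<phi> sends \<mu> to 1 and \<sigma> to 0.\<close>

lemma hom_latD_eq_point:
  assumes L: "is_struc sigD L" and T: "compact_space T"
    and v: "\<And>x. x \<in> topspace T \<Longrightarrow> v x \<in> hom sigD L latD"
    and cont: "\<And>a. a \<in> carrier L \<Longrightarrow> continuous_map T (discrete_topology UNIV) (\<lambda>x. v x a)"
    and inj: "\<And>a b. a \<in> carrier L \<Longrightarrow> b \<in> carrier L \<Longrightarrow>
      (\<And>x. x \<in> topspace T \<Longrightarrow> v x a = v x b) \<Longrightarrow> a = b"
    and \<phi>: "\<phi> \<in> hom sigD L latD"
  shows "\<exists>x\<in>topspace T. \<forall>a\<in>carrier L. \<phi> a = v x a"
proof (rule ccontr)
  assume neg: "\<not> ?thesis"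
  let ?W = "\<lambda>a. {x \<in> topspace T. v x a = (\<not> \<phi> a)}"
  have "\<exists>F\<subseteq>carrier L. finite F \<and> (\<forall>x\<in>topspace T. \<exists>a\<in>F. x \<in> ?W a)"
  proof (rule compact_space_indexed[OF T])
    show "openin T (?W a)" if "a \<in> carrier L" for a
      using openin_bool[OF cont[OF that] cont[OF that], of "\<not> \<phi> a" "\<not> \<phi> a"] by simp
    show "\<exists>a\<in>carrier L. x \<in> ?W a" if "x \<in> topspace T" for x
      using neg that by auto
  qed
  then obtain F where F: "F \<subseteq> carrier L" "finite F"
    and cover: "\<forall>x\<in>topspace T. \<exists>a\<in>F. v x a \<noteq> \<phi> a" by auto
  have F1: "finite {a\<in>F. \<phi> a}" "{a\<in>F. \<phi> a} \<subseteq> carrier L"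
    and F0: "finite {a\<in>F. \<not> \<phi> a}" "{a\<in>F. \<not> \<phi> a} \<subseteq> carrier L" using F by auto
  obtain \<mu> where \<mu>: "\<mu> \<in> carrier L" "\<forall>\<psi>\<in>hom sigD L latD. \<psi> \<mu> \<longleftrightarrow> (\<forall>a\<in>{a\<in>F. \<phi> a}. \<psi> a)"
    using finite_meet[OF L F1] by blast
  obtain \<sigma> where \<sigma>: "\<sigma> \<in> carrier L" "\<forall>\<psi>\<in>hom sigD L latD. \<psi> \<sigma> \<longleftrightarrow> (\<exists>a\<in>{a\<in>F. \<not> \<phi> a}. \<psi> a)"
    using finite_join[OF L F0] by blast
  have "v x (opn L Meet (pair \<mu> \<sigma>)) = v x \<mu>" if x: "x \<in> topspace T" for x
  proof -
    obtain a where "a \<in> F" "v x a \<noteq> \<phi> a" using cover x by blast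
    \<comment> \<open>If \<phi> is true at the witness \<open>a\<close>, then \<open>v x\<close>
      fails at \<open>a\<close> and hence at \<mu>; otherwise it holds at \<open>a\<close> and hence
      at \<sigma>.\<close>
    then have "v x \<mu> \<longrightarrow> v x \<sigma>"
      using bspec[OF \<mu>(2) v[OF x]] bspec[OF \<sigma>(2) v[OF x]] by auto
    then show ?thesis using hom_latD(2)[OF L v[OF x] \<mu>(1) \<sigma>(1)] by auto
  qed
  then have "opn L Meet (pair \<mu> \<sigma>) = \<mu>"
    by (intro inj sigD_closed(2)[OF L] \<mu> \<sigma>)
  then show False
    using hom_latD(2)[OF L \<phi> \<mu>(1) \<sigma>(1)] bspec[OF \<mu>(2) \<phi>] bspec[OF \<sigma>(2) \<phi>] by auto
qed

text \<open>Compactness is used twice. For a fixed \<open>x\<close> with \<open>f x\<close>, a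
  finite meet of elements true at \<open>x\<close> yields one that is true at \<open>x\<close> and
  lies below \<open>f\<close>; a finite join of elements of this kind then reaches all of
  \<open>f\<close>.\<close>

lemma continuous_eq_element:
  assumes L: "is_struc sigD L" and T: "compact_space T"
    and v: "\<And>x. x \<in> topspace T \<Longrightarrow> v x \<in> hom sigD L latD"
    and cont: "\<And>a. a \<in> carrier L \<Longrightarrow> continuous_map T (discrete_topology UNIV) (\<lambda>x. v x a)"
    and f: "continuous_map T (discrete_topology UNIV) f"
    and sep: "\<And>x y. x \<in> topspace T \<Longrightarrow> y \<in> topspace T \<Longrightarrow> f x \<Longrightarrow> \<not> f y \<Longrightarrow>
      \<exists>a\<in>carrier L. v x a \<and> \<not> v y a"
  shows "\<exists>a\<in>carrier L. \<forall>x\<in>topspace T. f x = v x a"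
proof -
  \<comment> \<open>\<open>I\<close> consists of the elements whose evaluation map lies below
    \<open>f\<close>.\<close>
  define I where "I = {\<mu>\<in>carrier L. \<forall>y\<in>topspace T. v y \<mu> \<longrightarrow> f y}"
  have above: "\<exists>\<mu>\<in>I. v x \<mu>" if x: "x \<in> topspace T" "f x" for x
  proof -
    let ?W = "\<lambda>a. {y \<in> topspace T. f y = True \<or> v y a = False}"
    have "\<exists>F\<subseteq>{a\<in>carrier L. v x a}. finite F \<and> (\<forall>y\<in>topspace T. \<exists>a\<in>F. y \<in> ?W a)"
    proof (rule compact_space_indexed[OF T])
      show "openin T (?W a)" if "a \<in> {a\<in>carrier L. v x a}" for a
        by (rule openin_bool[OF f cont]) (use that in auto)
      \<comment> \<open>Where \<open>f y\<close> holds any element true at \<open>x\<close> will do,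
        and \<open>One\<close> is one; elsewhere \<open>sep\<close> supplies it.\<close>
      show "\<exists>a\<in>{a\<in>carrier L. v x a}. y \<in> ?W a" if "y \<in> topspace T" for y
        using that x sep[of x y] sigD_closed(4)[OF L] hom_latD(4)[OF L v[OF x(1)]]
        by (cases "f y") auto
    qed
    then obtain F where F: "F \<subseteq> {a\<in>carrier L. v x a}" "finite F"
      and cover: "\<forall>y\<in>topspace T. \<exists>a\<in>F. f y \<or> \<not> v y a" by auto
    from F(1) have FL: "F \<subseteq> carrier L" by auto
    obtain \<mu> where \<mu>: "\<mu> \<in> carrier L" "\<forall>\<psi>\<in>hom sigD L latD. \<psi> \<mu> \<longleftrightarrow> (\<forall>a\<in>F. \<psi> a)"
      using finite_meet[OF L F(2) FL] by blast
    have "v y \<mu> \<longrightarrow> f y" if "y \<in> topspace T" for y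
      using bspec[OF \<mu>(2) v[OF that]] bspec[OF cover that] by auto
    moreover have "v x \<mu>" using bspec[OF \<mu>(2) v[OF x(1)]] F(1) by auto
    ultimately show ?thesis using \<mu>(1) by (auto simp: I_def)
  qed
  let ?W = "\<lambda>\<mu>. {y \<in> topspace T. f y = False \<or> v y \<mu> = True}"
  \<comment> \<open>\<open>Zero\<close> serves as the index for points where \<open>f\<close> is
    false; there any member of \<open>I\<close> covers.\<close>
  have zero: "opn L Zero (\<lambda>_. undefined) \<in> I"
    using sigD_closed(3)[OF L] hom_latD(3)[OF L v] by (auto simp: I_def)
  have "\<exists>F\<subseteq>I. finite F \<and> (\<forall>y\<in>topspace T. \<exists>\<mu>\<in>F. y \<in> ?W \<mu>)"
  proof (rule compact_space_indexed[OF T])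
    show "openin T (?W \<mu>)" if "\<mu> \<in> I" for \<mu>
      by (rule openin_bool[OF f cont]) (use that in \<open>auto simp: I_def\<close>)
    show "\<exists>\<mu>\<in>I. y \<in> ?W \<mu>" if "y \<in> topspace T" for y
      using that above zero by (cases "f y") auto
  qed
  then obtain F where F: "F \<subseteq> I" "finite F"
    and cover: "\<forall>y\<in>topspace T. \<exists>\<mu>\<in>F. \<not> f y \<or> v y \<mu>" by auto
  from F(1) have FL: "F \<subseteq> carrier L" by (auto simp: I_def)
  obtain \<sigma> where \<sigma>: "\<sigma> \<in> carrier L" "\<forall>\<psi>\<in>hom sigD L latD. \<psi> \<sigma> \<longleftrightarrow> (\<exists>a\<in>F. \<psi> a)"
    using finite_join[OF L F(2) FL] by blast
  have "f x = v x \<sigma>" if x: "x \<in> topspace T" for x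
  proof -
    have "v x \<mu> \<longrightarrow> f x" if "\<mu> \<in> F" for \<mu> using that F(1) x by (auto simp: I_def)
    then show ?thesis using bspec[OF \<sigma>(2) v[OF x]] bspec[OF cover x] by auto
  qed
  with \<sigma>(1) show ?thesis by blast
qed

section \<open>Carriers and topologies of the duals, composition of continuous homomorphisms\<close>

lemma dualD_simps [simp]:
  "carrier (dualD \<Sigma>1 M \<Sigma>2 Mt A) = hom \<Sigma>1 A M"
  "topo (dualD \<Sigma>1 M \<Sigma>2 Mt A)
    = subtopology (product_topology (\<lambda>_. topo Mt) (carrier A)) (hom \<Sigma>1 A M)"
  by (simp_all add: dualD_def)

lemma dualE_carrier [simp]: "carrier (dualE \<Sigma>1 M \<Sigma>2 Mt X) = thom \<Sigma>2 X Mt"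
  by (simp add: dualE_def)

lemma thom_hom: "h \<in> thom \<Sigma> X Y \<Longrightarrow> h \<in> hom \<Sigma> X Y"
  and thom_continuous: "h \<in> thom \<Sigma> X Y \<Longrightarrow> continuous_map (topo X) (topo Y) h"
  by (simp_all add: thom_def)

lemma thom_compose:
  assumes X: "is_struc \<Sigma> X" "topspace (topo X) = carrier X"
    and h: "h \<in> thom \<Sigma> X Y" and k: "k \<in> thom \<Sigma> Y Z"
  shows "compose (carrier X) k h \<in> thom \<Sigma> X Z"
proof -
  have "continuous_map (topo X) (topo Z) (compose (carrier X) k h)"
    by (rule continuous_map_eq[OF continuous_map_compose[OF thom_continuous[OF h] thom_continuous[OF k]]])
       (simp add: X(2) compose_def)
  then show ?thesis
    using hom_compose[OF X(1) thom_hom[OF h] thom_hom[OF k]] by (simp add: thom_def)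
qed

section \<open>Reducts\<close>

lemma lat_reduct_simps [simp]:
  "carrier (lat_reduct \<tau> A) = carrier A" "opn (lat_reduct \<tau> A) s = trm_val A (\<tau> s)"
  by (simp_all add: lat_reduct_def)

lemma ord_reduct_simps [simp]:
  "carrier (ord_reduct \<Phi> X) = carrier X" "topo (ord_reduct \<Phi> X) = topo X"
  by (simp_all add: ord_reduct_def)

lemma chainD_simps [simp]: "carrier chainD = UNIV" "topo chainD = discrete_topology UNIV"
  by (simp_all add: chainD_def)

lemma carrier_latD [simp]: "carrier latD = UNIV"
  by (simp add: latD_def)

lemma pair_chainD [simp]: "pair p q \<in> rel chainD () \<longleftrightarrow> (p \<longrightarrow> q)"
  by (simp add: chainD_def)

lemma total_chainD: "total_tstruc sigP chainD"
proof -
  have "pair True True \<in> rel chainD r" for r using pair_chainD by (cases r) simp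
  moreover have "is_struc sigP chainD" by (simp add: is_struc_def chainD_def)
  ultimately show ?thesis
    by (auto simp: total_tstruc_def total_struc_def compact_space_discrete_topology
        simp del: pair_chainD)
qed

lemma is_struc_lat_reduct:
  assumes "is_struc \<Sigma> A" "\<And>s. wf_trm \<Sigma> (opar sigD s) (\<tau> s)"
  shows "is_struc sigD (lat_reduct \<tau> A)"
  unfolding is_struc_def by (simp add: trm_val_closed[OF assms(1) _ assms(2)])

lemma hom_lat_reduct:
  assumes A: "is_struc \<Sigma> A" and \<tau>: "\<And>s. wf_trm \<Sigma> (opar sigD s) (\<tau> s)" and h: "h \<in> hom \<Sigma> A B"
  shows "h \<in> hom sigD (lat_reduct \<tau> A) (lat_reduct \<tau> B)"
  using hom_PiE[OF h] trm_val_hom(2)[OF A _ \<tau> h] by (simp add: hom_def)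

lemma is_struc_ord_reduct: "is_struc sigP (ord_reduct \<Phi> X)"
  by (simp add: is_struc_def ord_reduct_def)

lemma pair_ord_reduct:
  "pair x y \<in> rel (ord_reduct \<Phi> X) () \<longleftrightarrow>
    x \<in> carrier X \<and> y \<in> carrier X \<and> (\<forall>\<phi>\<in>set \<Phi>. sat X \<phi> (pair x y))"
  by (simp add: ord_reduct_def)

lemma hom_sigP_iff:
  assumes "is_struc sigP X"
  shows "h \<in> hom sigP X Y \<longleftrightarrow> h \<in> carrier X \<rightarrow>\<^sub>E carrier Y \<and>
    (\<forall>x\<in>carrier X. \<forall>y\<in>carrier X. pair x y \<in> rel X () \<longrightarrow> pair (h x) (h y) \<in> rel Y ())"
proof -
  have "(\<forall>p\<in>rel X (). compose {..<2} h p \<in> rel Y ()) \<longleftrightarrow>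
    (\<forall>x\<in>carrier X. \<forall>y\<in>carrier X. pair x y \<in> rel X () \<longrightarrow> pair (h x) (h y) \<in> rel Y ())"
    (is "?l \<longleftrightarrow> ?r")
  proof
    show "?l \<Longrightarrow> ?r" by (metis compose_pair)
    assume ?r
    show ?l
    proof
      fix p assume p: "p \<in> rel X ()"
      then have "p \<in> tuples 2 (carrier X)"
        using rel_tuples[OF assms, of "()" p] by simp
      with p \<open>?r\<close> show "compose {..<2} h p \<in> rel Y ()"
        by (metis compose_pair pair_tuples tuples_2_eq)
    qed
  qed
  then show ?thesis by (simp add: hom_def)
qed

lemma hom_ord_reduct:
  assumes X: "is_struc \<Sigma> X" and \<Phi>: "\<And>\<phi>. \<phi> \<in> set \<Phi> \<Longrightarrow> wf_atom \<Sigma> 2 \<phi>" and h: "h \<in> hom \<Sigma> X Y"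
  shows "h \<in> hom sigP (ord_reduct \<Phi> X) (ord_reduct \<Phi> Y)"
proof -
  have "pair (h x) (h y) \<in> rel (ord_reduct \<Phi> Y) ()"
    if "pair x y \<in> rel (ord_reduct \<Phi> X) ()" for x y
    using that sat_hom[OF X _ h \<Phi>, of "pair x y"] hom_PiE[OF h]
    by (auto simp: pair_ord_reduct compose_pair)
  then show ?thesis
    using hom_PiE[OF h] by (simp add: hom_sigP_iff[OF is_struc_ord_reduct])
qed

lemma thom_ord_reduct:
  "is_struc \<Sigma> X \<Longrightarrow> (\<And>\<phi>. \<phi> \<in> set \<Phi> \<Longrightarrow> wf_atom \<Sigma> 2 \<phi>) \<Longrightarrow> h \<in> thom \<Sigma> X Y \<Longrightarrow>
    h \<in> thom sigP (ord_reduct \<Phi> X) (ord_reduct \<Phi> Y)"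
  using hom_ord_reduct[of \<Sigma> X \<Phi> h Y] by (simp add: thom_def)

text \<open>The order of the reduct is a conjunction of atomic formulas, and a separating family
  reflects each of them.\<close>

lemma separating_ord_reduct:
  assumes X: "is_struc \<Sigma> X" and \<Phi>: "\<And>\<phi>. \<phi> \<in> set \<Phi> \<Longrightarrow> wf_atom \<Sigma> 2 \<phi>"
    and H: "separating \<Sigma> X Y H" "H \<subseteq> hom \<Sigma> X Y"
    and x: "x \<in> carrier X" and y: "y \<in> carrier X"
    and le: "\<And>h. h \<in> H \<Longrightarrow> pair (h x) (h y) \<in> rel (ord_reduct \<Phi> Y) ()"
  shows "pair x y \<in> rel (ord_reduct \<Phi> X) ()"
proof -
  have "sat X \<phi> (pair x y)" if "\<phi> \<in> set \<Phi>" for \<phi>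
    by (rule sat_separating[OF X _ \<Phi>[OF that] H])
       (use x y le that in \<open>auto simp: compose_pair pair_ord_reduct\<close>)
  then show ?thesis using x y by (simp add: pair_ord_reduct)
qed

text \<open>Priestley spaces are given here as closed substructures of powers of the chain, so
  antisymmetry is inherited from the chain through the separating maps into it.\<close>

lemma Priestley_antisym:
  assumes X: "X \<in> Priestley" and xy: "pair x y \<in> rel X ()" "pair y x \<in> rel X ()"
  shows "x = y"
proof -
  note X' = IScP_D[OF total_chainD X]
  have x: "x \<in> carrier X" and y: "y \<in> carrier X"
    using rel_tuples[OF X'(1), of "()" "pair x y"] xy(1) by simp_all
  show ?thesis
  proof (rule separating_pointsD[OF X'(4) x y])
    fix h assume "h \<in> thom sigP X chainD"
    then have "pair (h x) (h y) \<in> rel chainD ()" "pair (h y) (h x) \<in> rel chainD ()"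
      using xy x y by (auto simp: thom_def hom_sigP_iff[OF X'(1)])
    then show "h x = h y" by auto
  qed
qed

section \<open>Bimorphisms\<close>

lemma Clo1_elem:
  assumes "u \<in> Clo1 \<Sigma> M"
  shows "\<exists>t. wf_trm \<Sigma> 1 t \<and> (\<forall>a\<in>carrier M. u a = trm_val M t (\<lambda>i\<in>{..<1}. a))"
  using assms by (auto simp: Clo1_def)

text \<open>The term behind \<open>u\<close> is evaluated at \<open>a\<close> in \<open>A\<close>
  itself; homomorphisms carry its value to the value in \<open>M\<close>. In this way the separation
  conditions (2) and (3), which concern \<open>M\<close> alone, act on \<open>A\<close> and on
  \<open>X\<close>.\<close>

lemma Clo1_lift:
  assumes A: "is_struc \<Sigma> A" and u: "u \<in> Clo1 \<Sigma> M" and a: "a \<in> carrier A"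
  shows "\<exists>a'\<in>carrier A. \<forall>h\<in>hom \<Sigma> A M. h a' = u (h a)"
proof -
  obtain t where t: "wf_trm \<Sigma> 1 t" and u: "\<forall>a\<in>carrier M. u a = trm_val M t (\<lambda>i\<in>{..<1}. a)"
    using Clo1_elem[OF u] by blast
  have x: "(\<lambda>i\<in>{..<1::nat}. a) \<in> tuples 1 (carrier A)" using a by auto
  have "h (trm_val A t (\<lambda>i\<in>{..<1}. a)) = u (h a)" if h: "h \<in> hom \<Sigma> A M" for h
  proof -
    have "compose {..<1} h (\<lambda>i\<in>{..<1::nat}. a) = (\<lambda>i\<in>{..<1}. h a)"
      by (auto simp: compose_def)
    then show ?thesis
      using trm_val_hom(2)[OF A x t h] u PiE_mem[OF hom_PiE[OF h] a] by metis
  qed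
  then show ?thesis using trm_val_closed[OF A x t] by blast
qed

text \<open>The pairing described at the outset, with compactness of \<open>X\<close> built in for
  the covering arguments. How far the pairing separates is left to the lemmas, so that it may be
  pulled back along maps on either side. The restrictions make the sections extensional, as
  \<open>hom\<close> requires.\<close>

definition bimorphism ::
  "('f, 'r) signature \<Rightarrow> ('m, 'f, 'r) struc \<Rightarrow> ('g, 's) signature \<Rightarrow> ('m, 'g, 's) tstruc
    \<Rightarrow> ('a, 'f, 'r) struc \<Rightarrow> ('x, 'g, 's) tstruc \<Rightarrow> ('a \<Rightarrow> 'x \<Rightarrow> 'm) \<Rightarrow> bool"
where
  "bimorphism \<Sigma>1 M \<Sigma>2 Mt A X b \<longleftrightarrow>
     is_struc \<Sigma>1 A \<and> is_struc \<Sigma>2 X \<and> topspace (topo X) = carrier X \<and> compact_space (topo X) \<and>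
     (\<forall>x\<in>carrier X. (\<lambda>a\<in>carrier A. b a x) \<in> hom \<Sigma>1 A M) \<and>
     (\<forall>a\<in>carrier A. (\<lambda>x\<in>carrier X. b a x) \<in> thom \<Sigma>2 X Mt)"

lemma bimorphism_pull_left:
  assumes "bimorphism \<Sigma>1 M \<Sigma>2 Mt B X b" and A: "is_struc \<Sigma>1 A" and j: "j \<in> hom \<Sigma>1 A B"
  shows "bimorphism \<Sigma>1 M \<Sigma>2 Mt A X (\<lambda>a. b (j a))"
proof -
  have "compose (carrier A) (\<lambda>a\<in>carrier B. b a x) j = (\<lambda>a\<in>carrier A. b (j a) x)" for x
    unfolding compose_def by (rule restrict_ext) (use hom_PiE[OF j] in auto)
  then have "(\<lambda>a\<in>carrier A. b (j a) x) \<in> hom \<Sigma>1 A M" if "x \<in> carrier X" for x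
    using hom_compose[OF A j, of "\<lambda>a\<in>carrier B. b a x" M] assms(1) that by (simp add: bimorphism_def)
  then show ?thesis
    using assms(1) A PiE_mem[OF hom_PiE[OF j]] by (simp add: bimorphism_def)
qed

lemma bimorphism_pull_right:
  assumes "bimorphism \<Sigma>1 M \<Sigma>2 Mt A Y b"
    and X: "is_struc \<Sigma>2 X" "topspace (topo X) = carrier X" "compact_space (topo X)"
    and j: "j \<in> thom \<Sigma>2 X Y"
  shows "bimorphism \<Sigma>1 M \<Sigma>2 Mt A X (\<lambda>a x. b a (j x))"
proof -
  have jX: "j x \<in> carrier Y" if "x \<in> carrier X" for x
    using PiE_mem[OF hom_PiE[OF thom_hom[OF j]] that] .
  then have "compose (carrier X) (\<lambda>y\<in>carrier Y. b a y) j = (\<lambda>x\<in>carrier X. b a (j x))" for a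
    unfolding compose_def by (intro restrict_ext) simp
  then have "(\<lambda>x\<in>carrier X. b a (j x)) \<in> thom \<Sigma>2 X Mt" if "a \<in> carrier A" for a
    using thom_compose[OF X(1,2) j, of "\<lambda>y\<in>carrier Y. b a y" Mt] assms(1) that
    by (simp add: bimorphism_def)
  then show ?thesis
    using assms(1) X jX by (simp add: bimorphism_def)
qed

section \<open>Comparing morphisms through \<omega>\<close>

text \<open>Condition (2) enters as \<open>sep_points\<close>, condition (3) as
  \<open>sep_order\<close>.\<close>

locale piggyback =
  fixes \<Sigma>1 :: "('f, 'r) signature" and M :: "('m, 'f, 'r) struc"
    and \<Sigma>2 :: "('g, 's) signature" and Mt :: "('m, 'g, 's) tstruc"
    and \<tau> :: "dl_op \<Rightarrow> 'f trm" and \<Phi> :: "('g, 's) atom list" and \<omega> :: "'m \<Rightarrow> bool"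
  assumes total_M: "total_struc \<Sigma>1 M" and total_Mt: "total_tstruc \<Sigma>2 Mt"
    and ae: "alter_ego \<Sigma>1 M \<Sigma>2 Mt"
    and \<tau>: "\<And>s. wf_trm \<Sigma>1 (opar sigD s) (\<tau> s)"
    and \<Phi>: "\<And>\<phi>. \<phi> \<in> set \<Phi> \<Longrightarrow> wf_atom \<Sigma>2 2 \<phi>" and Priestley: "ord_reduct \<Phi> Mt \<in> Priestley"
    and \<omega>_hom: "\<omega> \<in> hom sigD (lat_reduct \<tau> M) latD"
    and \<omega>_thom: "\<omega> \<in> thom sigP (ord_reduct \<Phi> Mt) chainD"
    and sep_points: "separates_points ((\<circ>) \<omega> ` Clo1 \<Sigma>2 Mt) (carrier M)"
    and sep_order: "\<And>a b. a \<in> carrier M \<Longrightarrow> b \<in> carrier M \<Longrightarrow>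
      pair a b \<notin> rel (ord_reduct \<Phi> Mt) () \<Longrightarrow> \<exists>t\<in>Clo1 \<Sigma>1 M. \<omega> (t a) \<and> \<not> \<omega> (t b)"
begin

abbreviation D where "D \<equiv> dualD \<Sigma>1 M \<Sigma>2 Mt"
abbreviation E where "E \<equiv> dualE \<Sigma>1 M \<Sigma>2 Mt"
abbreviation le where "le a b \<equiv> pair a b \<in> rel (ord_reduct \<Phi> Mt) ()"
abbreviation bim where "bim \<equiv> bimorphism \<Sigma>1 M \<Sigma>2 Mt"

lemma M: "is_struc \<Sigma>1 M" and Mt: "is_struc \<Sigma>2 Mt" and carrier_Mt: "carrier Mt = carrier M"
  and topspace_Mt: "topspace (topo Mt) = carrier M" and compact_Mt: "compact_space (topo Mt)"
  and Hausdorff_Mt: "Hausdorff_space (topo Mt)"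
  using total_M total_Mt ae by (auto simp: total_struc_def total_tstruc_def alter_ego_def)

text \<open>If the order fails at \<open>a\<close>, then (3) gives a unary term \<open>t\<close>
  that \<omega> detects on \<open>x a\<close> and \<open>y a\<close>. Evaluating \<open>t\<close> at
  \<open>a\<close> inside \<open>A\<close> produces an element at which \<open>mono\<close>
  fails.\<close>

lemma hom_le:
  assumes A: "is_struc \<Sigma>1 A" and x: "x \<in> hom \<Sigma>1 A M" and y: "y \<in> hom \<Sigma>1 A M"
    and mono: "\<And>a. a \<in> carrier A \<Longrightarrow> \<omega> (x a) \<Longrightarrow> \<omega> (y a)" and a: "a \<in> carrier A"
  shows "le (x a) (y a)"
proof (rule ccontr)
  assume "\<not> le (x a) (y a)"
  then obtain t where t: "t \<in> Clo1 \<Sigma>1 M" and \<omega>: "\<omega> (t (x a))" "\<not> \<omega> (t (y a))"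
    using sep_order PiE_mem[OF hom_PiE[OF x] a] PiE_mem[OF hom_PiE[OF y] a] by blast
  obtain a' where "a' \<in> carrier A" "\<forall>h\<in>hom \<Sigma>1 A M. h a' = t (h a)"
    using Clo1_lift[OF A t a] by blast
  then show False using mono[of a'] \<omega> x y by simp
qed

lemma hom_eqI:
  assumes A: "is_struc \<Sigma>1 A" and x: "x \<in> hom \<Sigma>1 A M" and y: "y \<in> hom \<Sigma>1 A M"
    and eq: "\<And>a. a \<in> carrier A \<Longrightarrow> \<omega> (x a) = \<omega> (y a)"
  shows "x = y"
proof (rule PiE_ext[OF hom_PiE[OF x] hom_PiE[OF y]])
  fix a assume a: "a \<in> carrier A"
  show "x a = y a"
    by (rule Priestley_antisym[OF Priestley hom_le[OF A x y _ a] hom_le[OF A y x _ a]])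
       (use eq in auto)
qed

text \<open>The counterpart for \<open>X\<close>, with (2) in place of (3): a unary term of
  \<open>Mt\<close> that detects a difference at \<open>x\<close> moves it to another point of
  \<open>X\<close>, where \<omega> sees it.\<close>

lemma thom_eqI:
  assumes X: "is_struc \<Sigma>2 X" and \<alpha>: "\<alpha> \<in> thom \<Sigma>2 X Mt" and \<beta>: "\<beta> \<in> thom \<Sigma>2 X Mt"
    and eq: "\<And>x. x \<in> carrier X \<Longrightarrow> \<omega> (\<alpha> x) = \<omega> (\<beta> x)"
  shows "\<alpha> = \<beta>"
proof (rule PiE_ext[OF hom_PiE[OF thom_hom[OF \<alpha>]] hom_PiE[OF thom_hom[OF \<beta>]]], rule ccontr)
  fix x assume x: "x \<in> carrier X" and "\<alpha> x \<noteq> \<beta> x"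
  moreover have "\<alpha> x \<in> carrier M" "\<beta> x \<in> carrier M"
    using PiE_mem[OF hom_PiE[OF thom_hom] x] \<alpha> \<beta> carrier_Mt by auto
  ultimately obtain u where u: "u \<in> Clo1 \<Sigma>2 Mt" and \<omega>: "\<omega> (u (\<alpha> x)) \<noteq> \<omega> (u (\<beta> x))"
    using sep_points by (fastforce simp: separates_points_def)
  obtain x' where "x' \<in> carrier X" "\<forall>h\<in>hom \<Sigma>2 X Mt. h x' = u (h x)"
    using Clo1_lift[OF X u x] by blast
  then show False using eq[of x'] \<omega> thom_hom[OF \<alpha>] thom_hom[OF \<beta>] by simp
qed

lemma \<omega>_hom_compose:
  assumes A: "is_struc \<Sigma>1 A" and x: "x \<in> hom \<Sigma>1 A M"
  shows "compose (carrier A) \<omega> x \<in> hom sigD (lat_reduct \<tau> A) latD"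
  using hom_compose[OF is_struc_lat_reduct[of _ _ \<tau>, OF A \<tau>] hom_lat_reduct[OF A \<tau> x] \<omega>_hom] by simp

lemma \<omega>_thom_compose:
  assumes X: "is_struc \<Sigma>2 X" "topspace (topo X) = carrier X" and \<alpha>: "\<alpha> \<in> thom \<Sigma>2 X Mt"
  shows "compose (carrier X) \<omega> \<alpha> \<in> thom sigP (ord_reduct \<Phi> X) chainD"
  using thom_compose[OF is_struc_ord_reduct _ thom_ord_reduct[OF X(1) \<Phi> \<alpha>] \<omega>_thom] X(2) by simp

lemma bimD:
  assumes "bim A X b"
  shows "is_struc \<Sigma>1 A" "is_struc \<Sigma>2 X" "topspace (topo X) = carrier X" "compact_space (topo X)"
    and "\<And>x. x \<in> carrier X \<Longrightarrow> (\<lambda>a\<in>carrier A. b a x) \<in> hom \<Sigma>1 A M"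
    and "\<And>a. a \<in> carrier A \<Longrightarrow> (\<lambda>x\<in>carrier X. b a x) \<in> thom \<Sigma>2 X Mt"
  using assms by (auto simp: bimorphism_def)

lemma bim_\<omega>:
  assumes b: "bim A X b"
  shows "x \<in> carrier X \<Longrightarrow> (\<lambda>a\<in>carrier A. \<omega> (b a x)) \<in> hom sigD (lat_reduct \<tau> A) latD"
    and "a \<in> carrier A \<Longrightarrow> (\<lambda>x\<in>carrier X. \<omega> (b a x)) \<in> thom sigP (ord_reduct \<Phi> X) chainD"
proof -
  note b' = bimD[OF b]
  show "(\<lambda>a\<in>carrier A. \<omega> (b a x)) \<in> hom sigD (lat_reduct \<tau> A) latD" if "x \<in> carrier X"
    using \<omega>_hom_compose[OF b'(1) b'(5)[OF that]] by (simp add: compose_def cong: restrict_cong)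
  show "(\<lambda>x\<in>carrier X. \<omega> (b a x)) \<in> thom sigP (ord_reduct \<Phi> X) chainD" if "a \<in> carrier A"
    using \<omega>_thom_compose[OF b'(2,3) b'(6)[OF that]] by (simp add: compose_def cong: restrict_cong)
qed

lemma bim_continuous:
  assumes b: "bim A X b" and a: "a \<in> carrier A"
  shows "continuous_map (topo X) (discrete_topology UNIV) (\<lambda>x. \<omega> (b a x))"
  by (rule continuous_map_eq[OF thom_continuous[OF bim_\<omega>(2)[OF b a], simplified]])
     (simp add: bimD(3)[OF b])

section \<open>Every morphism comes from a separating pairing\<close>

text \<open>The compactness argument needs the composites of the pairing with \<omega> to separate
  the points of \<open>A\<close>. If they agree at \<open>a\<close> and \<open>a'\<close>, the
  sections at \<open>a\<close> and \<open>a'\<close> are equal by \<open>thom_eqI\<close>, and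
  \<open>sep\<close> applies.\<close>

lemma lat_hom_eq_point:
  assumes b: "bim A X b"
    and sep: "\<And>a a'. a \<in> carrier A \<Longrightarrow> a' \<in> carrier A \<Longrightarrow>
      (\<And>x. x \<in> carrier X \<Longrightarrow> b a x = b a' x) \<Longrightarrow> a = a'"
    and \<phi>: "\<phi> \<in> hom sigD (lat_reduct \<tau> A) latD"
  shows "\<exists>x\<in>carrier X. \<forall>a\<in>carrier A. \<phi> a = \<omega> (b a x)"
proof -
  note b' = bimD[OF b]
  have "\<exists>x\<in>topspace (topo X). \<forall>a\<in>carrier (lat_reduct \<tau> A). \<phi> a = (\<lambda>a\<in>carrier A. \<omega> (b a x)) a"
  proof (rule hom_latD_eq_point[OF is_struc_lat_reduct[of _ _ \<tau>, OF b'(1) \<tau>] b'(4) _ _ _ \<phi>])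
    show "(\<lambda>a\<in>carrier A. \<omega> (b a x)) \<in> hom sigD (lat_reduct \<tau> A) latD"
      if "x \<in> topspace (topo X)" for x
      using that bim_\<omega>(1)[OF b] b'(3) by simp
    show "continuous_map (topo X) (discrete_topology UNIV) (\<lambda>x. (\<lambda>a\<in>carrier A. \<omega> (b a x)) a)"
      if "a \<in> carrier (lat_reduct \<tau> A)" for a
      using that bim_continuous[OF b] by simp
    fix a a' assume "a \<in> carrier (lat_reduct \<tau> A)" "a' \<in> carrier (lat_reduct \<tau> A)"
      and eq: "\<And>x. x \<in> topspace (topo X) \<Longrightarrow>
        (\<lambda>a\<in>carrier A. \<omega> (b a x)) a = (\<lambda>a\<in>carrier A. \<omega> (b a x)) a'"
    then have a: "a \<in> carrier A" "a' \<in> carrier A" by simp_all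
    have "(\<lambda>x\<in>carrier X. b a x) = (\<lambda>x\<in>carrier X. b a' x)"
      by (rule thom_eqI[OF b'(2) b'(6)[OF a(1)] b'(6)[OF a(2)]]) (use eq a b'(3) in simp)
    then show "a = a'" using sep[OF a] by (metis restrict_apply')
  qed
  then show ?thesis using b'(3) by simp
qed

text \<open>The lattice homomorphism \<omega> after \<open>h\<close> comes from a point; \<omega> is
  then cancelled by \<open>hom_eqI\<close>.\<close>

lemma hom_eq_point:
  assumes b: "bim A X b"
    and sep: "\<And>a a'. a \<in> carrier A \<Longrightarrow> a' \<in> carrier A \<Longrightarrow>
      (\<And>x. x \<in> carrier X \<Longrightarrow> b a x = b a' x) \<Longrightarrow> a = a'"
    and h: "h \<in> hom \<Sigma>1 A M"
  shows "\<exists>x\<in>carrier X. h = (\<lambda>a\<in>carrier A. b a x)"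
proof -
  note b' = bimD[OF b]
  obtain x where x: "x \<in> carrier X" and eq: "\<forall>a\<in>carrier A. compose (carrier A) \<omega> h a = \<omega> (b a x)"
    using lat_hom_eq_point[OF b sep \<omega>_hom_compose[OF b'(1) h]] by blast
  have "h = (\<lambda>a\<in>carrier A. b a x)"
    by (rule hom_eqI[OF b'(1) h b'(5)[OF x]]) (use eq in \<open>simp add: compose_def\<close>)
  with x show ?thesis by blast
qed

text \<open>A map \<open>f\<close> that is true at \<open>x\<close> and false at \<open>y\<close>
  shows that \<open>x\<close> is not below \<open>y\<close>; \<open>sep\<close> passes this to the
  sections, and \<open>hom_le\<close> to their composites with \<omega>, as the second compactness
  argument demands.\<close>

lemma Priestley_map_eq_element:
  assumes b: "bim A X b"
    and sep: "\<And>x y. x \<in> carrier X \<Longrightarrow> y \<in> carrier X \<Longrightarrow>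
      (\<And>a. a \<in> carrier A \<Longrightarrow> le (b a x) (b a y)) \<Longrightarrow> pair x y \<in> rel (ord_reduct \<Phi> X) ()"
    and f: "f \<in> thom sigP (ord_reduct \<Phi> X) chainD"
  shows "\<exists>a\<in>carrier A. \<forall>x\<in>carrier X. f x = \<omega> (b a x)"
proof -
  note b' = bimD[OF b]
  have "\<exists>a\<in>carrier (lat_reduct \<tau> A). \<forall>x\<in>topspace (topo X). f x = (\<lambda>a\<in>carrier A. \<omega> (b a x)) a"
  proof (rule continuous_eq_element[OF is_struc_lat_reduct[of _ _ \<tau>, OF b'(1) \<tau>] b'(4)])
    show "(\<lambda>a\<in>carrier A. \<omega> (b a x)) \<in> hom sigD (lat_reduct \<tau> A) latD"
      if "x \<in> topspace (topo X)" for x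
      using that bim_\<omega>(1)[OF b] b'(3) by simp
    show "continuous_map (topo X) (discrete_topology UNIV) (\<lambda>x. (\<lambda>a\<in>carrier A. \<omega> (b a x)) a)"
      if "a \<in> carrier (lat_reduct \<tau> A)" for a
      using that bim_continuous[OF b] by simp
    show "continuous_map (topo X) (discrete_topology UNIV) f"
      using thom_continuous[OF f] by simp
    fix x y assume "x \<in> topspace (topo X)" "y \<in> topspace (topo X)" and fxy: "f x" "\<not> f y"
    then have x: "x \<in> carrier X" and y: "y \<in> carrier X" using b'(3) by simp_all
    have "pair x y \<notin> rel (ord_reduct \<Phi> X) ()"
      using thom_hom[OF f] fxy x y by (auto simp: hom_sigP_iff[OF is_struc_ord_reduct])
    then obtain a where a: "a \<in> carrier A" "\<not> le (b a x) (b a y)"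
      using sep[OF x y] by blast
    \<comment> \<open>At the \<open>a\<close> found so far only the order of \<open>Mt\<close>
      fails. The contrapositive of \<open>hom_le\<close> yields a possibly different element at
      which \<omega> detects it.\<close>
    have "\<exists>a\<in>carrier A. \<omega> (b a x) \<and> \<not> \<omega> (b a y)"
      using hom_le[OF b'(1) b'(5)[OF x] b'(5)[OF y] _ a(1)] a by auto
    then show "\<exists>a\<in>carrier (lat_reduct \<tau> A).
        (\<lambda>a\<in>carrier A. \<omega> (b a x)) a \<and> \<not> (\<lambda>a\<in>carrier A. \<omega> (b a y)) a" by auto
  qed
  then show ?thesis using b'(3) by simp
qed

lemma thom_eq_element:
  assumes b: "bim A X b"
    and sep: "\<And>x y. x \<in> carrier X \<Longrightarrow> y \<in> carrier X \<Longrightarrow>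
      (\<And>a. a \<in> carrier A \<Longrightarrow> le (b a x) (b a y)) \<Longrightarrow> pair x y \<in> rel (ord_reduct \<Phi> X) ()"
    and \<alpha>: "\<alpha> \<in> thom \<Sigma>2 X Mt"
  shows "\<exists>a\<in>carrier A. \<alpha> = (\<lambda>x\<in>carrier X. b a x)"
proof -
  note b' = bimD[OF b]
  obtain a where a: "a \<in> carrier A" and eq: "\<forall>x\<in>carrier X. compose (carrier X) \<omega> \<alpha> x = \<omega> (b a x)"
    using Priestley_map_eq_element[OF b sep \<omega>_thom_compose[OF b'(2,3) \<alpha>]] by blast
  have "\<alpha> = (\<lambda>x\<in>carrier X. b a x)"
    by (rule thom_eqI[OF b'(2) \<alpha> b'(6)[OF a]]) (use eq in \<open>simp add: compose_def\<close>)
  with a show ?thesis by blast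
qed

section \<open>The dual structures and the two evaluation pairings\<close>

lemma D_struc:
  assumes A: "is_struc \<Sigma>1 A"
  shows "is_struc \<Sigma>2 (D A)" and "topspace (topo (D A)) = carrier (D A)"
    and "compact_space (topo (D A))" and "Hausdorff_space (topo (D A))"
proof -
  let ?P = "product_topology (\<lambda>_. topo Mt) (carrier A)"
  note cl = dualD_closedin[OF total_Mt ae A]
  show "is_struc \<Sigma>2 (D A)"
    using dualD_closed[OF M Mt ae A] by (simp add: dualD_def is_struc_def closed_under_def)
  show "topspace (topo (D A)) = carrier (D A)"
    using closedin_subset[OF cl] by auto
  have "compact_space ?P" using compact_Mt by (simp add: compact_space_product_topology)
  then show "compact_space (topo (D A))"
    using closedin_compact_space[OF _ cl] by (simp add: compact_space_subtopology)
  have "Hausdorff_space ?P" using Hausdorff_Mt by (simp add: Hausdorff_space_product_topology)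
  then show "Hausdorff_space (topo (D A))" by (simp add: Hausdorff_space_subtopology)
qed

lemma E_struc:
  assumes "is_struc \<Sigma>2 X" "topspace (topo X) = carrier X"
  shows "is_struc \<Sigma>1 (E X)"
  using dualE_closed[OF M Mt _ ae assms] topspace_Mt carrier_Mt
  by (simp add: dualE_def is_struc_restr)

lemma D_rel_iff:
  assumes r: "r \<in> rels \<Sigma>2" and p: "p \<in> tuples (relar \<Sigma>2 r) (hom \<Sigma>1 A M)"
  shows "p \<in> rel (D A) r \<longleftrightarrow> (\<forall>a\<in>carrier A. (\<lambda>i\<in>{..<relar \<Sigma>2 r}. p i a) \<in> rel Mt r)"
proof -
  have "p \<in> tuples (relar \<Sigma>2 r) (carrier A \<rightarrow>\<^sub>E carrier Mt)"
    using p carrier_Mt hom_PiE[of _ \<Sigma>1 A M] by (auto simp: PiE_iff)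
  then show ?thesis using p by (simp add: dualD_def pow_struc_def del: restrict_apply)
qed

lemma E_rel_iff:
  assumes r: "r \<in> rels \<Sigma>1" and p: "p \<in> tuples (relar \<Sigma>1 r) (thom \<Sigma>2 X Mt)"
  shows "p \<in> rel (E X) r \<longleftrightarrow> (\<forall>x\<in>carrier X. (\<lambda>i\<in>{..<relar \<Sigma>1 r}. p i x) \<in> rel M r)"
proof -
  have "p \<in> tuples (relar \<Sigma>1 r) (carrier X \<rightarrow>\<^sub>E carrier M)"
    using p carrier_Mt hom_PiE[OF thom_hom, of _ \<Sigma>2 X Mt] by (auto simp: PiE_iff)
  then show ?thesis using p by (simp add: dualE_def pow_struc_def del: restrict_apply)
qed

text \<open>Sections at a point of the dual are the homomorphisms themselves; sections at an element
  of \<open>A\<close> are projections of the power, restricted to the dual.\<close>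

lemma bim_D:
  assumes A: "is_struc \<Sigma>1 A"
  shows "bim A (D A) (\<lambda>a x. x a)"
  unfolding bimorphism_def
proof (intro conjI ballI)
  show "is_struc \<Sigma>1 A" by fact
  show "is_struc \<Sigma>2 (D A)" "topspace (topo (D A)) = carrier (D A)" "compact_space (topo (D A))"
    by (rule D_struc[OF A])+
  show "restrict x (carrier A) \<in> hom \<Sigma>1 A M" if "x \<in> carrier (D A)" for x
    using that hom_PiE[of x \<Sigma>1 A M] by (simp add: PiE_restrict)
  fix a assume a: "a \<in> carrier A"
  note cl = dualD_closed[OF M Mt ae A]
  have sub: "hom \<Sigma>1 A M \<subseteq> carrier A \<rightarrow>\<^sub>E carrier Mt" using cl by (simp add: closed_under_def)
  have eq: "restrict (\<lambda>y\<in>carrier A \<rightarrow>\<^sub>E carrier Mt. y a) (hom \<Sigma>1 A M) = (\<lambda>x\<in>hom \<Sigma>1 A M. x a)"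
    by (rule restrict_ext) (use sub in auto)
  have "(\<lambda>x\<in>hom \<Sigma>1 A M. x a) \<in> hom \<Sigma>2 (restr \<Sigma>2 (pow_struc \<Sigma>2 Mt (carrier A)) (hom \<Sigma>1 A M)) Mt"
    using restrict_hom[OF proj_hom[OF Mt a] cl] unfolding eq .
  moreover have "continuous_map (topo (D A)) (topo Mt) (\<lambda>x\<in>hom \<Sigma>1 A M. x a)"
  proof (rule continuous_map_eq)
    show "continuous_map (topo (D A)) (topo Mt) (\<lambda>x. x a)"
      unfolding dualD_simps
      by (rule continuous_map_from_subtopology[OF continuous_map_product_projection[OF a]])
  qed simp
  ultimately show "(\<lambda>x\<in>carrier (D A). x a) \<in> thom \<Sigma>2 (D A) Mt"
    by (simp add: dualD_def thom_trestr_pow)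
qed

lemma bim_E:
  assumes X: "is_struc \<Sigma>2 X" "topspace (topo X) = carrier X" "compact_space (topo X)"
  shows "bim (E X) X (\<lambda>\<alpha> x. \<alpha> x)"
  unfolding bimorphism_def
proof (intro conjI ballI)
  show "is_struc \<Sigma>1 (E X)" by (rule E_struc[OF X(1,2)])
  show "is_struc \<Sigma>2 X" "topspace (topo X) = carrier X" "compact_space (topo X)" by fact+
  show "restrict \<alpha> (carrier X) \<in> thom \<Sigma>2 X Mt" if "\<alpha> \<in> carrier (E X)" for \<alpha>
    using that hom_PiE[OF thom_hom, of \<alpha> \<Sigma>2 X Mt] by (simp add: PiE_restrict)
  fix x assume x: "x \<in> carrier X"
  have cl: "closed_under \<Sigma>1 (pow_struc \<Sigma>1 M (carrier X)) (thom \<Sigma>2 X Mt)"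
    using dualE_closed[OF M Mt _ ae X(1,2)] topspace_Mt carrier_Mt by simp
  have sub: "thom \<Sigma>2 X Mt \<subseteq> carrier X \<rightarrow>\<^sub>E carrier M" using cl by (simp add: closed_under_def)
  have eq: "restrict (\<lambda>y\<in>carrier X \<rightarrow>\<^sub>E carrier M. y x) (thom \<Sigma>2 X Mt) = (\<lambda>\<alpha>\<in>thom \<Sigma>2 X Mt. \<alpha> x)"
    by (rule restrict_ext) (use sub in auto)
  show "(\<lambda>\<alpha>\<in>carrier (E X). \<alpha> x) \<in> hom \<Sigma>1 (E X) M"
    using restrict_hom[OF proj_hom[OF M x] cl] unfolding eq by (simp add: dualE_def)
qed

text \<open>The dual is a substructure of a power of \<open>Mt\<close>, so evaluations at elements
  of \<open>A\<close> form a separating family and reflect the formulas in \<Phi>; the order of the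
  reduct is therefore pointwise.\<close>

lemma D_separates_order:
  assumes A: "is_struc \<Sigma>1 A" and x: "x \<in> hom \<Sigma>1 A M" and y: "y \<in> hom \<Sigma>1 A M"
    and le: "\<And>a. a \<in> carrier A \<Longrightarrow> le (x a) (y a)"
  shows "pair x y \<in> rel (ord_reduct \<Phi> (D A)) ()"
proof -
  let ?H = "(\<lambda>a. \<lambda>x\<in>hom \<Sigma>1 A M. x a) ` carrier A"
  have "separating \<Sigma>2 (D A) Mt ?H"
    unfolding separating_def
  proof (intro conjI ballI impI)
    fix x y assume x: "x \<in> carrier (D A)" and y: "y \<in> carrier (D A)" and eq: "\<forall>h\<in>?H. h x = h y"
    then show "x = y" by (intro PiE_ext[OF hom_PiE hom_PiE]) auto
  next
    fix r p assume r: "r \<in> rels \<Sigma>2" and p: "p \<in> tuples (relar \<Sigma>2 r) (carrier (D A))"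
      and R: "\<forall>h\<in>?H. compose {..<relar \<Sigma>2 r} h p \<in> rel Mt r"
    have "compose {..<relar \<Sigma>2 r} (\<lambda>x\<in>hom \<Sigma>1 A M. x a) p = (\<lambda>i\<in>{..<relar \<Sigma>2 r}. p i a)" for a
      unfolding compose_def by (rule restrict_ext) (use p in auto)
    then show "p \<in> rel (D A) r" using R p by (simp add: D_rel_iff[OF r])
  qed
  moreover have "?H \<subseteq> hom \<Sigma>2 (D A) Mt"
    using bimD(6)[OF bim_D[OF A]] by (auto simp: thom_def)
  ultimately show ?thesis
    by (intro separating_ord_reduct[OF D_struc(1)[OF A]]) (use x y le \<Phi> in auto)
qed

lemma IScP_separates_order:
  assumes X: "X \<in> IScP \<Sigma>2 Mt" and x: "x \<in> carrier X" and y: "y \<in> carrier X"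
    and le: "\<And>\<alpha>. \<alpha> \<in> thom \<Sigma>2 X Mt \<Longrightarrow> le (\<alpha> x) (\<alpha> y)"
  shows "pair x y \<in> rel (ord_reduct \<Phi> X) ()"
  by (rule separating_ord_reduct[OF IScP_D(1)[OF total_Mt X] \<Phi> IScP_D(4)[OF total_Mt X] _ x y le])
     (auto simp: thom_def)

section \<open>Full duality and injectivity\<close>

text \<open>Injectivity and reflection of relations say that homomorphisms to \<open>M\<close>
  separate \<open>A\<close>. Surjectivity is \<open>thom_eq_element\<close> for the pairing of
  \<open>A\<close> with its dual, whose order is separated by the elements of
  \<open>A\<close>.\<close>

lemma isom_eval_e:
  assumes A: "A \<in> ISP \<Sigma>1 M"
  shows "isom \<Sigma>1 A (E (D A)) (eval_e \<Sigma>1 M A)"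
proof -
  note A' = ISP_D[OF M A]
  note b = bim_D[OF A'(1)]
  let ?e = "eval_e \<Sigma>1 M A"
  have e: "?e a = (\<lambda>x\<in>hom \<Sigma>1 A M. x a)" if "a \<in> carrier A" for a
    using that by (simp add: eval_e_def)
  have eE: "?e a \<in> thom \<Sigma>2 (D A) Mt" if "a \<in> carrier A" for a
    using bimD(6)[OF b that] e[OF that] by simp
  have "?e \<in> hom \<Sigma>1 A (pow_struc \<Sigma>1 M (hom \<Sigma>1 A M))"
    unfolding eval_e_def by (rule prod_hom[OF A'(1)])
  then have hom: "?e \<in> hom \<Sigma>1 A (E (D A))"
    unfolding dualE_def dualD_simps by (rule hom_into_restr[OF A'(1)]) (use eE in auto)
  have bij: "bij_betw ?e (carrier A) (carrier (E (D A)))"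
    unfolding bij_betw_def
  proof
    show "inj_on ?e (carrier A)"
    proof (rule inj_onI)
      fix a a' assume a: "a \<in> carrier A" "a' \<in> carrier A" and "?e a = ?e a'"
      then show "a = a'" by (intro separating_pointsD[OF A'(2) a]) (metis e restrict_apply')
    qed
    show "?e ` carrier A = carrier (E (D A))"
      using eE thom_eq_element[OF b D_separates_order[OF A'(1)]] e by fastforce
  qed
  show ?thesis
  proof (rule isomI(4)[OF _ hom A'(1) bij _ refl])
    show "rel (E (D A)) r \<subseteq> tuples (relar \<Sigma>1 r) (carrier (E (D A)))" if "r \<in> rels \<Sigma>1" for r
      using rel_tuples[OF E_struc[OF D_struc(1,2)[OF A'(1)]] that] by blast
    fix r x assume r: "r \<in> rels \<Sigma>1" and x: "x \<in> tuples (relar \<Sigma>1 r) (carrier A)"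
      and R: "compose {..<relar \<Sigma>1 r} ?e x \<in> rel (E (D A)) r"
    have ex: "compose {..<relar \<Sigma>1 r} ?e x \<in> tuples (relar \<Sigma>1 r) (thom \<Sigma>2 (D A) Mt)"
      by (rule tuples_compose[OF _ x]) (use eE in auto)
    show "x \<in> rel A r"
    proof (rule separating_relD[OF A'(2) r x])
      fix h assume h: "h \<in> hom \<Sigma>1 A M"
      have "compose {..<relar \<Sigma>1 r} h x = (\<lambda>i\<in>{..<relar \<Sigma>1 r}. compose {..<relar \<Sigma>1 r} ?e x i h)"
        unfolding compose_def by (rule restrict_ext) (use tuples_nth[OF x] h e in simp)
      then show "compose {..<relar \<Sigma>1 r} h x \<in> rel M r"
        using R h by (simp add: E_rel_iff[OF r ex] del: restrict_apply)
    qed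
  qed
qed

lemma eval_eps_thom:
  assumes X: "is_struc \<Sigma>2 X" "topspace (topo X) = carrier X" "compact_space (topo X)"
  shows "eval_eps \<Sigma>2 Mt X \<in> thom \<Sigma>2 X (D (E X))"
proof -
  note b = bim_E[OF X]
  let ?e = "eval_eps \<Sigma>2 Mt X"
  have eD: "?e x \<in> hom \<Sigma>1 (E X) M" if "x \<in> carrier X" for x
    using bimD(5)[OF b that] that by (simp add: eval_eps_def)
  have "?e \<in> hom \<Sigma>2 X (pow_struc \<Sigma>2 Mt (thom \<Sigma>2 X Mt))"
    unfolding eval_eps_def by (rule prod_hom[OF X(1)]) (rule thom_hom)
  then have hom: "?e \<in> hom \<Sigma>2 X (restr \<Sigma>2 (pow_struc \<Sigma>2 Mt (carrier (E X))) (hom \<Sigma>1 (E X) M))"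
    unfolding dualE_carrier by (rule hom_into_restr[OF X(1)]) (use eD in auto)
  have "continuous_map (topo X) (topo Mt) (\<lambda>x. ?e x \<alpha>)" if "\<alpha> \<in> thom \<Sigma>2 X Mt" for \<alpha>
    by (rule continuous_map_eq[OF thom_continuous[OF that]]) (simp add: eval_eps_def X(2) that)
  then have "continuous_map (topo X) (product_topology (\<lambda>_. topo Mt) (carrier (E X))) ?e"
    by (auto simp: continuous_map_componentwise X(2) eval_eps_def)
  then show ?thesis
    using hom eD X(2)
    unfolding dualD_def thom_trestr_pow by (auto simp: continuous_map_in_subtopology)
qed

text \<open>As on the algebraic side, separation of \<open>X\<close> gives injectivity and
  reflection of relations; surjectivity is \<open>hom_eq_point\<close> for the pairing of
  \<open>E X\<close> with \<open>X\<close>. Compactness then takes care of the inverse.\<close>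

lemma tisom_eval_eps:
  assumes X: "X \<in> IScP \<Sigma>2 Mt"
  shows "tisom \<Sigma>2 X (D (E X)) (eval_eps \<Sigma>2 Mt X)"
proof -
  note X' = IScP_D[OF total_Mt X]
  note b = bim_E[OF X'(1-3)] and EX = E_struc[OF X'(1,2)]
  let ?e = "eval_eps \<Sigma>2 Mt X"
  have e: "?e x = (\<lambda>\<alpha>\<in>thom \<Sigma>2 X Mt. \<alpha> x)" if "x \<in> carrier X" for x
    using that by (simp add: eval_eps_def)
  have eD: "?e x \<in> hom \<Sigma>1 (E X) M" if "x \<in> carrier X" for x
    using bimD(5)[OF b that] e[OF that] by simp
  \<comment> \<open>Elements of \<open>E X\<close> are extensional functions on \<open>X\<close>, so
    the points of \<open>X\<close> separate them.\<close>
  have E_sep: "\<alpha> = \<beta>" if "\<alpha> \<in> carrier (E X)" "\<beta> \<in> carrier (E X)"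
    and "\<And>x. x \<in> carrier X \<Longrightarrow> \<alpha> x = \<beta> x" for \<alpha> \<beta>
    using that by (intro PiE_ext[OF hom_PiE[OF thom_hom] hom_PiE[OF thom_hom]]) auto
  have bij: "bij_betw ?e (carrier X) (carrier (D (E X)))"
    unfolding bij_betw_def
  proof
    show "inj_on ?e (carrier X)"
    proof (rule inj_onI)
      fix x y assume x: "x \<in> carrier X" "y \<in> carrier X" and "?e x = ?e y"
      then show "x = y" by (intro separating_pointsD[OF X'(4) x]) (metis e restrict_apply')
    qed
    show "?e ` carrier X = carrier (D (E X))"
      using eD hom_eq_point[OF b E_sep] e by fastforce
  qed
  show ?thesis
  proof (rule tisomI[OF X'(1-3) D_struc(1,2,4)[OF EX] eval_eps_thom[OF X'(1-3)] bij])
    fix r x assume r: "r \<in> rels \<Sigma>2" and x: "x \<in> tuples (relar \<Sigma>2 r) (carrier X)"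
      and R: "compose {..<relar \<Sigma>2 r} ?e x \<in> rel (D (E X)) r"
    have ex: "compose {..<relar \<Sigma>2 r} ?e x \<in> tuples (relar \<Sigma>2 r) (hom \<Sigma>1 (E X) M)"
      by (rule tuples_compose[OF _ x]) (use eD in auto)
    show "x \<in> rel X r"
    proof (rule separating_relD[OF X'(4) r x])
      fix \<alpha> assume \<alpha>: "\<alpha> \<in> thom \<Sigma>2 X Mt"
      have "compose {..<relar \<Sigma>2 r} \<alpha> x = (\<lambda>i\<in>{..<relar \<Sigma>2 r}. compose {..<relar \<Sigma>2 r} ?e x i \<alpha>)"
        unfolding compose_def by (rule restrict_ext) (use tuples_nth[OF x] \<alpha> e in simp)
      then show "compose {..<relar \<Sigma>2 r} \<alpha> x \<in> rel Mt r"
        using R \<alpha> by (simp add: D_rel_iff[OF r ex] del: restrict_apply)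
    qed
  qed
qed

section \<open>Extending morphisms along embeddings\<close>

text \<open>The pairing of \<open>B\<close> with its dual is pulled back along \<open>j\<close>.
  Injectivity of \<open>j\<close> keeps the elements of \<open>A\<close> separated, so
  \<open>h\<close> is the section at some point of the dual of \<open>B\<close>; that point is
  itself the extension.\<close>

lemma extend_hom:
  fixes A :: "('a, 'f, 'r) struc"
  assumes A: "is_struc \<Sigma>1 A" and B: "B \<in> ISP \<Sigma>1 M" and j: "j \<in> hom \<Sigma>1 A B"
    and inj: "inj_on j (carrier A)" and h: "h \<in> hom \<Sigma>1 A M"
  shows "\<exists>k\<in>hom \<Sigma>1 B M. \<forall>a\<in>carrier A. k (j a) = h a"
proof -
  note B' = ISP_D[OF M B]
  have "a = a'" if a: "a \<in> carrier A" "a' \<in> carrier A"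
    and eq: "\<And>x. x \<in> carrier (D B) \<Longrightarrow> x (j a) = x (j a')" for a a'
  proof (rule inj_onD[OF inj _ a])
    show "j a = j a'"
      by (rule separating_pointsD[OF B'(2)]) (use eq PiE_mem[OF hom_PiE[OF j]] a in auto)
  qed
  from hom_eq_point[OF bimorphism_pull_left[OF bim_D[OF B'(1)] A j] this h]
  show ?thesis by fastforce
qed

text \<open>The pairing of \<open>E Y\<close> with \<open>Y\<close> is pulled back along
  \<open>j\<close>; the element of \<open>E Y\<close> that represents \<alpha> on \<open>X\<close>
  is the extension.\<close>

lemma extend_thom:
  assumes X: "is_struc \<Sigma>2 X" "topspace (topo X) = carrier X" "compact_space (topo X)"
    and Y: "Y \<in> IScP \<Sigma>2 Mt" and j: "j \<in> thom \<Sigma>2 X Y" and sep: "separating \<Sigma>2 X Y {j}"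
    and \<alpha>: "\<alpha> \<in> thom \<Sigma>2 X Mt"
  shows "\<exists>\<beta>\<in>thom \<Sigma>2 Y Mt. \<forall>x\<in>carrier X. \<beta> (j x) = \<alpha> x"
proof -
  note Y' = IScP_D[OF total_Mt Y]
  have "pair x y \<in> rel (ord_reduct \<Phi> X) ()" if x: "x \<in> carrier X" "y \<in> carrier X"
    and le: "\<And>\<beta>. \<beta> \<in> carrier (E Y) \<Longrightarrow> le (\<beta> (j x)) (\<beta> (j y))" for x y
  proof -
    \<comment> \<open>\<open>E Y\<close> decides the order between the images in \<open>Y\<close>;
      the formulas in \<Phi> then pass back along \<open>j\<close>, since \<open>j\<close> alone
      separates \<open>X\<close>.\<close>
    have "pair (j x) (j y) \<in> rel (ord_reduct \<Phi> Y) ()"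
      by (rule IScP_separates_order[OF Y]) (use le PiE_mem[OF hom_PiE[OF thom_hom[OF j]]] x in auto)
    then show ?thesis
      using thom_hom[OF j] by (intro separating_ord_reduct[OF X(1) \<Phi> sep _ x]) auto
  qed
  from thom_eq_element[OF bimorphism_pull_right[OF bim_E[OF Y'(1-3)] X j] this \<alpha>]
  show ?thesis by fastforce
qed

lemma injective_M: "injective_ISP TYPE('a) TYPE('b) \<Sigma>1 M"
  unfolding injective_ISP_def
proof (intro ballI allI impI, elim conjE)
  fix A :: "('a, 'f, 'r) struc" and B :: "('b, 'f, 'r) struc" and j h
  assume A: "A \<in> ISP \<Sigma>1 M" and B: "B \<in> ISP \<Sigma>1 M" and "embedding \<Sigma>1 A B j"
    and h: "h \<in> hom \<Sigma>1 A M"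
  then obtain N k where N: "N \<subseteq> carrier B" and j: "j \<in> hom \<Sigma>1 A (restr \<Sigma>1 B N)"
    and kj: "\<forall>a\<in>carrier A. k (j a) = a"
    unfolding embedding_def isom_def forms_substruc_def closed_under_def by blast
  show "\<exists>k\<in>hom \<Sigma>1 B M. \<forall>a\<in>carrier A. k (j a) = h a"
    by (rule extend_hom[OF ISP_D(1)[OF M A] B hom_from_restr_codomain[OF j N] inj_on_inverseI h])
       (use kj in auto)
qed

lemma injective_Mt: "injective_IScP TYPE('x) TYPE('y) \<Sigma>2 Mt"
  unfolding injective_IScP_def
proof (intro ballI allI impI, elim conjE)
  fix X :: "('x, 'g, 's) tstruc" and Y :: "('y, 'g, 's) tstruc" and j \<alpha>
  assume X: "X \<in> IScP \<Sigma>2 Mt" and Y: "Y \<in> IScP \<Sigma>2 Mt" and "tembedding \<Sigma>2 X Y j"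
    and \<alpha>: "\<alpha> \<in> thom \<Sigma>2 X Mt"
  then obtain N k where N: "closed_under \<Sigma>2 Y N" and j: "j \<in> thom \<Sigma>2 X (trestr \<Sigma>2 Y N)"
    and k: "k \<in> thom \<Sigma>2 (trestr \<Sigma>2 Y N) X" and kj: "\<forall>x\<in>carrier X. k (j x) = x"
    unfolding tembedding_def tisom_def forms_closed_tsubstruc_def by blast
  have NY: "N \<subseteq> carrier Y" using N by (simp add: closed_under_def)
  note X' = IScP_D[OF total_Mt X] and Y' = IScP_D[OF total_Mt Y]
  have j_restr: "j \<in> hom \<Sigma>2 X (restr \<Sigma>2 Y N)" and k_restr: "k \<in> hom \<Sigma>2 (restr \<Sigma>2 Y N) X"
    using thom_hom[OF j] thom_hom[OF k] by (simp_all add: hom_def)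
  have jY: "j \<in> thom \<Sigma>2 X Y"
    using hom_from_restr_codomain[OF j_restr NY] thom_continuous[OF j]
    by (simp add: thom_def continuous_map_in_subtopology)
  \<comment> \<open>The left inverse \<open>k\<close> on the image recovers points, and being a
    homomorphism it recovers relations too.\<close>
  have "separating \<Sigma>2 X Y {j}"
    unfolding separating_def
  proof (intro conjI ballI impI)
    show "x = y" if "x \<in> carrier X" "y \<in> carrier X" "\<forall>h\<in>{j}. h x = h y" for x y
      using that kj by (metis singletonI)
    fix r p assume r: "r \<in> rels \<Sigma>2" and p: "p \<in> tuples (relar \<Sigma>2 r) (carrier X)"
      and R: "\<forall>h\<in>{j}. compose {..<relar \<Sigma>2 r} h p \<in> rel Y r"
    have "compose {..<relar \<Sigma>2 r} j p \<in> tuples (relar \<Sigma>2 r) N"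
      using hom_PiE[OF j_restr] by (intro tuples_compose[OF _ p]) auto
    then have "compose {..<relar \<Sigma>2 r} k (compose {..<relar \<Sigma>2 r} j p) \<in> rel X r"
      using R by (intro hom_rel[OF k_restr r]) simp
    moreover have "compose {..<relar \<Sigma>2 r} k (compose {..<relar \<Sigma>2 r} j p) = p"
      by (rule ext) (use p kj in \<open>auto simp: compose_def PiE_iff extensional_def\<close>)
    ultimately show "p \<in> rel X r" by simp
  qed
  then show "\<exists>\<beta>\<in>thom \<Sigma>2 Y Mt. \<forall>x\<in>carrier X. \<beta> (j x) = \<alpha> x"
    by (rule extend_thom[OF X'(1-3) Y jY _ \<alpha>])
qed

section \<open>The reducts of the dual structures\<close>

text \<open>Bijectivity is \<open>hom_eqI\<close> with \<open>lat_hom_eq_point\<close>, and the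
  order is reflected by \<open>hom_le\<close>; continuity of the inverse again comes from
  compactness.\<close>

lemma tisom_D_reduct:
  assumes A: "A \<in> ISP \<Sigma>1 M"
  shows "tisom sigP (ord_reduct \<Phi> (D A)) (dualH (lat_reduct \<tau> A))
    (\<lambda>x\<in>hom \<Sigma>1 A M. compose (carrier A) \<omega> x)"
    (is "tisom _ ?X ?Y ?h")
proof -
  note A' = ISP_D[OF M A]
  note b = bim_D[OF A'(1)] and DA = D_struc[OF A'(1)]
  have hY: "?h x \<in> hom sigD (lat_reduct \<tau> A) latD" if "x \<in> hom \<Sigma>1 A M" for x
    using \<omega>_hom_compose[OF A'(1) that] that by simp
  \<comment> \<open>The map is the product of the order-preserving maps that send \<open>x\<close>
    to \<open>\<omega> (x a)\<close>.\<close>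
  have "(\<lambda>x\<in>carrier ?X. \<lambda>a\<in>carrier A. (\<lambda>x\<in>carrier (D A). \<omega> (x a)) x)
      \<in> hom sigP ?X (pow_struc sigP chainD (carrier A))"
    by (rule prod_hom[OF is_struc_ord_reduct]) (rule thom_hom[OF bim_\<omega>(2)[OF b]])
  moreover have "(\<lambda>x\<in>carrier ?X. \<lambda>a\<in>carrier A. (\<lambda>x\<in>carrier (D A). \<omega> (x a)) x) = ?h"
    by (auto simp: fun_eq_iff compose_def)
  ultimately have "?h \<in> hom sigP ?X (pow_struc sigP chainD (carrier A))" by simp
  then have hom: "?h \<in> hom sigP ?X
      (restr sigP (pow_struc sigP chainD (carrier A)) (hom sigD (lat_reduct \<tau> A) latD))"
    by (rule hom_into_restr[OF is_struc_ord_reduct]) (use hY in auto)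
  have "continuous_map (topo ?X) (discrete_topology UNIV) (\<lambda>x. ?h x a)" if "a \<in> carrier A" for a
    by (rule continuous_map_eq) (use bim_continuous[OF b that] DA(2) that in \<open>auto simp: compose_def\<close>)
  then have "continuous_map (topo ?X) (topo ?Y) ?h"
    using hY DA(2)
    by (auto simp: continuous_map_in_subtopology continuous_map_componentwise compose_def)
  then have h: "?h \<in> thom sigP ?X ?Y"
    using hom by (simp add: dualD_def[of sigD] thom_trestr_pow)
  have bij: "bij_betw ?h (carrier ?X) (carrier ?Y)"
    unfolding bij_betw_def
  proof
    show "inj_on ?h (carrier ?X)"
    proof (rule inj_onI)
      fix x y assume "x \<in> carrier ?X" "y \<in> carrier ?X" and eq: "?h x = ?h y"
      then have x: "x \<in> hom \<Sigma>1 A M" and y: "y \<in> hom \<Sigma>1 A M" by simp_all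
      have "compose (carrier A) \<omega> x = compose (carrier A) \<omega> y" using eq x y by simp
      then show "x = y"
        by (intro hom_eqI[OF A'(1) x y]) (metis compose_eq)
    qed
    have "\<phi> \<in> ?h ` hom \<Sigma>1 A M" if \<phi>: "\<phi> \<in> hom sigD (lat_reduct \<tau> A) latD" for \<phi>
    proof -
      have "\<exists>x\<in>carrier (D A). \<forall>a\<in>carrier A. \<phi> a = \<omega> (x a)"
        by (rule lat_hom_eq_point[OF b _ \<phi>], rule separating_pointsD[OF A'(2)]) simp_all
      then obtain x where x: "x \<in> hom \<Sigma>1 A M" and eq: "\<forall>a\<in>carrier A. \<phi> a = \<omega> (x a)" by auto
      have "\<phi> = ?h x"
        by (rule extensionalityI[of _ "carrier A"])
           (use x eq PiE_iff[THEN iffD1, OF hom_PiE[OF \<phi>]] in \<open>simp_all add: compose_def\<close>)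
      with x show ?thesis by blast
    qed
    then show "?h ` carrier ?X = carrier ?Y" using hY by auto
  qed
  show ?thesis
  proof (rule tisomI[OF is_struc_ord_reduct _ _ _ _ _ h bij])
    show "topspace (topo ?X) = carrier ?X" "compact_space (topo ?X)" using DA(2,3) by simp_all
    show "is_struc sigP ?Y" by (simp add: is_struc_def dualD_def)
    show "topspace (topo ?Y) = carrier ?Y"
      using hom_PiE[of _ sigD "lat_reduct \<tau> A" latD] by auto
    show "Hausdorff_space (topo ?Y)"
      by (simp add: Hausdorff_space_product_topology Hausdorff_space_subtopology)
    fix r p assume "p \<in> tuples (relar sigP r) (carrier ?X)"
      and R: "compose {..<relar sigP r} ?h p \<in> rel ?Y r"
    then have "p \<in> tuples 2 (hom \<Sigma>1 A M)" by simp
    then obtain x y where p: "p = pair x y" and x: "x \<in> hom \<Sigma>1 A M" and y: "y \<in> hom \<Sigma>1 A M"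
      using tuples_2_eq by (metis pair_tuples)
    \<comment> \<open>The order of the Priestley dual is pointwise; it is read off at coordinate
      \<open>a\<close>.\<close>
    have "\<omega> (x a) \<longrightarrow> \<omega> (y a)" if a: "a \<in> carrier A" for a
    proof -
      have "(\<lambda>i\<in>{..<2}. compose {..<2} ?h p i a) \<in> rel chainD r"
        using R a by (simp add: dualD_def pow_struc_def)
      moreover have "(\<lambda>i\<in>{..<2}. compose {..<2} ?h p i a) = pair (\<omega> (x a)) (\<omega> (y a))"
        using x y a by (auto simp: p compose_pair pair_def compose_def fun_eq_iff)
      ultimately show ?thesis using pair_chainD by (cases r) simp
    qed
    then have "pair x y \<in> rel ?X ()"
      by (intro D_separates_order[OF A'(1) x y] hom_le[OF A'(1) x y]) auto
    then show "p \<in> rel ?X r" by (cases r) (simp add: p)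
  qed
qed

text \<open>The mirror image, with \<open>thom_eqI\<close> for injectivity and
  \<open>Priestley_map_eq_element\<close> for surjectivity.\<close>

lemma isom_E_reduct:
  assumes X: "X \<in> IScP \<Sigma>2 Mt"
  shows "isom sigD (lat_reduct \<tau> (E X)) (dualK (ord_reduct \<Phi> X))
    (\<lambda>\<alpha>\<in>thom \<Sigma>2 X Mt. compose (carrier X) \<omega> \<alpha>)"
    (is "isom _ ?A ?B ?h")
proof -
  note X' = IScP_D[OF total_Mt X]
  note b = bim_E[OF X'(1-3)]
  have EX: "is_struc sigD ?A"
    by (rule is_struc_lat_reduct[OF E_struc[OF X'(1,2)] \<tau>])
  have hB: "?h \<alpha> \<in> thom sigP (ord_reduct \<Phi> X) chainD" if "\<alpha> \<in> thom \<Sigma>2 X Mt" for \<alpha>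
    using \<omega>_thom_compose[OF X'(1,2) that] that by simp
  have "(\<lambda>\<alpha>\<in>carrier ?A. \<lambda>x\<in>carrier X. (\<lambda>\<alpha>\<in>carrier (E X). \<omega> (\<alpha> x)) \<alpha>)
      \<in> hom sigD ?A (pow_struc sigD latD (carrier X))"
    by (rule prod_hom[OF EX]) (rule bim_\<omega>(1)[OF b])
  moreover have "(\<lambda>\<alpha>\<in>carrier ?A. \<lambda>x\<in>carrier X. (\<lambda>\<alpha>\<in>carrier (E X). \<omega> (\<alpha> x)) \<alpha>) = ?h"
    by (auto simp: fun_eq_iff compose_def)
  ultimately have "?h \<in> hom sigD ?A (pow_struc sigD latD (carrier X))" by simp
  then have h: "?h \<in> hom sigD ?A ?B"
    unfolding dualE_def[of sigD] ord_reduct_simps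
    by (rule hom_into_restr[OF EX]) (use hB in auto)
  have bij: "bij_betw ?h (carrier ?A) (carrier ?B)"
    unfolding bij_betw_def
  proof
    show "inj_on ?h (carrier ?A)"
    proof (rule inj_onI)
      fix \<alpha> \<beta> assume "\<alpha> \<in> carrier ?A" "\<beta> \<in> carrier ?A" and eq: "?h \<alpha> = ?h \<beta>"
      then have \<alpha>: "\<alpha> \<in> thom \<Sigma>2 X Mt" and \<beta>: "\<beta> \<in> thom \<Sigma>2 X Mt" by simp_all
      have "compose (carrier X) \<omega> \<alpha> = compose (carrier X) \<omega> \<beta>" using eq \<alpha> \<beta> by simp
      then show "\<alpha> = \<beta>"
        by (intro thom_eqI[OF X'(1) \<alpha> \<beta>]) (metis compose_eq)
    qed
    have "f \<in> ?h ` thom \<Sigma>2 X Mt" if f: "f \<in> thom sigP (ord_reduct \<Phi> X) chainD" for f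
    proof -
      have "\<exists>\<alpha>\<in>carrier (E X). \<forall>x\<in>carrier X. f x = \<omega> (\<alpha> x)"
        by (rule Priestley_map_eq_element[OF b _ f], rule IScP_separates_order[OF X]) simp_all
      then obtain \<alpha> where \<alpha>: "\<alpha> \<in> thom \<Sigma>2 X Mt" and eq: "\<forall>x\<in>carrier X. f x = \<omega> (\<alpha> x)" by auto
      have "f = ?h \<alpha>"
        by (rule extensionalityI[of _ "carrier X"])
           (use \<alpha> eq PiE_iff[THEN iffD1, OF hom_PiE[OF thom_hom[OF f]]] in \<open>simp_all add: compose_def\<close>)
      with \<alpha> show ?thesis by blast
    qed
    then show "?h ` carrier ?A = carrier ?B" using hB by auto
  qed
  \<comment> \<open>The lattice signature has no relation symbols, so the conditions on relations
    are vacuous.\<close>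
  show ?thesis by (rule isomI(4)[OF _ h EX bij _ refl]) simp_all
qed

end

theorem theorem4p4:
  fixes \<Sigma>1 :: "('f, 'r) signature" and M :: "('m, 'f, 'r) struc"
    and \<Sigma>2 :: "('g, 's) signature" and Mt :: "('m, 'g, 's) tstruc"
    and \<tau> :: "dl_op \<Rightarrow> 'f trm" and \<Phi> :: "('g, 's) atom list" and \<omega> :: "'m \<Rightarrow> bool"
  assumes "total_struc \<Sigma>1 M" and "total_tstruc \<Sigma>2 Mt" and "alter_ego \<Sigma>1 M \<Sigma>2 Mt"
    and "D_based \<Sigma>1 M \<tau>"
    and "\<forall>\<phi>\<in>set \<Phi>. wf_atom \<Sigma>2 2 \<phi>" and "ord_reduct \<Phi> Mt \<in> Priestley"
    and "\<omega> \<in> hom sigD (lat_reduct \<tau> M) latD \<inter> thom sigP (ord_reduct \<Phi> Mt) chainD"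
    and "\<forall>r. maximal_in \<Sigma>1 M (preimage_le (carrier M) \<omega>) r \<longrightarrow>
               entails TYPE(nat \<Rightarrow> 'm) \<Sigma>1 M \<Sigma>2 Mt 2 r"
    and "separates_points ((\<circ>) \<omega> ` Clo1 \<Sigma>2 Mt) (carrier M)"
    and "\<forall>a\<in>carrier M. \<forall>b\<in>carrier M. pair a b \<notin> rel (ord_reduct \<Phi> Mt) () \<longrightarrow>
           (\<exists>t\<in>Clo1 \<Sigma>1 M. \<omega> (t a) = True \<and> \<omega> (t b) = False)"
  shows
    "fully_dualises TYPE('a) TYPE('x) \<Sigma>1 M \<Sigma>2 Mt \<and>
     injective_ISP TYPE('a) TYPE('b) \<Sigma>1 M \<and>
     injective_IScP TYPE('x) TYPE('y) \<Sigma>2 Mt \<and>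
     strongly_dualises TYPE('a) TYPE('x) TYPE('y) \<Sigma>1 M \<Sigma>2 Mt \<and>
     (\<forall>(A :: ('a, 'f, 'r) struc)\<in>ISP \<Sigma>1 M.
        tisom sigP (ord_reduct \<Phi> (dualD \<Sigma>1 M \<Sigma>2 Mt A)) (dualH (lat_reduct \<tau> A))
          (\<lambda>x\<in>hom \<Sigma>1 A M. compose (carrier A) \<omega> x)) \<and>
     (\<forall>(X :: ('x, 'g, 's) tstruc)\<in>IScP \<Sigma>2 Mt.
        isom sigD (lat_reduct \<tau> (dualE \<Sigma>1 M \<Sigma>2 Mt X)) (dualK (ord_reduct \<Phi> X))
          (\<lambda>\<alpha>\<in>thom \<Sigma>2 X Mt. compose (carrier X) \<omega> \<alpha>))"
proof -
  interpret piggyback \<Sigma>1 M \<Sigma>2 Mt \<tau> \<Phi> \<omega>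
    by unfold_locales (use assms in \<open>auto simp: D_based_def\<close>)
  \<comment> \<open>The locale facts are polymorphic in the carrier types of \<open>A\<close> and
    \<open>X\<close>, so they apply at the given types.\<close>
  have "fully_dualises TYPE('a) TYPE('x) \<Sigma>1 M \<Sigma>2 Mt"
    by (simp add: fully_dualises_def isom_eval_e tisom_eval_eps)
  then show ?thesis
    by (simp add: strongly_dualises_def injective_M injective_Mt tisom_D_reduct isom_E_reduct)
qed

end
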